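(* Let $X$ be a mixing one-dimensional subshift of finite type with at least two points. Then the stabilized inert automorphism group $\mathrm{SIAut}(X)$ is simple, and it is the unique minimal non-trivial normal subgroup of the stabilized automorphism group $\mathrm{SAut}(X)$.
   Context: A one-dimensional subshift is a nonempty closed shift-invariant set $X\subset\Sigma^{\mathbb Z}$, $\Sigma$ a finite alphabet, with the shift $\sigma(x)_i=x_{i+1}$. It is a subshift of finite type (SFT) if $X=\bigcap_{n\in\mathbb Z}\sigma^n(C)$ for some clopen $C\subset\Sigma^{\mathbb Z}$. The edge shift of a finite directed multigraph $(V,E)$ (every vertex having positive in- and out-degree) is the set of bi-infinite paths $p:\mathbb Z\to E$ in which the edge $p(n)$ ends where $p(n+1)$ begins; every SFT is topologically conjugate to an edge shift. An SFT is mixing if it is topologically conjugate to an edge shift whose adjacency matrix is primitive (some power has all entries positive); equivalently, it is topologically mixing. If $(X,\sigma)$ is a mixing SFT then so is $(X,\sigma^n)$ for every $n\ge1$ (up to topological conjugacy). $\mathrm{Aut}(X,\sigma^n)$ is the group of homeomorphisms $X\to X$ commuting with $\sigma^n$, and $\mathrm{SAut}(X)=\bigcup_{n\ge1}\mathrm{Aut}(X,\sigma^n)$. Inertness: an automorphism of a mixing SFT is inert if it acts trivially on Krieger's dimension group. Concretely, for an edge shift $Y$ with vertex set $V$: an $m$-ray is a set $R(x,m)=\{y\in Y: y_i=x_i\ \forall i\le m\}$ ($x\in Y$), which is said to end at the terminal vertex of $x_m$; an $m$-beam is a finite (possibly empty) union of $m$-rays; every $m$-beam is an $m'$-beam for all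 $m'\ge m$. For an $m$-beam $U$ let $v_{U,m}\in\mathbb Z^V$ have $I$-th entry the number of $m$-rays contained in $U$ ending at $I$. Two beams $U,U'$ are equivalent if $v_{U,m}=v_{U',m}$ for some $m$ for which both are $m$-beams. The classes of beams form the positive cone generating the dimension group, and an automorphism $f$ of $Y$ acts by $[U]\mapsto[f(U)]$; so $f$ is inert iff $f(U)$ is equivalent to $U$ for every beam $U$. Inertness of an automorphism of an arbitrary mixing SFT is defined by conjugating to an edge shift (the choice does not matter); for $f\in\mathrm{Aut}(X,\sigma^n)$ this is applied to the mixing SFT $(X,\sigma^n)$. $\mathrm{SIAut}(X)$ is the subgroup of $\mathrm{SAut}(X)$ generated by all inert automorphisms of $(X,\sigma^n)$, over all $n\ge1$. "Unique minimal non-trivial normal subgroup" (the monolith) means a non-trivial normal subgroup contained in every non-trivial normal subgroup. *)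

theory Defs
  imports "HOL-Analysis.Analysis" "HOL-Algebra.Bij" "HOL-Algebra.Generated_Groups"
    "Graph_Theory.Digraph"
begin

definition shift_by :: "int \<Rightarrow> (int \<Rightarrow> 'a) \<Rightarrow> (int \<Rightarrow> 'a)" where
  "shift_by n x = (\<lambda>i. x (i + n))"

text \<open>The shift map \<open>\<sigma>\<close> is \<open>shift_by 1\<close>, and \<open>shift_by n\<close> is its \<open>n\<close>-th power, \<open>n\<close> any integer.\<close>

definition full_shift :: "'a set \<Rightarrow> (int \<Rightarrow> 'a) set" where
  "full_shift A = {x. range x \<subseteq> A}"

text \<open>
  The subspace topology on \<open>X\<close>. If \<open>X \<subseteq> full_shift A\<close>, this is also the topology induced by the
  product topology on \<open>full_shift A\<close>, so the alphabet need not be mentioned.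
\<close>
definition shift_topology :: "(int \<Rightarrow> 'a) set \<Rightarrow> (int \<Rightarrow> 'a) topology" where
  "shift_topology X = subtopology (product_topology (\<lambda>_. discrete_topology UNIV) UNIV) X"

definition subshift :: "'a set \<Rightarrow> (int \<Rightarrow> 'a) set \<Rightarrow> bool" where
  "subshift A X \<longleftrightarrow>
     finite A \<and> X \<noteq> {} \<and> closedin (shift_topology (full_shift A)) X \<and> shift_by 1 ` X = X"

definition SFT :: "'a set \<Rightarrow> (int \<Rightarrow> 'a) set \<Rightarrow> bool" where
  "SFT A X \<longleftrightarrow> subshift A X \<and>
     (\<exists>C. openin (shift_topology (full_shift A)) C \<and> closedin (shift_topology (full_shift A)) C \<and>
          X = (\<Inter>n. shift_by n ` C))"

definition conjugacy ::
  "'a topology \<Rightarrow> ('a \<Rightarrow> 'a) \<Rightarrow> 'b topology \<Rightarrow> ('b \<Rightarrow> 'b) \<Rightarrow> ('a \<Rightarrow> 'b) \<Rightarrow> bool" where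
  "conjugacy S f T g h \<longleftrightarrow> homeomorphic_map S T h \<and> (\<forall>x\<in>topspace S. h (f x) = g (h x))"

definition essential_graph :: "('v, 'e) pre_digraph \<Rightarrow> bool" where
  "essential_graph G \<longleftrightarrow>
     fin_digraph G \<and> (\<forall>v\<in>verts G. in_degree G v > 0 \<and> out_degree G v > 0)"

definition edge_shift :: "('v, 'e) pre_digraph \<Rightarrow> (int \<Rightarrow> 'e) set" where
  "edge_shift G = {p. \<forall>n. p n \<in> arcs G \<and> head G (p n) = tail G (p (n + 1))}"

definition adj_matrix :: "('v, 'e) pre_digraph \<Rightarrow> 'v \<Rightarrow> 'v \<Rightarrow> nat" where
  "adj_matrix G u v = card {e \<in> arcs G. tail G e = u \<and> head G e = v}"

text \<open>Powers of the adjacency matrix, viewed as a square matrix indexed by \<open>verts G\<close>.\<close>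

primrec adj_power :: "('v, 'e) pre_digraph \<Rightarrow> nat \<Rightarrow> 'v \<Rightarrow> 'v \<Rightarrow> nat" where
  "adj_power G 0 u w = (if u = w then 1 else 0)"
| "adj_power G (Suc k) u w = (\<Sum>v\<in>verts G. adj_matrix G u v * adj_power G k v w)"

definition primitive_graph :: "('v, 'e) pre_digraph \<Rightarrow> bool" where
  "primitive_graph G \<longleftrightarrow> (\<exists>k\<ge>1. \<forall>u\<in>verts G. \<forall>w\<in>verts G. adj_power G k u w > 0)"

text \<open>
  Every finite directed multigraph is isomorphic to one whose vertices and edges are natural
  numbers, so it suffices to quantify over these.
\<close>
definition mixing_SFT :: "'a set \<Rightarrow> (int \<Rightarrow> 'a) set \<Rightarrow> bool" where
  "mixing_SFT A X \<longleftrightarrow> SFT A X \<and>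
     (\<exists>(G :: (nat, nat) pre_digraph) h. essential_graph G \<and> primitive_graph G \<and>
        conjugacy (shift_topology X) (shift_by 1) (shift_topology (edge_shift G)) (shift_by 1) h)"

definition ray :: "('v, 'e) pre_digraph \<Rightarrow> (int \<Rightarrow> 'e) \<Rightarrow> int \<Rightarrow> (int \<Rightarrow> 'e) set" where
  "ray G x m = {y \<in> edge_shift G. \<forall>i\<le>m. y i = x i}"

definition is_beam_at :: "('v, 'e) pre_digraph \<Rightarrow> int \<Rightarrow> (int \<Rightarrow> 'e) set \<Rightarrow> bool" where
  "is_beam_at G m U \<longleftrightarrow> (\<exists>F. finite F \<and> F \<subseteq> edge_shift G \<and> U = (\<Union>x\<in>F. ray G x m))"

definition is_beam :: "('v, 'e) pre_digraph \<Rightarrow> (int \<Rightarrow> 'e) set \<Rightarrow> bool" where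
  "is_beam G U \<longleftrightarrow> (\<exists>m. is_beam_at G m U)"

text \<open>Rays are counted as sets, not by the points representing them.\<close>

definition beam_vector :: "('v, 'e) pre_digraph \<Rightarrow> (int \<Rightarrow> 'e) set \<Rightarrow> int \<Rightarrow> 'v \<Rightarrow> int" where
  "beam_vector G U m v =
     int (card {ray G x m | x. x \<in> edge_shift G \<and> ray G x m \<subseteq> U \<and> head G (x m) = v})"

definition beam_equiv :: "('v, 'e) pre_digraph \<Rightarrow> (int \<Rightarrow> 'e) set \<Rightarrow> (int \<Rightarrow> 'e) set \<Rightarrow> bool" where
  "beam_equiv G U U' \<longleftrightarrow>
     (\<exists>m. is_beam_at G m U \<and> is_beam_at G m U' \<and>
          (\<forall>v\<in>verts G. beam_vector G U m v = beam_vector G U' m v))"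

definition inert_on_edge_shift ::
  "('v, 'e) pre_digraph \<Rightarrow> ((int \<Rightarrow> 'e) \<Rightarrow> (int \<Rightarrow> 'e)) \<Rightarrow> bool" where
  "inert_on_edge_shift G f \<longleftrightarrow> (\<forall>U. is_beam G U \<longrightarrow> beam_equiv G (f ` U) U)"

text \<open>
  As in \<^const>\<open>BijGroup\<close>, self-maps of \<open>X\<close> are represented by functions that are
  \<^const>\<open>undefined\<close> outside \<open>X\<close>, so that equality is equality on \<open>X\<close>.
\<close>
definition shift_Aut :: "(int \<Rightarrow> 'a) set \<Rightarrow> nat \<Rightarrow> ((int \<Rightarrow> 'a) \<Rightarrow> (int \<Rightarrow> 'a)) set" where
  "shift_Aut X n =
     {f \<in> Bij X. homeomorphic_map (shift_topology X) (shift_topology X) f \<and>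
                 (\<forall>x\<in>X. f (shift_by (int n) x) = shift_by (int n) (f x))}"

definition SAut :: "(int \<Rightarrow> 'a) set \<Rightarrow> ((int \<Rightarrow> 'a) \<Rightarrow> (int \<Rightarrow> 'a)) monoid" where
  "SAut X = (BijGroup X)\<lparr>carrier := (\<Union>n\<in>{1..}. shift_Aut X n)\<rparr>"

text \<open>
  Inertness is tested on an edge shift conjugate to \<open>(X, \<sigma>\<^sup>n)\<close>; it does not depend
  on the choice of the graph \<open>G\<close> and the conjugacy \<open>h\<close>.
\<close>
definition inert_Aut :: "(int \<Rightarrow> 'a) set \<Rightarrow> nat \<Rightarrow> ((int \<Rightarrow> 'a) \<Rightarrow> (int \<Rightarrow> 'a)) set" where
  "inert_Aut X n =
     {f \<in> shift_Aut X n.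
        \<exists>(G :: (nat, nat) pre_digraph) h. essential_graph G \<and>
          conjugacy (shift_topology X) (shift_by (int n))
            (shift_topology (edge_shift G)) (shift_by 1) h \<and>
          inert_on_edge_shift G (h \<circ> f \<circ> inv_into X h)}"

definition SIAut_carrier :: "(int \<Rightarrow> 'a) set \<Rightarrow> ((int \<Rightarrow> 'a) \<Rightarrow> (int \<Rightarrow> 'a)) set" where
  "SIAut_carrier X = generate (SAut X) (\<Union>n\<in>{1..}. inert_Aut X n)"

definition SIAut :: "(int \<Rightarrow> 'a) set \<Rightarrow> ((int \<Rightarrow> 'a) \<Rightarrow> (int \<Rightarrow> 'a)) monoid" where
  "SIAut X = (SAut X)\<lparr>carrier := SIAut_carrier X\<rparr>"

text \<open>
  The locale \<open>simple_group\<close> of \<open>HOL-Algebra.SimpleGroups\<close> cannot be used: it requires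
  \<open>order G > 1\<close>, which fails for every infinite group because \<^const>\<open>card\<close> of an infinite
  set is \<open>0\<close>.
\<close>
definition is_simple :: "('a, 'b) monoid_scheme \<Rightarrow> bool" where
  "is_simple G \<longleftrightarrow> group G \<and> carrier G \<noteq> {\<one>\<^bsub>G\<^esub>} \<and>
     (\<forall>N. N \<lhd> G \<longrightarrow> N = {\<one>\<^bsub>G\<^esub>} \<or> N = carrier G)"

definition is_monolith :: "'a set \<Rightarrow> ('a, 'b) monoid_scheme \<Rightarrow> bool" where
  "is_monolith M G \<longleftrightarrow> M \<lhd> G \<and> M \<noteq> {\<one>\<^bsub>G\<^esub>} \<and>
     (\<forall>N. N \<lhd> G \<and> N \<noteq> {\<one>\<^bsub>G\<^esub>} \<longrightarrow> M \<subseteq> N)"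

end

theory Submission
  imports Defs "HOL-Combinatorics.Permutations"
begin

text \<open>
  The proof identifies the stabilised inert group with a group that is visibly generated by local
  moves, and then shows that any nontrivial group normalised by these moves contains all of them.

  Membership in \<open>X\<close> is tested on windows of some length \<open>w + 1\<close>, so two points can be exchanged
  between two places where they agree on \<open>w\<close> consecutive coordinates. A \<^emph>\<open>gate\<close> permutes the words on
  a finite window while keeping the \<open>w\<close> outermost symbols on both sides; a \<^emph>\<open>lattice\<close> of gates applies
  one gate simultaneously at all positions of \<open>k\<int>\<close>, with disjoint windows. An automorphism \<open>f\<close> of some
  \<open>(X, \<sigma>\<^sup>n)\<close> is \<^emph>\<open>cuttable\<close> if some homeomorphism \<open>g\<close> acts as \<open>f\<close> far to the left and as the
  identity far to the right. Three implications lead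
  from inert automorphisms back to products of inert automorphisms.

  \<^item> Inert automorphisms are cuttable (\<open>inert_cuttable\<close>): equivalence of the beams \<open>R\<close> and \<open>f(R)\<close>, for
    every ray \<open>R\<close>, is a matching of the rays inside \<open>R\<close> with those inside \<open>f(R)\<close> that preserves
    terminal vertices. Replacing the beginning of a point according to the matching and keeping its
    tail acts as \<open>f\<close> on the left and as the identity on the right.

  \<^item> Cuttable automorphisms are products of two lattices of gates (\<open>cuttable_product_of_lattices\<close>): if
    \<open>g\<close> cuts \<open>f\<close> then \<open>(\<sigma>\<^sup>-\<^sup>k g \<sigma>\<^sup>k) g\<^sup>-\<^sup>1\<close> is a gate that acts as \<open>f\<close> between the two cuts. Its
    lattice of period \<open>2k\<close> removes \<open>f\<close> on half of every period, and what remains of \<open>f\<close> acts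
    independently on the other halves.

  \<^item> Lattices of gates are inert (\<open>lattice_inert\<close>): they permute the edges of a higher block graph
    of \<open>(X, \<sigma>\<^sup>k)\<close> and fix all vertices.

  Cuttability does not mention a graph or a conjugacy, and it passes to products, inverses and
  conjugates. So the stabilised inert group is normal, and it is the group generated by lattices of
  gates.

  Now let \<open>N\<close> be a nontrivial group of stabilised automorphisms that is normalised by all lattices
  (\<open>contains_lattices\<close>). Pick \<open>g \<noteq> id\<close> in \<open>N\<close> and a gate \<open>\<alpha>\<close> that does not commute with it. The
  commutator of \<open>g\<close> with a sparse lattice of \<open>\<alpha>\<close> is a sparse lattice of the gate
  \<open>g \<alpha> g\<^sup>-\<^sup>1 \<alpha>\<^sup>-\<^sup>1 \<noteq> id\<close>. Hence the gates all of whose sufficiently sparse lattices (with period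
  divisible by that of \<open>g\<close>) lie in \<open>N\<close> form a nontrivial group \<open>PP\<close> normalised by all gates. On a large
  window the group of gates is a product of symmetric groups, one for each pair of margins, so \<open>PP\<close>
  contains the corresponding product of alternating groups (\<open>class_permutations\<close>); in particular the
  quotient by \<open>PP\<close> has exponent \<open>2\<close> and an order bounded independently of the window. By the
  pigeonhole principle a gate \<open>P\<close> and its translate \<open>P'\<close> by any multiple of a suitable constant agree
  modulo \<open>PP\<close>, so \<open>P \<circ> P'\<close> lies in \<open>PP\<close>. If \<open>k\<close> is a multiple of this constant and \<open>P'\<close> is the
  translate of \<open>P\<close> by \<open>k\<close>, then the lattice of \<open>P\<close> of period \<open>k\<close> is the lattice of \<open>P \<circ> P'\<close> of
  period \<open>2k\<close>, hence a product of sparse lattices in \<open>N\<close>. Every lattice splits into lattices with such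
  periods. This parity argument is what makes the full group appear, and not only the part
  generated by even gates.
\<close>

(* inv denotes the inverse of a function throughout *)
unbundle no m_inv_syntax

section \<open>Normal subgroups of finite products of symmetric groups\<close>

abbreviation swap :: "'a \<Rightarrow> 'a \<Rightarrow> 'a \<Rightarrow> 'a" where
  "swap \<equiv> Transposition.transpose"

text \<open>
  The group \<open>class_preserving\<close> defined below is the product of the symmetric groups of the classes
  \<open>{u \<in> W. c u = a}\<close>, and \<open>N\<close> is a normal subgroup of it that acts nontrivially on every class. As in
  the proof that the alternating groups on at least five points are simple, \<open>N\<close> contains the product of
  the alternating groups. This is expressed without signs: modulo \<open>N\<close>, all transpositions within
  one class are equal.
\<close>

locale class_permutations =
  fixes W :: "'b set" and c :: "'b \<Rightarrow> 'c" and N :: "('b \<Rightarrow> 'b) set"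
  assumes finite_W: "finite W"
    and N_perm: "p \<in> N \<Longrightarrow> p permutes W"
    and N_class: "p \<in> N \<Longrightarrow> u \<in> W \<Longrightarrow> c (p u) = c u"
    and N_comp: "p \<in> N \<Longrightarrow> q \<in> N \<Longrightarrow> p \<circ> q \<in> N"
    and N_inv: "p \<in> N \<Longrightarrow> inv p \<in> N"
    and N_conj: "p \<in> N \<Longrightarrow> q permutes W \<Longrightarrow> (\<And>u. u \<in> W \<Longrightarrow> c (q u) = c u) \<Longrightarrow> q \<circ> p \<circ> inv q \<in> N"
    and N_id: "id \<in> N"
    and five: "u \<in> W \<Longrightarrow> card {v \<in> W. c v = c u} \<ge> 5"
    and moved: "u \<in> W \<Longrightarrow> \<exists>p\<in>N. \<exists>v\<in>W. c v = c u \<and> p v \<noteq> v"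
begin

definition class_preserving :: "('b \<Rightarrow> 'b) set" where
  "class_preserving = {p. p permutes W \<and> (\<forall>u\<in>W. c (p u) = c u)}"

lemma class_preserving_comp: "p \<in> class_preserving \<Longrightarrow> q \<in> class_preserving \<Longrightarrow> p \<circ> q \<in> class_preserving"
  by (auto simp: class_preserving_def permutes_compose permutes_in_image)

lemma N_class_preserving: "p \<in> N \<Longrightarrow> p \<in> class_preserving"
  using N_perm N_class by (auto simp: class_preserving_def)

lemma class_preserving_bij: "p \<in> class_preserving \<Longrightarrow> bij p"
  by (auto simp: class_preserving_def permutes_bij)

lemma transpose_class_preserving: "x \<in> W \<Longrightarrow> y \<in> W \<Longrightarrow> c x = c y \<Longrightarrow> swap x y \<in> class_preserving"
  by (auto simp: class_preserving_def permutes_swap_id Transposition.transpose_def)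

lemma N_conj': "p \<in> N \<Longrightarrow> q \<in> class_preserving \<Longrightarrow> q \<circ> p \<circ> inv q \<in> N"
  using N_conj by (auto simp: class_preserving_def)

lemma conj_transpose: "bij q \<Longrightarrow> q \<circ> swap x y \<circ> inv q = swap (q x) (q y)"
proof
  fix z assume b: "bij q"
  then obtain z' where "z = q z'" by (metis bij_pointE)
  then show "(q \<circ> swap x y \<circ> inv q) z = swap (q x) (q y) z"
    using b by (auto simp: Transposition.transpose_def bij_is_inj dest: bij_is_inj injD)
qed

text \<open>
  Equality of two transpositions in the quotient by \<open>N\<close>.
\<close>

definition cong_swaps :: "'b \<Rightarrow> 'b \<Rightarrow> 'b \<Rightarrow> 'b \<Rightarrow> bool" where
  "cong_swaps x y x' y' \<longleftrightarrow> swap x y \<circ> swap x' y' \<in> N"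

lemma cong_swaps_sym: "cong_swaps x y x' y' \<Longrightarrow> cong_swaps x' y' x y"
  unfolding cong_swaps_def
proof -
  assume "swap x y \<circ> swap x' y' \<in> N"
  then have "inv (swap x y \<circ> swap x' y') \<in> N" by (rule N_inv)
  moreover have "inv (swap x y \<circ> swap x' y') = swap x' y' \<circ> swap x y"
    by (rule inv_unique_comp) (auto simp: fun_eq_iff)
  ultimately show "swap x' y' \<circ> swap x y \<in> N" by simp
qed

lemma cong_swaps_trans:
  assumes "cong_swaps x y x' y'" "cong_swaps x' y' x'' y''"
  shows "cong_swaps x y x'' y''"
proof -
  have "(swap x y \<circ> swap x' y') \<circ> (swap x' y' \<circ> swap x'' y'') \<in> N"
    using assms N_comp by (auto simp: cong_swaps_def)
  moreover have "(swap x y \<circ> swap x' y') \<circ> (swap x' y' \<circ> swap x'' y'')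
      = swap x y \<circ> swap x'' y''"
    by (auto simp: fun_eq_iff)
  ultimately show ?thesis by (simp add: cong_swaps_def)
qed

lemma cong_swaps_flip:
  assumes "cong_swaps x y x' y'" shows "cong_swaps x y y' x'"
  using assms by (simp add: cong_swaps_def Transposition.transpose_commute[of x' y'])

lemma cong_swaps_conj:
  assumes "cong_swaps x y x' y'" "q \<in> class_preserving"
  shows "cong_swaps (q x) (q y) (q x') (q y')"
proof -
  have b: "bij q" using assms class_preserving_bij by auto
  have "q \<circ> (swap x y \<circ> swap x' y') \<circ> inv q \<in> N"
    using assms N_conj' by (auto simp: cong_swaps_def)
  moreover have "q \<circ> (swap x y \<circ> swap x' y') \<circ> inv q
     = (q \<circ> swap x y \<circ> inv q) \<circ> (q \<circ> swap x' y' \<circ> inv q)"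
    using b by (auto simp: fun_eq_iff bij_is_inj)
  ultimately show ?thesis by (simp add: cong_swaps_def conj_transpose b)
qed

lemma cong_swaps_refl: "cong_swaps x y x y"
  using N_id by (simp add: cong_swaps_def)

lemma avoid_four:
  assumes "u \<in> W" shows "\<exists>z\<in>W. c z = c u \<and> z \<notin> {p, q, r, s}"
proof (rule ccontr)
  assume "\<not> ?thesis"
  then have "{v \<in> W. c v = c u} \<subseteq> {p, q, r, s}" by auto
  then have "card {v \<in> W. c v = c u} \<le> card {p, q, r, s}" by (intro card_mono) auto
  also have "\<dots> \<le> 4" by (auto simp: card_insert_if)
  finally show False using five[OF assms] by simp
qed

text \<open>
  If \<open>n \<in> N\<close> moves \<open>U\<close> to \<open>V\<close>, then the commutator of \<open>n\<close> with the transposition of \<open>U\<close> and \<open>Z\<close> is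
  the product of the transpositions of \<open>V, n Z\<close> and of \<open>U, Z\<close>. For \<open>n Z = Z\<close> this is already a
  \<open>3\<close>-cycle; otherwise conjugation by a transposition that moves \<open>U\<close> but none of \<open>V, n Z, Z\<close> shows that two
  transpositions with a common point agree modulo \<open>N\<close>.
\<close>

lemma cong_swaps_seed:
  assumes "u \<in> W"
  shows "\<exists>x y z. {x, y, z} \<subseteq> W \<and> c x = c u \<and> c y = c u \<and> c z = c u \<and>
           x \<noteq> y \<and> x \<noteq> z \<and> y \<noteq> z \<and> cong_swaps x z y z"
proof -
  obtain n U where n: "n \<in> N" and U: "U \<in> W" "c U = c u" "n U \<noteq> U"
    using moved[OF assms] by blast
  have bn: "bij n" and nW: "n permutes W" using n class_preserving_bij N_class_preserving N_perm by auto
  define V where "V = n U"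
  have V: "V \<in> W" "c V = c u" "V \<noteq> U"
    using U n nW N_class by (auto simp: V_def permutes_in_image)
  obtain Z where Z: "Z \<in> W" "c Z = c u" "Z \<noteq> U" "Z \<noteq> V" "Z \<noteq> inv n U"
    using avoid_four[OF assms, of U V "inv n U" U] by auto
  have nZ: "n Z \<in> W" "c (n Z) = c u" "n Z \<noteq> U" "n Z \<noteq> V"
    using Z n nW bn N_class U by (auto simp: permutes_in_image V_def bij_inv_eq_iff dest: bij_is_inj injD)
  have t: "swap U Z \<in> class_preserving" using U Z by (intro transpose_class_preserving) auto
  have "n \<circ> (swap U Z \<circ> inv n \<circ> inv (swap U Z)) \<in> N"
    using n t N_inv N_comp N_conj' by blast
  moreover have "n \<circ> (swap U Z \<circ> inv n \<circ> inv (swap U Z))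
      = (n \<circ> swap U Z \<circ> inv n) \<circ> swap U Z"
    by (simp add: comp_assoc)
  ultimately have e: "cong_swaps V (n Z) U Z"
    using bn by (simp add: cong_swaps_def conj_transpose V_def)
  show ?thesis
  proof (cases "n Z = Z")
    case True
    then show ?thesis using e U V Z by (intro exI[of _ V] exI[of _ U] exI[of _ Z]) auto
  next
    case False
    obtain T where T: "T \<in> W" "c T = c u" "T \<noteq> U" "T \<noteq> V" "T \<noteq> Z" "T \<noteq> n Z"
      using avoid_four[OF assms, of U V Z "n Z"] by auto
    have "swap U T \<in> class_preserving" using U T by (intro transpose_class_preserving) auto
    from cong_swaps_conj[OF e this] have "cong_swaps V (n Z) T Z"
      using U V Z T nZ False by (simp add: Transposition.transpose_def)
    then have "cong_swaps U Z T Z" using e cong_swaps_sym cong_swaps_trans by blast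
    then show ?thesis using U T Z by (intro exI[of _ U] exI[of _ T] exI[of _ Z]) auto
  qed
qed

text \<open>
  Conjugation spreads the coincidence of two transpositions that share the point \<open>z\<close> first to all
  transpositions that involve \<open>z\<close>, then to every other common point, and a chain of two such steps
  connects arbitrary transpositions.
\<close>

lemma cong_swaps_all:
  assumes "{x, y, x', y'} \<subseteq> W" "c x = c y" "c x' = c y'" "c x = c x'" "x \<noteq> y" "x' \<noteq> y'"
  shows "cong_swaps x y x' y'"
proof -
  obtain p q z where pqz: "{p, q, z} \<subseteq> W" "c p = c x" "c q = c x" "c z = c x"
    "p \<noteq> q" "p \<noteq> z" "q \<noteq> z" "cong_swaps p z q z"
    using cong_swaps_seed[of x] assms by auto
  have star1: "cong_swaps p z r z" if "r \<in> W" "c r = c x" "r \<noteq> z" for r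
  proof (cases "r = p")
    case True then show ?thesis by (simp add: cong_swaps_refl)
  next
    case False
    have "swap q r \<in> class_preserving" using pqz that by (intro transpose_class_preserving) auto
    from cong_swaps_conj[OF pqz(8) this] show ?thesis
      using pqz that False by (auto simp: Transposition.transpose_def split: if_splits)
  qed
  have starz: "cong_swaps r z r' z" if "{r, r'} \<subseteq> W" "c r = c x" "c r' = c x" "r \<noteq> z" "r' \<noteq> z" for r r'
    using cong_swaps_trans[OF cong_swaps_sym[OF star1[of r]] star1[of r']] that by simp
  have star: "cong_swaps r t r' t"
    if r: "{r, r', t} \<subseteq> W" "c r = c x" "c r' = c x" "c t = c x" "r \<noteq> t" "r' \<noteq> t" for r r' t
  proof -
    have tk: "swap z t \<in> class_preserving" using pqz r by (intro transpose_class_preserving) auto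
    have "cong_swaps (swap z t r) z (swap z t r') z"
      using r pqz by (intro starz) (auto simp: Transposition.transpose_def)
    from cong_swaps_conj[OF this tk] show ?thesis by simp
  qed
  show ?thesis
  proof (cases "y = x'")
    case True
    have "cong_swaps x x' y' x'" by (rule star) (use assms True in simp_all)
    then show ?thesis unfolding True by (rule cong_swaps_flip)
  next
    case False
    have "cong_swaps x y x' y" using False assms by (intro star) auto
    moreover have "cong_swaps y x' y' x'" using False assms by (intro star) auto
    ultimately show ?thesis
      by (rule cong_swaps_flip[OF cong_swaps_trans[OF cong_swaps_flip]])
  qed
qed

text \<open>
  Two distinct points of the class \<open>a\<close>, as the transposition that represents the odd coset there.
\<close>

definition base_pt :: "'c \<Rightarrow> 'b \<times> 'b" where
  "base_pt a = (SOME p. fst p \<in> W \<and> snd p \<in> W \<and> c (fst p) = a \<and> c (snd p) = a \<and> fst p \<noteq> snd p)"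

abbreviation tau :: "'c \<Rightarrow> 'b \<Rightarrow> 'b" where
  "tau a \<equiv> swap (fst (base_pt a)) (snd (base_pt a))"

text \<open>
  The representative, modulo \<open>N\<close>, of the permutations that are odd exactly on the classes in \<open>S\<close>.
\<close>

definition tau_set :: "'c set \<Rightarrow> 'b \<Rightarrow> 'b" where
  "tau_set S x = (if x \<in> W \<and> c x \<in> S then tau (c x) x else x)"

lemma base_pt:
  assumes "u \<in> W"
  shows "fst (base_pt (c u)) \<in> W" "snd (base_pt (c u)) \<in> W" "c (fst (base_pt (c u))) = c u"
    "c (snd (base_pt (c u))) = c u" "fst (base_pt (c u)) \<noteq> snd (base_pt (c u))"
proof -
  obtain z where z: "z \<in> W" "c z = c u" "z \<noteq> u" using avoid_four[OF assms, of u u u u] by auto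
  have "\<exists>p. fst p \<in> W \<and> snd p \<in> W \<and> c (fst p) = c u \<and> c (snd p) = c u \<and> fst p \<noteq> snd p"
    using z assms by (intro exI[of _ "(u, z)"]) auto
  from someI_ex[OF this] show "fst (base_pt (c u)) \<in> W" "snd (base_pt (c u)) \<in> W" "c (fst (base_pt (c u))) = c u"
    "c (snd (base_pt (c u))) = c u" "fst (base_pt (c u)) \<noteq> snd (base_pt (c u))"
    unfolding base_pt_def by auto
qed

lemma tau_class_preserving: "u \<in> W \<Longrightarrow> tau (c u) \<in> class_preserving"
  using base_pt by (intro transpose_class_preserving) auto

lemma tau_set_W: "x \<in> W \<Longrightarrow> tau_set S x \<in> W" "x \<in> W \<Longrightarrow> c (tau_set S x) = c x"
  using tau_class_preserving by (auto simp: tau_set_def class_preserving_def permutes_in_image)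

lemma tau_set_invol: "tau_set S (tau_set S x) = x"
  using tau_set_W[of x S] by (auto simp: tau_set_def)

lemma tau_set_class_preserving: "tau_set S \<in> class_preserving"
proof -
  have "bij (tau_set S)" by (rule o_bij[of "tau_set S"]) (auto simp: fun_eq_iff tau_set_invol)
  then have "tau_set S permutes W" by (auto simp: permutes_def bij_iff tau_set_def)
  then show ?thesis using tau_set_W by (auto simp: class_preserving_def)
qed

lemma inv_tau_set: "inv (tau_set S) = tau_set S"
  by (rule inv_unique_comp) (auto simp: fun_eq_iff tau_set_invol)

lemma tau_set_comp_tau:
  assumes "u \<in> W" shows "\<exists>S'. S' \<subseteq> insert (c u) S \<and> tau_set S' = tau_set S \<circ> tau (c u)"
proof -
  let ?S' = "if c u \<in> S then S - {c u} else insert (c u) S"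
  have k: "tau (c u) permutes W" "\<And>x. x \<in> W \<Longrightarrow> c (tau (c u) x) = c x"
    using tau_class_preserving[OF assms] by (auto simp: class_preserving_def)
  have fx: "tau (c u) x = x" if "x \<notin> W \<or> c x \<noteq> c u" for x
    using base_pt[OF assms] that by (auto simp: Transposition.transpose_def)
  have "tau_set ?S' x = tau_set S (tau (c u) x)" for x
  proof (cases "x \<in> W \<and> c x = c u")
    case True
    then show ?thesis using k by (auto simp: tau_set_def permutes_in_image)
  next
    case False
    then show ?thesis using fx[of x] by (auto simp: tau_set_def)
  qed
  then show ?thesis by (intro exI[of _ ?S']) auto
qed

text \<open>
  Splitting off transpositions one at a time, each may be replaced modulo \<open>N\<close> by the chosen one of
  its class.
\<close>

lemma cong_tau_set:
  "p \<in> class_preserving \<Longrightarrow> \<exists>S\<subseteq>c ` W. p \<circ> tau_set S \<in> N"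
proof (induction "card {x \<in> W. p x \<noteq> x}" arbitrary: p rule: less_induct)
  case less
  show ?case
  proof (cases "\<exists>x\<in>W. p x \<noteq> x")
    case False
    then have "p = id" using less.prems by (auto simp: class_preserving_def permutes_def fun_eq_iff)
    moreover have "tau_set {} = id" by (auto simp: tau_set_def)
    ultimately show ?thesis using N_id by (intro exI[of _ "{}"]) auto
  next
    case True
    then obtain x where x: "x \<in> W" "p x \<noteq> x" by blast
    have pK: "p permutes W" "\<And>u. u \<in> W \<Longrightarrow> c (p u) = c u" using less.prems by (auto simp: class_preserving_def)
    have px: "p x \<in> W" using x pK by (simp add: permutes_in_image)
    define t where "t = swap x (p x)"
    have tK: "t \<in> class_preserving" using x px pK by (auto simp: t_def intro: transpose_class_preserving)
    define p' where "p' = t \<circ> p"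
    have p'K: "p' \<in> class_preserving" using tK less.prems class_preserving_comp by (auto simp: p'_def)
    have tt: "t \<circ> t = id" by (simp add: t_def)
    have sub: "{y \<in> W. p' y \<noteq> y} \<subseteq> {y \<in> W. p y \<noteq> y} - {x}"
    proof
      fix y assume y: "y \<in> {y \<in> W. p' y \<noteq> y}"
      then have "y \<noteq> x" by (auto simp: p'_def t_def)
      moreover have "p y \<noteq> y"
      proof
        assume py: "p y = y"
        then have "y = p x" using y \<open>y \<noteq> x\<close> by (auto simp: p'_def t_def Transposition.transpose_def split: if_splits)
        then have "p x = p (p x)" using py by simp
        then show False using pK x permutes_inj by (metis injD)
      qed
      ultimately show "y \<in> {y \<in> W. p y \<noteq> y} - {x}" using y by auto
    qed
    have "card {y \<in> W. p' y \<noteq> y} < card {y \<in> W. p y \<noteq> y}"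
      using sub x finite_W by (intro psubset_card_mono) auto
    from less.hyps[OF this p'K] obtain S where S: "S \<subseteq> c ` W" "p' \<circ> tau_set S \<in> N" by auto
    obtain S' where S': "S' \<subseteq> insert (c x) S" "tau_set S' = tau_set S \<circ> tau (c x)"
      using tau_set_comp_tau[OF x(1)] by blast
    have "cong_swaps x (p x) (fst (base_pt (c x))) (snd (base_pt (c x)))"
      using x px pK base_pt[OF x(1)] by (intro cong_swaps_all) auto
    then have n1: "t \<circ> tau (c x) \<in> N" by (simp add: cong_swaps_def t_def)
    have "t \<circ> (p' \<circ> tau_set S) \<circ> inv t \<in> N" using S tK N_conj' by blast
    then have "(t \<circ> (p' \<circ> tau_set S) \<circ> inv t) \<circ> (t \<circ> tau (c x)) \<in> N" using n1 N_comp by blast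
    moreover have "(t \<circ> (p' \<circ> tau_set S) \<circ> inv t) \<circ> (t \<circ> tau (c x)) = p \<circ> tau_set S'"
      by (simp add: S' p'_def fun_eq_iff t_def)
    ultimately show ?thesis using S S' x by (intro exI[of _ S']) auto
  qed
qed

lemma square_in_N: assumes "p \<in> class_preserving" shows "p \<circ> p \<in> N"
proof -
  obtain S where S: "p \<circ> tau_set S \<in> N" using cong_tau_set[OF assms] by blast
  have "tau_set S \<circ> (p \<circ> tau_set S) \<circ> inv (tau_set S) \<in> N"
    using N_conj'[OF S tau_set_class_preserving[of S]] .
  then have "(p \<circ> tau_set S) \<circ> (tau_set S \<circ> (p \<circ> tau_set S) \<circ> inv (tau_set S)) \<in> N"
    using S N_comp by blast
  moreover have "(p \<circ> tau_set S) \<circ> (tau_set S \<circ> (p \<circ> tau_set S) \<circ> inv (tau_set S)) = p \<circ> p"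
    by (simp add: inv_tau_set fun_eq_iff tau_set_invol)
  ultimately show ?thesis by simp
qed

text \<open>
  The cosets of \<open>N\<close> are represented by the \<open>2 ^ card (c ` W)\<close> permutations \<open>tau_set S\<close>, so among
  more permutations than that two lie in the same coset.
\<close>

lemma index_bound:
  fixes P :: "nat \<Rightarrow> 'b \<Rightarrow> 'b"
  assumes "\<And>i. i \<le> 2 ^ card (c ` W) \<Longrightarrow> P i \<in> class_preserving"
  shows "\<exists>i j. i < j \<and> j \<le> 2 ^ card (c ` W) \<and> P j \<circ> inv (P i) \<in> N"
proof -
  let ?B = "2 ^ card (c ` W) :: nat"
  have "\<forall>i. \<exists>S. i \<le> ?B \<longrightarrow> S \<subseteq> c ` W \<and> P i \<circ> tau_set S \<in> N"
    using cong_tau_set assms by blast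
  then obtain S where S: "\<And>i. i \<le> ?B \<Longrightarrow> S i \<subseteq> c ` W \<and> P i \<circ> tau_set (S i) \<in> N" by metis
  have "S ` {..?B} \<subseteq> Pow (c ` W)" using S by auto
  then have "card (S ` {..?B}) \<le> card (Pow (c ` W))" using finite_W by (intro card_mono) auto
  also have "\<dots> = ?B" using finite_W by (simp add: card_Pow)
  finally have "card (S ` {..?B}) < card {..?B}" by simp
  then have "\<not> inj_on S {..?B}" by (rule pigeonhole)
  then obtain i j where ij: "i < j" "j \<le> ?B" "S i = S j"
    unfolding inj_on_def by (metis atMost_iff linorder_neqE_nat)
  have bi: "bij (P i)" using ij assms class_preserving_bij by auto
  have "inv (P i \<circ> tau_set (S i)) = tau_set (S i) \<circ> inv (P i)"
    using bi class_preserving_bij[OF tau_set_class_preserving] by (simp add: o_inv_distrib inv_tau_set)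
  moreover have "inv (P i \<circ> tau_set (S i)) \<in> N" using S[of i] ij N_inv by simp
  ultimately have "(P j \<circ> tau_set (S j)) \<circ> (tau_set (S i) \<circ> inv (P i)) \<in> N"
    using S ij N_comp by auto
  then have "P j \<circ> inv (P i) \<in> N" using ij by (simp add: fun_eq_iff comp_def tau_set_invol)
  then show ?thesis using ij by blast
qed

end

section \<open>Locality of continuous maps between shift spaces\<close>

lemma topspace_shift_topology [simp]: "topspace (shift_topology X) = X"
  by (simp add: shift_topology_def)

lemma Hausdorff_shift_topology: "Hausdorff_space (shift_topology X)"
  unfolding shift_topology_def
  by (intro Hausdorff_space_subtopology) (simp add: Hausdorff_space_product_topology)

lemma finite_int_bound: "finite (F :: int set) \<Longrightarrow> \<exists>M. \<forall>i\<in>F. \<bar>i\<bar> \<le> M"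
  by (induction rule: finite_induct) (auto, meson dual_order.trans linear)

text \<open>
  The cylinders on the windows \<open>{-M..M}\<close> form a neighbourhood base, so all topological notions of the
  statement can be replaced by dependence on finitely many coordinates.
\<close>

lemma openin_shift_topology:
  "openin (shift_topology X) U \<longleftrightarrow>
     U \<subseteq> X \<and> (\<forall>x\<in>U. \<exists>M. \<forall>y\<in>X. (\<forall>j. \<bar>j\<bar> \<le> M \<longrightarrow> y j = x j) \<longrightarrow> y \<in> U)"
proof
  let ?T = "product_topology (\<lambda>_::int. discrete_topology (UNIV :: 'a set)) UNIV"
  assume "openin (shift_topology X) U"
  then obtain V where V: "openin ?T V" "U = V \<inter> X"
    unfolding shift_topology_def openin_subtopology by blast
  have "\<exists>M. \<forall>y\<in>X. (\<forall>j. \<bar>j\<bar> \<le> M \<longrightarrow> y j = x j) \<longrightarrow> y \<in> U" if "x \<in> U" for x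
  proof -
    from that V have "x \<in> V" by auto
    then have "\<exists>B. finite {i \<in> UNIV. B i \<noteq> topspace (discrete_topology (UNIV :: 'a set))} \<and>
        (\<forall>i\<in>UNIV. openin (discrete_topology UNIV) (B i)) \<and> x \<in> Pi\<^sub>E UNIV B \<and> Pi\<^sub>E UNIV B \<subseteq> V"
      by (rule bspec[OF V(1)[unfolded openin_product_topology_alt]])
    then obtain B where B: "finite {i. B i \<noteq> UNIV}" "x \<in> Pi\<^sub>E UNIV B" "Pi\<^sub>E UNIV B \<subseteq> V"
      by (elim exE conjE) (simp only: topspace_discrete_topology UNIV_I simp_thms)
    obtain M where M: "\<forall>i\<in>{i. B i \<noteq> UNIV}. \<bar>i\<bar> \<le> M"
      using finite_int_bound[OF B(1)] by blast
    have "y \<in> U" if "y \<in> X" "\<forall>j. \<bar>j\<bar> \<le> M \<longrightarrow> y j = x j" for y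
    proof -
      have "y i \<in> B i" for i
        using that(2) M B(2) by (cases "B i = UNIV") (auto simp: PiE_iff)
      then have "y \<in> Pi\<^sub>E UNIV B" by auto
      then show ?thesis using B V that by auto
    qed
    then show ?thesis by blast
  qed
  then show "U \<subseteq> X \<and> (\<forall>x\<in>U. \<exists>M. \<forall>y\<in>X. (\<forall>j. \<bar>j\<bar> \<le> M \<longrightarrow> y j = x j) \<longrightarrow> y \<in> U)"
    using V by auto
next
  let ?T = "product_topology (\<lambda>_::int. discrete_topology (UNIV :: 'a set)) UNIV"
  assume U: "U \<subseteq> X \<and> (\<forall>x\<in>U. \<exists>M. \<forall>y\<in>X. (\<forall>j. \<bar>j\<bar> \<le> M \<longrightarrow> y j = x j) \<longrightarrow> y \<in> U)"
  show "openin (shift_topology X) U"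
  proof (subst openin_subopen, intro ballI)
    fix x assume x: "x \<in> U"
    then obtain M where M: "\<forall>y\<in>X. (\<forall>j. \<bar>j\<bar> \<le> M \<longrightarrow> y j = x j) \<longrightarrow> y \<in> U" using U by blast
    let ?B = "Pi\<^sub>E UNIV (\<lambda>j. if \<bar>j\<bar> \<le> M then {x j} else UNIV)"
    have "finite {j::int. \<bar>j\<bar> \<le> M}"
      by (rule finite_subset[of _ "{-M..M}"]) auto
    then have fin: "finite {j. (if \<bar>j\<bar> \<le> M then {x j} else UNIV) \<noteq> topspace (discrete_topology (UNIV :: 'a set))}"
      by (rule rev_finite_subset) auto
    have "openin ?T ?B"
      using fin by (intro product_topology_basis) auto
    then have "openin (shift_topology X) (?B \<inter> X)"
      unfolding shift_topology_def by (auto simp: openin_subtopology)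
    moreover have "?B \<inter> X \<subseteq> U" using M by (auto simp: PiE_iff split: if_splits)
    moreover have "x \<in> ?B \<inter> X" using x U by (auto simp: PiE_iff)
    ultimately show "\<exists>T. openin (shift_topology X) T \<and> x \<in> T \<and> T \<subseteq> U" by blast
  qed
qed

text \<open>
  Continuity of a map into a discrete space.
\<close>

definition pointwise_local :: "(int \<Rightarrow> 'a) set \<Rightarrow> ((int \<Rightarrow> 'a) \<Rightarrow> 'c) \<Rightarrow> bool" where
  "pointwise_local X \<phi> \<longleftrightarrow>
     (\<forall>x\<in>X. \<exists>M. \<forall>y\<in>X. (\<forall>j. \<bar>j\<bar> \<le> M \<longrightarrow> y j = x j) \<longrightarrow> \<phi> y = \<phi> x)"

lemma continuous_map_shift_topology:
  "continuous_map (shift_topology X) (shift_topology Y) f \<longleftrightarrow>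
     f ` X \<subseteq> Y \<and> (\<forall>i. pointwise_local X (\<lambda>x. f x i))"
proof
  assume c: "continuous_map (shift_topology X) (shift_topology Y) f"
  have sub: "f ` X \<subseteq> Y" using continuous_map_image_subset_topspace[OF c] by simp
  have "\<exists>M. \<forall>y\<in>X. (\<forall>j. \<bar>j\<bar> \<le> M \<longrightarrow> y j = x j) \<longrightarrow> f y i = f x i" if x: "x \<in> X" for x i
  proof -
    let ?V = "{z \<in> Y. z i = f x i}"
    have "openin (shift_topology Y) ?V"
      unfolding openin_shift_topology by (auto intro!: exI[of _ "\<bar>i\<bar>"])
    then have o: "openin (shift_topology X) {z \<in> X. f z \<in> ?V}"
      using openin_continuous_map_preimage[OF c, of ?V] by (simp only: topspace_shift_topology)
    have "x \<in> {z \<in> X. f z \<in> ?V}" using x sub by auto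
    from bspec[OF o[unfolded openin_shift_topology, THEN conjunct2] this]
    show ?thesis by (simp only: mem_Collect_eq) blast
  qed
  then show "f ` X \<subseteq> Y \<and> (\<forall>i. pointwise_local X (\<lambda>x. f x i))"
    using sub unfolding pointwise_local_def by blast
next
  assume f: "f ` X \<subseteq> Y \<and> (\<forall>i. pointwise_local X (\<lambda>x. f x i))"
  have "openin (shift_topology X) {x \<in> X. f x \<in> U}" if U: "openin (shift_topology Y) U" for U
    unfolding openin_shift_topology
  proof (intro conjI ballI)
    fix x assume x: "x \<in> {x \<in> X. f x \<in> U}"
    then obtain M where M: "\<forall>y\<in>Y. (\<forall>j. \<bar>j\<bar> \<le> M \<longrightarrow> y j = f x j) \<longrightarrow> y \<in> U"
      using bspec[OF U[unfolded openin_shift_topology, THEN conjunct2], of "f x"] by (simp only: mem_Collect_eq) blast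
    have "\<forall>i. \<exists>m. \<forall>y\<in>X. (\<forall>j. \<bar>j\<bar> \<le> m \<longrightarrow> y j = x j) \<longrightarrow> f y i = f x i"
      using f x unfolding pointwise_local_def by blast
    then obtain m where m: "\<And>i y. y \<in> X \<Longrightarrow> (\<forall>j. \<bar>j\<bar> \<le> m i \<longrightarrow> y j = x j) \<Longrightarrow> f y i = f x i"
      by metis
    obtain m' where m': "\<forall>i\<in>m ` {-M..M}. \<bar>i\<bar> \<le> m'" using finite_int_bound[of "m ` {-M..M}"] by auto
    have "y \<in> {x \<in> X. f x \<in> U}" if y: "y \<in> X" "\<forall>j. \<bar>j\<bar> \<le> m' \<longrightarrow> y j = x j" for y
    proof -
      have "f y i = f x i" if "\<bar>i\<bar> \<le> M" for i
      proof -
        have "i \<in> {-M..M}" using that by auto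
        then have "m i \<le> m'" using m' by force
        then show ?thesis using m[OF y(1)] y(2) by auto
      qed
      then show ?thesis using M y f by auto
    qed
    then show "\<exists>M. \<forall>y\<in>X. (\<forall>j. \<bar>j\<bar> \<le> M \<longrightarrow> y j = x j) \<longrightarrow> y \<in> {x \<in> X. f x \<in> U}" by blast
  qed auto
  then show "continuous_map (shift_topology X) (shift_topology Y) f"
    using f by (auto simp: continuous_map_def)
qed

text \<open>
  A finite subcover of the cylinders on which \<open>\<phi>\<close> is constant gives one window that determines
  \<open>\<phi>\<close> everywhere.
\<close>

lemma pointwise_local_uniform:
  assumes "compact_space (shift_topology X)" and "pointwise_local X \<phi>"
  shows "\<exists>M. \<forall>x\<in>X. \<forall>y\<in>X. (\<forall>j. \<bar>j\<bar> \<le> M \<longrightarrow> x j = y j) \<longrightarrow> \<phi> x = \<phi> y"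
proof -
  from assms(2) obtain m where m: "\<And>x y. x \<in> X \<Longrightarrow> y \<in> X \<Longrightarrow> (\<forall>j. \<bar>j\<bar> \<le> m x \<longrightarrow> y j = x j) \<Longrightarrow> \<phi> y = \<phi> x"
    unfolding pointwise_local_def by metis
  define U where "U x = {y \<in> X. \<forall>j. \<bar>j\<bar> \<le> m x \<longrightarrow> y j = x j}" for x
  have "openin (shift_topology X) (U x)" for x
    unfolding openin_shift_topology U_def by (auto intro!: exI[of _ "m x"])
  moreover have "X \<subseteq> \<Union>(U ` X)" by (auto simp: U_def)
  ultimately obtain F where F: "finite F" "F \<subseteq> U ` X" "X \<subseteq> \<Union>F"
    using assms(1) unfolding compact_space_alt by (metis (no_types, lifting) imageE topspace_shift_topology)
  then obtain F' where F': "finite F'" "F' \<subseteq> X" "F = U ` F'" by (meson finite_subset_image)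
  obtain M where M: "\<forall>i\<in>m ` F'. \<bar>i\<bar> \<le> M" using finite_int_bound[of "m ` F'"] F' by auto
  have "\<phi> x = \<phi> y" if xy: "x \<in> X" "y \<in> X" "\<forall>j. \<bar>j\<bar> \<le> M \<longrightarrow> x j = y j" for x y
  proof -
    obtain z where z: "z \<in> F'" "x \<in> U z" using F F' xy by blast
    have "m z \<le> M" using M z by force
    then have "\<forall>j. \<bar>j\<bar> \<le> m z \<longrightarrow> y j = z j" using z xy(3) by (auto simp: U_def)
    then have "\<phi> y = \<phi> z" using m z F' xy by blast
    moreover have "\<phi> x = \<phi> z" using m[of z x] z F' xy by (auto simp: U_def)
    ultimately show ?thesis by simp
  qed
  then show ?thesis by blast
qed

lemma compact_full_shift: "finite A \<Longrightarrow> compact_space (shift_topology (full_shift A))"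
proof -
  assume "finite A"
  have "full_shift A = Pi\<^sub>E UNIV (\<lambda>_. A)" by (auto simp: full_shift_def PiE_iff)
  moreover have "compactin (product_topology (\<lambda>_::int. discrete_topology (UNIV :: 'a set)) UNIV) (Pi\<^sub>E UNIV (\<lambda>_. A))"
    using \<open>finite A\<close> by (simp add: compactin_PiE finite_imp_compactin)
  ultimately show ?thesis
    unfolding shift_topology_def by (simp add: compact_space_subtopology)
qed

lemma compact_subshift:
  assumes "finite A" "closedin (shift_topology (full_shift A)) X"
  shows "compact_space (shift_topology X)"
proof -
  have sub: "X \<subseteq> full_shift A" using closedin_subset[OF assms(2)] by simp
  have "compactin (shift_topology (full_shift A)) X"
    using closedin_compact_space[OF compact_full_shift assms(2)] assms(1) by simp
  then have "compact_space (subtopology (shift_topology (full_shift A)) X)"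
    by (rule compact_space_subtopology)
  then show ?thesis using sub
    by (simp add: shift_topology_def subtopology_subtopology inf_absorb2)
qed

lemma homeomorphic_map_shift_topologyI:
  assumes "compact_space (shift_topology X)" "bij_betw f X Y" "\<And>i. pointwise_local X (\<lambda>x. f x i)"
  shows "homeomorphic_map (shift_topology X) (shift_topology Y) f"
proof (rule continuous_imp_homeomorphic_map[OF _ assms(1) Hausdorff_shift_topology])
  show "continuous_map (shift_topology X) (shift_topology Y) f"
    using assms(2,3) by (simp add: continuous_map_shift_topology bij_betw_def)
qed (use assms(2) in \<open>simp_all add: bij_betw_def\<close>)

lemma homeomorphic_map_shift_topologyD:
  assumes "homeomorphic_map (shift_topology X) (shift_topology Y) f"
  shows "bij_betw f X Y" "pointwise_local X (\<lambda>x. f x i)" "pointwise_local Y (\<lambda>x. inv_into X f x i)"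
proof -
  show "bij_betw f X Y"
    using assms by (simp add: homeomorphic_eq_everything_map bij_betw_def)
  show "pointwise_local X (\<lambda>x. f x i)"
    using homeomorphic_imp_continuous_map[OF assms] by (simp add: continuous_map_shift_topology)
  obtain g where g: "homeomorphic_maps (shift_topology X) (shift_topology Y) f g"
    using assms homeomorphic_map_maps by blast
  have "inv_into X f y = g y" if "y \<in> Y" for y
    using g that \<open>bij_betw f X Y\<close>
    by (metis bij_betw_def continuous_map_shift_topology homeomorphic_maps_def image_subset_iff
        inv_into_f_f topspace_shift_topology)
  moreover have "pointwise_local Y (\<lambda>x. g x i)"
    using g by (simp add: homeomorphic_maps_def continuous_map_shift_topology)
  ultimately show "pointwise_local Y (\<lambda>x. inv_into X f x i)"
    by (simp add: pointwise_local_def)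
qed

lemma shift_by_apply [simp]: "shift_by n x i = x (i + n)"
  by (simp add: shift_by_def)

lemma shift_by_shift_by [simp]: "shift_by m (shift_by n x) = shift_by (m + n) x"
  by (simp add: shift_by_def fun_eq_iff algebra_simps)

lemma shift_by_0 [simp]: "shift_by 0 x = x"
  by (simp add: shift_by_def)

text \<open>
  A map with local rules on windows of bounded width. The rules may depend on the position, so that
  the notion covers gates and the half maps that cut an automorphism, besides automorphisms.
\<close>

definition has_radius :: "(int \<Rightarrow> 'a) set \<Rightarrow> ((int \<Rightarrow> 'a) \<Rightarrow> int \<Rightarrow> 'b) \<Rightarrow> int \<Rightarrow> bool" where
  "has_radius X f r \<longleftrightarrow>
     (\<forall>x\<in>X. \<forall>y\<in>X. \<forall>i. (\<forall>j. \<bar>j - i\<bar> \<le> r \<longrightarrow> x j = y j) \<longrightarrow> f x i = f y i)"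

lemma has_radiusD:
  "has_radius X f r \<Longrightarrow> x \<in> X \<Longrightarrow> y \<in> X \<Longrightarrow> (\<And>j. \<bar>j - i\<bar> \<le> r \<Longrightarrow> x j = y j) \<Longrightarrow> f x i = f y i"
  unfolding has_radius_def by blast

lemma has_radius_mono: "has_radius X f r \<Longrightarrow> r \<le> r' \<Longrightarrow> has_radius X f r'"
  unfolding has_radius_def by (meson order_trans)

lemma has_radius_pointwise_local: "has_radius X f r \<Longrightarrow> pointwise_local X (\<lambda>x. f x i)"
  unfolding pointwise_local_def
proof (intro ballI)
  fix x assume r: "has_radius X f r" and x: "x \<in> X"
  have "f y i = f x i" if "y \<in> X" "\<forall>j. \<bar>j\<bar> \<le> \<bar>i\<bar> + \<bar>r\<bar> \<longrightarrow> y j = x j" for y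
    by (rule has_radiusD[OF r]) (use that x in auto)
  then show "\<exists>M. \<forall>y\<in>X. (\<forall>j. \<bar>j\<bar> \<le> M \<longrightarrow> y j = x j) \<longrightarrow> f y i = f x i" by blast
qed

lemma has_radius_comp:
  assumes "has_radius X f r" "has_radius X g q" "\<And>x. x \<in> X \<Longrightarrow> g x \<in> X"
  shows "has_radius X (f \<circ> g) (r + q)"
  unfolding has_radius_def
proof (intro ballI allI impI)
  fix x y i assume xy: "x \<in> X" "y \<in> X" "\<forall>j. \<bar>j - i\<bar> \<le> r + q \<longrightarrow> x j = y j"
  have "g x j = g y j" if "\<bar>j - i\<bar> \<le> r" for j
    by (rule has_radiusD[OF assms(2)]) (use xy that in auto)
  then show "(f \<circ> g) x i = (f \<circ> g) y i"
    using has_radiusD[OF assms(1)] assms(3) xy by simp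
qed

lemma uniformly_local_finite:
  assumes "compact_space (shift_topology X)" "finite I" "\<And>i. i \<in> I \<Longrightarrow> pointwise_local X (\<lambda>x. f x i)"
  shows "\<exists>M\<ge>0. \<forall>x\<in>X. \<forall>y\<in>X. (\<forall>j. \<bar>j\<bar> \<le> M \<longrightarrow> x j = y j) \<longrightarrow> (\<forall>i\<in>I. f x i = f y i)"
proof -
  have "pointwise_local X (\<lambda>x. restrict (f x) I)"
    unfolding pointwise_local_def
  proof
    fix x assume x: "x \<in> X"
    have "\<forall>i\<in>I. \<exists>M. \<forall>y\<in>X. (\<forall>j. \<bar>j\<bar> \<le> M \<longrightarrow> y j = x j) \<longrightarrow> f y i = f x i"
      using assms(3) x unfolding pointwise_local_def by blast
    then obtain m where m: "\<And>i y. i \<in> I \<Longrightarrow> y \<in> X \<Longrightarrow> (\<forall>j. \<bar>j\<bar> \<le> m i \<longrightarrow> y j = x j) \<Longrightarrow> f y i = f x i"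
      by metis
    obtain M where M: "\<forall>i\<in>m ` I. \<bar>i\<bar> \<le> M" using finite_int_bound[of "m ` I"] assms(2) by auto
    have "restrict (f y) I = restrict (f x) I" if y: "y \<in> X" "\<forall>j. \<bar>j\<bar> \<le> M \<longrightarrow> y j = x j" for y
    proof (rule restrict_ext)
      fix i assume i: "i \<in> I"
      then have "m i \<le> M" using M by force
      then show "f y i = f x i" using m[OF i y(1)] y(2) by auto
    qed
    then show "\<exists>M. \<forall>y\<in>X. (\<forall>j. \<bar>j\<bar> \<le> M \<longrightarrow> y j = x j) \<longrightarrow> restrict (f y) I = restrict (f x) I" by blast
  qed
  from pointwise_local_uniform[OF assms(1) this]
  obtain M where M: "\<forall>x\<in>X. \<forall>y\<in>X. (\<forall>j. \<bar>j\<bar> \<le> M \<longrightarrow> x j = y j) \<longrightarrow> restrict (f x) I = restrict (f y) I" by blast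
  have "f x i = f y i" if "x \<in> X" "y \<in> X" "\<forall>j. \<bar>j\<bar> \<le> \<bar>M\<bar> \<longrightarrow> x j = y j" "i \<in> I" for x y i
  proof -
    have "\<forall>j. \<bar>j\<bar> \<le> M \<longrightarrow> x j = y j" using that(3) by auto
    then have "restrict (f x) I = restrict (f y) I" using M that(1,2) by blast
    then have "restrict (f x) I i = restrict (f y) I i" by simp
    then show ?thesis using that by simp
  qed
  then show ?thesis by (intro exI[of _ "\<bar>M\<bar>"] conjI abs_ge_zero) blast
qed

text \<open>
  For \<open>m \<noteq> n\<close> this covers conjugacies between \<open>(X, \<sigma>\<^sup>m)\<close> and \<open>(Y, \<sigma>\<^sup>n)\<close>: by equivariance the
  coordinates in \<open>{n * q..<n * q + n}\<close> of the image depend on a window of fixed size around \<open>m * q\<close>.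
\<close>

lemma shift_equivariant_locality:
  assumes "compact_space (shift_topology X)" "\<And>i. pointwise_local X (\<lambda>x. f x i)" "0 < n"
    and sh: "\<And>x q. x \<in> X \<Longrightarrow> f (shift_by (m * q) x) = shift_by (n * q) (f x)"
    and inX: "\<And>x q. x \<in> X \<Longrightarrow> shift_by (m * q) x \<in> X"
  shows "\<exists>M\<ge>0. \<forall>x\<in>X. \<forall>y\<in>X. \<forall>q. (\<forall>j. \<bar>j - m * q\<bar> \<le> M \<longrightarrow> x j = y j) \<longrightarrow>
     (\<forall>i. n * q \<le> i \<and> i < n * q + n \<longrightarrow> f x i = f y i)"
proof -
  have "\<exists>M\<ge>0. \<forall>x\<in>X. \<forall>y\<in>X. (\<forall>j. \<bar>j\<bar> \<le> M \<longrightarrow> x j = y j) \<longrightarrow> (\<forall>i\<in>{0..<n}. f x i = f y i)"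
    by (rule uniformly_local_finite[OF assms(1)]) (use assms(2) in simp_all)
  then obtain M where
    M: "M \<ge> 0" "\<forall>x\<in>X. \<forall>y\<in>X. (\<forall>j. \<bar>j\<bar> \<le> M \<longrightarrow> x j = y j) \<longrightarrow> (\<forall>i\<in>{0..<n}. f x i = f y i)"
    by blast
  have "f x i = f y i" if "x \<in> X" "y \<in> X" "\<forall>j. \<bar>j - m * q\<bar> \<le> M \<longrightarrow> x j = y j" "n * q \<le> i" "i < n * q + n" for x y q i
  proof -
    have "\<forall>j. \<bar>j\<bar> \<le> M \<longrightarrow> shift_by (m * q) x j = shift_by (m * q) y j" using that(3) by auto
    then have "\<forall>i\<in>{0..<n}. f (shift_by (m * q) x) i = f (shift_by (m * q) y) i"
      using M(2) inX[OF that(1), of q] inX[OF that(2), of q] by blast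
    then have "f (shift_by (m * q) x) (i - n * q) = f (shift_by (m * q) y) (i - n * q)"
      using that(4,5) by simp
    then show ?thesis using sh that(1,2) by simp
  qed
  then show ?thesis using M(1) by blast
qed

lemma has_radius_exists:
  assumes "compact_space (shift_topology X)" "\<And>i. pointwise_local X (\<lambda>x. f x i)" "0 < n"
    and sh: "\<And>x q. x \<in> X \<Longrightarrow> f (shift_by (n * q) x) = shift_by (n * q) (f x)"
    and inX: "\<And>x q. x \<in> X \<Longrightarrow> shift_by (n * q) x \<in> X"
  shows "\<exists>r\<ge>0. has_radius X f r"
proof -
  have "\<exists>M\<ge>0. \<forall>x\<in>X. \<forall>y\<in>X. \<forall>q. (\<forall>j. \<bar>j - n * q\<bar> \<le> M \<longrightarrow> x j = y j) \<longrightarrow>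
     (\<forall>i. n * q \<le> i \<and> i < n * q + n \<longrightarrow> f x i = f y i)"
    by (rule shift_equivariant_locality[OF assms(1,2,3)]) (use sh inX in \<open>simp_all add: fun_eq_iff\<close>)
  then obtain M where M: "M \<ge> 0" "\<forall>x\<in>X. \<forall>y\<in>X. \<forall>q. (\<forall>j. \<bar>j - n * q\<bar> \<le> M \<longrightarrow> x j = y j) \<longrightarrow>
     (\<forall>i. n * q \<le> i \<and> i < n * q + n \<longrightarrow> f x i = f y i)"
    by blast
  have "has_radius X f (M + n)"
    unfolding has_radius_def
  proof (intro ballI allI impI)
    fix x y i assume xy: "x \<in> X" "y \<in> X" "\<forall>j. \<bar>j - i\<bar> \<le> M + n \<longrightarrow> x j = y j"
    have "n * (i div n) + i mod n = i" by simp
    then have e: "n * (i div n) \<le> i" "i < n * (i div n) + n"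
      using \<open>0 < n\<close> pos_mod_sign[of n i] pos_mod_bound[of n i] by linarith+
    have "\<forall>j. \<bar>j - n * (i div n)\<bar> \<le> M \<longrightarrow> x j = y j"
    proof (intro allI impI)
      fix j assume "\<bar>j - n * (i div n)\<bar> \<le> M"
      then have "\<bar>j - i\<bar> \<le> M + n" using e by linarith
      then show "x j = y j" using xy(3) by blast
    qed
    then show "f x i = f y i" using M(2)[rule_format, OF xy(1,2), of "i div n" i] e by blast
  qed
  moreover have "M + n \<ge> 0" using M(1) \<open>0 < n\<close> by simp
  ultimately show ?thesis by blast
qed

section \<open>Gates and lattices of gates\<close>

lemma mult_small_zero: "\<bar>k * a\<bar> < k \<Longrightarrow> a = 0" for k a :: int
proof (rule ccontr)
  assume "\<bar>k * a\<bar> < k" "a \<noteq> 0"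
  have "0 < k" using \<open>\<bar>k * a\<bar> < k\<close> by linarith
  have "k * 1 \<le> k * \<bar>a\<bar>" using \<open>a \<noteq> 0\<close> \<open>0 < k\<close> by (intro mult_left_mono) auto
  then show False using \<open>\<bar>k * a\<bar> < k\<close> \<open>0 < k\<close> by (simp add: abs_mult)
qed

lemma block_position: "0 < k \<Longrightarrow> \<exists>i j. n = i + k * j \<and> s \<le> i \<and> i < s + k" for k :: int
  by (rule exI[of _ "s + (n - s) mod k"], rule exI[of _ "(n - s) div k"]) simp

text \<open>
  The subshift consists of the configurations all of whose windows of length \<open>w + 1\<close> occur in it. Points
  that agree on \<open>w\<close> consecutive coordinates can then be spliced there, so words of length \<open>w\<close> play
  the role of the vertices of an edge shift.
\<close>

locale local_shift =
  fixes X :: "(int \<Rightarrow> 'a) set" and w :: int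
  assumes w_pos: "1 \<le> w"
    and local: "\<And>y. (\<And>i. \<exists>z\<in>X. \<forall>j. i \<le> j \<and> j \<le> i + w \<longrightarrow> z j = y j) \<Longrightarrow> y \<in> X"
    and shift_in [simp]: "\<And>x n. x \<in> X \<Longrightarrow> shift_by n x \<in> X"
begin

lemma splice:
  assumes "x \<in> X" "y \<in> X" "\<And>j. i \<le> j \<Longrightarrow> j < i + w \<Longrightarrow> x j = y j"
  shows "(\<lambda>j. if j < i then x j else y j) \<in> X"
proof (rule local)
  fix k
  show "\<exists>z\<in>X. \<forall>j. k \<le> j \<and> j \<le> k + w \<longrightarrow> z j = (if j < i then x j else y j)"
  proof (cases "k < i")
    case True
    then show ?thesis using assms by (intro bexI[of _ x]) auto
  next
    case False
    then show ?thesis using assms by (intro bexI[of _ y]) auto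
  qed
qed

definition overwrite :: "int \<Rightarrow> int \<Rightarrow> (int \<Rightarrow> 'a) \<Rightarrow> (int \<Rightarrow> 'a) \<Rightarrow> int \<Rightarrow> 'a" where
  "overwrite s t x y = (\<lambda>j. if s \<le> j \<and> j < t then y j else x j)"

lemma overwrite_in:
  assumes "x \<in> X" "y \<in> X" "s + w \<le> t"
    "\<And>j. s \<le> j \<Longrightarrow> j < s + w \<Longrightarrow> x j = y j" "\<And>j. t - w \<le> j \<Longrightarrow> j < t \<Longrightarrow> x j = y j"
  shows "overwrite s t x y \<in> X"
proof -
  have 1: "(\<lambda>j. if j < s then x j else y j) \<in> X" by (rule splice) (use assms in auto)
  have 2: "(\<lambda>j. if j < t - w then (if j < s then x j else y j) else x j) \<in> X"
    by (rule splice[OF 1 assms(1)]) (use assms(3,5) in auto)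
  moreover have "(\<lambda>j. if j < t - w then (if j < s then x j else y j) else x j) = overwrite s t x y"
    using assms(3,5) w_pos by (auto simp: overwrite_def fun_eq_iff)
  ultimately show ?thesis by simp
qed

text \<open>
  The margins of width \<open>w\<close> at both ends of the window are read but not changed. This keeps gates on
  disjoint windows independent, and it makes the inverse of a gate a gate.
\<close>

definition gate :: "int \<Rightarrow> int \<Rightarrow> ((int \<Rightarrow> 'a) \<Rightarrow> (int \<Rightarrow> 'a)) \<Rightarrow> bool" where
  "gate s t P \<longleftrightarrow> s + 2 * w \<le> t \<and> P permutes X \<and>
     (\<forall>x\<in>X. \<forall>i. \<not> (s + w \<le> i \<and> i < t - w) \<longrightarrow> P x i = x i) \<and>
     (\<forall>x\<in>X. \<forall>y\<in>X. (\<forall>i. s \<le> i \<and> i < t \<longrightarrow> x i = y i) \<longrightarrow>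
        (\<forall>i. s \<le> i \<and> i < t \<longrightarrow> P x i = P y i))"

lemma gate_length: "gate s t P \<Longrightarrow> s + 2 * w \<le> t"
  by (simp add: gate_def)

lemma gate_permutes: "gate s t P \<Longrightarrow> P permutes X"
  by (simp add: gate_def)

lemma gate_in [simp]: "gate s t P \<Longrightarrow> P x \<in> X \<longleftrightarrow> x \<in> X"
  using gate_permutes permutes_in_image by metis

lemma gate_fixes: "gate s t P \<Longrightarrow> x \<in> X \<Longrightarrow> \<not> (s + w \<le> i \<and> i < t - w) \<Longrightarrow> P x i = x i"
  unfolding gate_def by blast

lemma gate_local:
  "gate s t P \<Longrightarrow> x \<in> X \<Longrightarrow> y \<in> X \<Longrightarrow> (\<And>i. s \<le> i \<Longrightarrow> i < t \<Longrightarrow> x i = y i) \<Longrightarrow>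
     s \<le> i \<Longrightarrow> i < t \<Longrightarrow> P x i = P y i"
  unfolding gate_def by blast

lemma gateI:
  assumes "s + 2 * w \<le> t" "P permutes X"
    "\<And>x i. x \<in> X \<Longrightarrow> \<not> (s + w \<le> i \<and> i < t - w) \<Longrightarrow> P x i = x i"
    "\<And>x y i. x \<in> X \<Longrightarrow> y \<in> X \<Longrightarrow> (\<And>i. s \<le> i \<Longrightarrow> i < t \<Longrightarrow> x i = y i) \<Longrightarrow>
     s \<le> i \<Longrightarrow> i < t \<Longrightarrow> P x i = P y i"
  shows "gate s t P"
  unfolding gate_def using assms by blast

lemma gate_mono:
  assumes "gate s t P" "s' \<le> s" "t \<le> t'"
  shows "gate s' t' P"
proof (rule gateI)
  show "s' + 2 * w \<le> t'" using gate_length[OF assms(1)] assms by simp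
  show "P permutes X" using assms gate_permutes by blast
  show "P x i = x i" if "x \<in> X" "\<not> (s' + w \<le> i \<and> i < t' - w)" for x i
    by (rule gate_fixes[OF assms(1)]) (use that assms in auto)
  show "P x i = P y i" if "x \<in> X" "y \<in> X" "\<And>i. s' \<le> i \<Longrightarrow> i < t' \<Longrightarrow> x i = y i" "s' \<le> i" "i < t'" for x y i
  proof (cases "s \<le> i \<and> i < t")
    case True
    show ?thesis by (rule gate_local[OF assms(1) that(1,2)]) (use that(3) True assms in auto)
  next
    case False
    then have "P x i = x i" "P y i = y i"
      using gate_fixes[OF assms(1)] that w_pos by auto
    then show ?thesis using that by simp
  qed
qed

lemma gate_comp:
  assumes "gate s t P" "gate s t Q"
  shows "gate s t (P \<circ> Q)"
proof (rule gateI)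
  show "s + 2 * w \<le> t" using assms gate_length by blast
  show "P \<circ> Q permutes X" using assms gate_permutes permutes_compose by blast
  show "(P \<circ> Q) x i = x i" if "x \<in> X" "\<not> (s + w \<le> i \<and> i < t - w)" for x i
    using that gate_fixes[OF assms(1), of "Q x" i] gate_fixes[OF assms(2), of x i] assms by simp
  show "(P \<circ> Q) x i = (P \<circ> Q) y i"
    if "x \<in> X" "y \<in> X" "\<And>i. s \<le> i \<Longrightarrow> i < t \<Longrightarrow> x i = y i" "s \<le> i" "i < t" for x y i
    unfolding comp_def
    by (rule gate_local[OF assms(1) _ _ gate_local[OF assms(2) that(1,2,3)] that(4,5)])
      (use assms(2) that(1,2) in simp_all)
qed

lemma gate_id: "s + 2 * w \<le> t \<Longrightarrow> gate s t id"
  by (rule gateI) (auto simp: permutes_id)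

text \<open>
  Only locality of the inverse needs an argument. If \<open>x\<close> and \<open>y\<close> agree on the window, then overwriting
  \<open>y\<close> there by the preimage of \<open>x\<close> gives a point of \<open>X\<close> that is mapped to \<open>y\<close>.
\<close>

lemma gate_inv:
  assumes "gate s t P"
  shows "gate s t (inv P)"
proof (rule gateI)
  have P: "P permutes X" using assms gate_permutes by blast
  show "s + 2 * w \<le> t" using assms gate_length by blast
  show "inv P permutes X" using P permutes_inv by blast
  have inX: "inv P x \<in> X" if "x \<in> X" for x
    using permutes_in_image[OF permutes_inv[OF P]] that by blast
  have PP: "P (inv P x) = x" for x using permutes_inverses(1)[OF P] .
  show fx: "inv P x i = x i" if "x \<in> X" "\<not> (s + w \<le> i \<and> i < t - w)" for x i
    using gate_fixes[OF assms inX that(2)] that(1) PP by metis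
  show "inv P x i = inv P y i"
    if xy: "x \<in> X" "y \<in> X" "\<And>i. s \<le> i \<Longrightarrow> i < t \<Longrightarrow> x i = y i" "s \<le> i" "i < t" for x y i
  proof -
    define z where "z = overwrite s t y (inv P x)"
    have z: "z \<in> X" unfolding z_def
    proof (rule overwrite_in)
      show "s + w \<le> t" using gate_length[OF assms] w_pos by simp
      fix j
      show "y j = inv P x j" if "s \<le> j" "j < s + w"
        using fx[of x j] xy that gate_length[OF assms] w_pos by simp
      show "y j = inv P x j" if "t - w \<le> j" "j < t"
        using fx[of x j] xy that gate_length[OF assms] w_pos by simp
    qed (use xy inX in auto)
    have "P z k = y k" for k
    proof (cases "s \<le> k \<and> k < t")
      case True
      then have "P z k = P (inv P x) k"
        by (intro gate_local[OF assms z inX[OF xy(1)]]) (simp_all add: z_def overwrite_def)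
      then show ?thesis using PP xy True by simp
    next
      case False
      then have "P z k = z k" using gate_fixes[OF assms z, of k] w_pos by auto
      then show ?thesis using False by (auto simp: z_def overwrite_def)
    qed
    then have "P z = y" by (simp add: fun_eq_iff)
    then have "inv P y = z" using permutes_inverses(2)[OF P] by metis
    then show ?thesis using xy by (simp add: z_def overwrite_def)
  qed
qed

text \<open>
  The gate \<open>P\<close> on the window \<open>{s..<t}\<close> becomes a gate on \<open>{s + c..<t + c}\<close>.
\<close>

definition translate :: "int \<Rightarrow> ((int \<Rightarrow> 'a) \<Rightarrow> (int \<Rightarrow> 'a)) \<Rightarrow> (int \<Rightarrow> 'a) \<Rightarrow> (int \<Rightarrow> 'a)" where
  "translate c P = shift_by (- c) \<circ> P \<circ> shift_by c"

lemma translate_apply: "translate c P x i = P (shift_by c x) (i - c)"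
  by (simp add: translate_def)

lemma translate_translateanslate: "translate c (translate d P) = translate (c + d) P"
  by (auto simp: translate_def fun_eq_iff algebra_simps)

lemma translate_0 [simp]: "translate 0 P = P"
  by (auto simp: translate_def fun_eq_iff)

lemma translate_comp: "translate c (P \<circ> Q) = translate c P \<circ> translate c Q"
  by (auto simp: translate_def fun_eq_iff)

lemma shift_in_iff: "shift_by n x \<in> X \<longleftrightarrow> x \<in> X"
  using shift_in[of "shift_by n x" "- n"] by auto

lemma translate_permutes: assumes "P permutes X" shows "translate c P permutes X"
proof (rule bij_imp_permutes)
  have "translate c P \<circ> translate c (inv P) = id" "translate c (inv P) \<circ> translate c P = id"
    by (auto simp: translate_def fun_eq_iff permutes_inverses[OF assms])
  then have "bij (translate c P)" using o_bij by blast
  have im: "translate c P x \<in> X \<longleftrightarrow> x \<in> X" for x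
    by (simp add: translate_def shift_in_iff permutes_in_image[OF assms])
  show "bij_betw (translate c P) X X"
    unfolding bij_betw_def
  proof
    show "inj_on (translate c P) X" using \<open>bij (translate c P)\<close> bij_is_inj inj_on_subset by blast
    show "translate c P ` X = X"
    proof
      show "X \<subseteq> translate c P ` X"
      proof
        fix y assume "y \<in> X"
        obtain x where "y = translate c P x" using \<open>bij (translate c P)\<close> by (metis bij_pointE)
        then show "y \<in> translate c P ` X" using im \<open>y \<in> X\<close> by auto
      qed
    qed (use im in auto)
  qed
  fix x assume "x \<notin> X"
  then have "P (shift_by c x) = shift_by c x"
    using permutes_not_in[OF assms] shift_in_iff by metis
  then show "translate c P x = x" by (simp add: translate_def)
qed

lemma translate_inv: assumes "P permutes X" shows "inv (translate c P) = translate c (inv P)"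
  by (rule inv_unique_comp) (auto simp: translate_def fun_eq_iff permutes_inverses[OF assms])

lemma gate_translate:
  assumes "gate s t P" shows "gate (s + c) (t + c) (translate c P)"
proof (rule gateI)
  show "s + c + 2 * w \<le> t + c" using gate_length[OF assms] by simp
  show "translate c P permutes X" using assms gate_permutes translate_permutes by blast
  show "translate c P x i = x i" if "x \<in> X" "\<not> (s + c + w \<le> i \<and> i < t + c - w)" for x i
  proof -
    have "\<not> (s + w \<le> i - c \<and> i - c < t - w)" using that by auto
    then show ?thesis
      using gate_fixes[OF assms, of "shift_by c x" "i - c"] that by (simp add: translate_apply)
  qed
  show "translate c P x i = translate c P y i"
    if "x \<in> X" "y \<in> X" "\<And>i. s + c \<le> i \<Longrightarrow> i < t + c \<Longrightarrow> x i = y i" "s + c \<le> i" "i < t + c" for x y i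
    unfolding translate_apply by (rule gate_local[OF assms]) (use that in auto)
qed

lemma translate_eq_if_commutes:
  assumes "P permutes X" "\<And>x. x \<in> X \<Longrightarrow> P (shift_by c x) = shift_by c (P x)"
  shows "translate c P = P"
proof
  fix x
  show "translate c P x = P x"
    using assms permutes_not_in[OF assms(1), of x] permutes_not_in[OF assms(1), of "shift_by c x"] shift_in_iff[of c x]
    by (cases "x \<in> X") (auto simp: translate_def)
qed

text \<open>
  The gate \<open>P\<close> is applied at all positions of \<open>k\<int>\<close>. For windows of length at most \<open>k\<close> at most one of the
  translates moves a given coordinate, so that the choice is immaterial; the definition does not
  mention the window, since a gate has many.
\<close>

definition lattice :: "int \<Rightarrow> ((int \<Rightarrow> 'a) \<Rightarrow> (int \<Rightarrow> 'a)) \<Rightarrow> (int \<Rightarrow> 'a) \<Rightarrow> (int \<Rightarrow> 'a)" where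
  "lattice k P x = (if x \<in> X then
     (\<lambda>i. if \<exists>j. translate (k * j) P x i \<noteq> x i then translate (k * (SOME j. translate (k * j) P x i \<noteq> x i)) P x i else x i)
     else x)"

lemma lattice_apply:
  assumes "gate s t P" "t - s \<le> k" "x \<in> X" "s \<le> i" "i < s + k"
  shows "lattice k P x (i + k * j) = P (shift_by (k * j) x) i"
proof -
  have un: "j' = j" if "translate (k * j') P x (i + k * j) \<noteq> x (i + k * j)" for j'
  proof -
    have "P (shift_by (k * j') x) (i + k * j - k * j') \<noteq> shift_by (k * j') x (i + k * j - k * j')"
      using that by (simp add: translate_apply)
    then have "s + w \<le> i + k * j - k * j' \<and> i + k * j - k * j' < t - w"
      using gate_fixes[OF assms(1)] assms(3) shift_in by metis
    then have "\<bar>k * (j - j')\<bar> < k" using assms w_pos by (auto simp: right_diff_distrib)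
    then show ?thesis using mult_small_zero by fastforce
  qed
  show ?thesis
  proof (cases "translate (k * j) P x (i + k * j) = x (i + k * j)")
    case True
    then have "\<not> (\<exists>j'. translate (k * j') P x (i + k * j) \<noteq> x (i + k * j))" using un by metis
    then show ?thesis using True assms by (simp add: lattice_def translate_apply)
  next
    case False
    then have "(SOME j'. translate (k * j') P x (i + k * j) \<noteq> x (i + k * j)) = j"
      using un by (intro some_equality) auto
    moreover have "\<exists>j'. translate (k * j') P x (i + k * j) \<noteq> x (i + k * j)" using False by blast
    ultimately show ?thesis using assms by (simp add: lattice_def translate_apply)
  qed
qed

lemma period_pos: "gate s t P \<Longrightarrow> t - s \<le> k \<Longrightarrow> w < k"
  using gate_length w_pos by force

lemma lattice_unique:
  assumes "gate s t P" "t - s \<le> k" "x \<in> X"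
    "\<And>i j. s \<le> i \<Longrightarrow> i < s + k \<Longrightarrow> y (i + k * j) = P (shift_by (k * j) x) i"
  shows "lattice k P x = y"
proof
  fix n
  have "0 < k" using period_pos[OF assms(1,2)] w_pos by simp
  then obtain i j where "n = i + k * j" "s \<le> i" "i < s + k" using block_position[of k n s] by auto
  then show "lattice k P x n = y n" using lattice_apply[OF assms(1-3)] assms(4) by simp
qed

text \<open>
  Locally the image looks like the image under one of the translates: a window of length \<open>w + 1\<close> that
  starts in one period reaches only into the unchanged margin of the next one.
\<close>

lemma lattice_in:
  assumes "gate s t P" "t - s \<le> k" "x \<in> X"
  shows "lattice k P x \<in> X"
proof (rule local)
  fix n
  have k: "w < k" "0 < k" using period_pos[OF assms(1,2)] w_pos by auto
  then obtain i j where ij: "n = i + k * j" "s \<le> i" "i < s + k" using block_position[of k n s] by auto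
  have g: "gate s (s + k) P" using assms gate_mono by force
  let ?z = "translate (k * j) P x"
  have "?z \<in> X" using assms by (simp add: translate_def)
  moreover have "?z m = lattice k P x m" if m: "n \<le> m \<and> m \<le> n + w" for m
  proof (cases "m - k * j < s + k")
    case True
    then have "lattice k P x ((m - k * j) + k * j) = P (shift_by (k * j) x) (m - k * j)"
      using ij m by (intro lattice_apply[OF assms]) auto
    then show ?thesis by (simp add: translate_apply)
  next
    case False
    let ?i = "m - k * (j + 1)"
    have i: "s \<le> ?i" "?i < s + w" using False m ij by (auto simp: distrib_left)
    then have "lattice k P x (?i + k * (j + 1)) = P (shift_by (k * (j + 1)) x) ?i"
      using k by (intro lattice_apply[OF assms]) auto
    also have "\<dots> = x m" using gate_fixes[OF g, of "shift_by (k * (j + 1)) x" ?i] i assms by simp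
    finally have "lattice k P x m = x m" by simp
    moreover have "?z m = x m"
      using gate_fixes[OF g, of "shift_by (k * j) x" "m - k * j"] False assms w_pos by (simp add: translate_apply)
    ultimately show ?thesis by simp
  qed
  ultimately show "\<exists>z\<in>X. \<forall>m. n \<le> m \<and> m \<le> n + w \<longrightarrow> z m = lattice k P x m" by blast
qed

lemma lattice_notin: "x \<notin> X \<Longrightarrow> lattice k P x = x"
  by (simp add: lattice_def)

lemma lattice_shift:
  assumes "gate s t P" "t - s \<le> k" "x \<in> X"
  shows "lattice k P (shift_by (k * m) x) = shift_by (k * m) (lattice k P x)"
proof (rule lattice_unique[OF assms(1,2)])
  fix i j assume "s \<le> i" "i < s + k"
  then have "lattice k P x (i + k * (j + m)) = P (shift_by (k * (j + m)) x) i"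
    by (intro lattice_apply[OF assms])
  then show "shift_by (k * m) (lattice k P x) (i + k * j) = P (shift_by (k * j) (shift_by (k * m) x)) i"
    by (simp add: algebra_simps)
qed (use assms in simp)

lemma lattice_comp:
  assumes "gate s t P" "gate s t Q" "t - s \<le> k"
  shows "lattice k (P \<circ> Q) = lattice k P \<circ> lattice k Q"
proof
  fix x
  have g: "gate s (s + k) P" "gate s (s + k) Q" using assms gate_mono by force+
  show "lattice k (P \<circ> Q) x = (lattice k P \<circ> lattice k Q) x"
  proof (cases "x \<in> X")
    case True
    show ?thesis
    proof (rule lattice_unique[OF gate_comp[OF assms(1,2)] assms(3) True])
      fix i j assume i: "s \<le> i" "i < s + k"
      have Lx: "lattice k Q x \<in> X" using lattice_in assms True by blast
      have "lattice k P (lattice k Q x) (i + k * j) = P (shift_by (k * j) (lattice k Q x)) i"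
        by (rule lattice_apply[OF assms(1,3) Lx i])
      also have "\<dots> = P (Q (shift_by (k * j) x)) i"
      proof (rule gate_local[OF g(1)])
        fix i assume "s \<le> i" "i < s + k"
        then show "shift_by (k * j) (lattice k Q x) i = Q (shift_by (k * j) x) i"
          using lattice_apply[OF assms(2,3) True] by simp
      qed (use i Lx True assms in auto)
      finally show "(lattice k P \<circ> lattice k Q) x (i + k * j) = (P \<circ> Q) (shift_by (k * j) x) i" by simp
    qed
  qed (simp add: lattice_notin)
qed

lemma lattice_id: "lattice k id = id"
  by (auto simp: lattice_def fun_eq_iff translate_apply)

lemma gate_inv_comp: "gate s t P \<Longrightarrow> P \<circ> inv P = id" "gate s t P \<Longrightarrow> inv P \<circ> P = id"
  using gate_permutes permutes_inv_o by blast+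

lemma lattice_inv_comp:
  assumes "gate s t P" "t - s \<le> k"
  shows "lattice k P \<circ> lattice k (inv P) = id" "lattice k (inv P) \<circ> lattice k P = id"
  using lattice_comp[OF assms(1) gate_inv[OF assms(1)] assms(2)]
    lattice_comp[OF gate_inv[OF assms(1)] assms(1,2)] gate_inv_comp[OF assms(1)] lattice_id
  by simp_all

lemma inv_lattice:
  assumes "gate s t P" "t - s \<le> k"
  shows "inv (lattice k P) = lattice k (inv P)"
  using lattice_inv_comp[OF assms] by (intro inv_unique_comp) auto

lemma lattice_permutes:
  assumes "gate s t P" "t - s \<le> k"
  shows "lattice k P permutes X"
proof -
  have "bij (lattice k P)" using lattice_inv_comp[OF assms] o_bij by blast
  then show ?thesis by (auto simp: permutes_def bij_iff lattice_notin)
qed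

lemma lattice_radius:
  assumes "gate s t P" "t - s \<le> k"
  shows "has_radius X (lattice k P) k"
  unfolding has_radius_def
proof (intro ballI allI impI)
  fix x y n assume xy: "x \<in> X" "y \<in> X" "\<forall>j. \<bar>j - n\<bar> \<le> k \<longrightarrow> x j = y j"
  have k: "w < k" "0 < k" using period_pos[OF assms(1,2)] w_pos by auto
  then obtain i j where ij: "n = i + k * j" "s \<le> i" "i < s + k" using block_position[of k n s] by auto
  have g: "gate s (s + k) P" using assms gate_mono by force
  have "P (shift_by (k * j) x) i = P (shift_by (k * j) y) i"
    by (rule gate_local[OF g]) (use xy ij in auto)
  then show "lattice k P x n = lattice k P y n"
    using lattice_apply[OF assms] xy ij by simp
qed

text \<open>
  The positions \<open>k\<int>\<close> split into the residue classes modulo \<open>k m\<close>. After \<open>q\<close> steps the partial product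
  applies \<open>P\<close> at the positions \<open>k j\<close> with \<open>j mod m < q\<close>.
\<close>

lemma lattice_split:
  assumes P: "gate s t P" "t - s \<le> k" and "0 < m"
    and S: "id \<in> S" "\<And>f g. f \<in> S \<Longrightarrow> g \<in> S \<Longrightarrow> f \<circ> g \<in> S"
    and piece: "\<And>q. lattice (k * int m) (translate (k * q) P) \<in> S"
  shows "lattice k P \<in> S"
proof -
  have k: "w < k" "0 < k" using period_pos[OF P] w_pos by auto
  have g: "gate s (s + k) P" using P gate_mono by force
  let ?m = "int m"
  have "\<exists>F\<in>S. (\<forall>x. x \<notin> X \<longrightarrow> F x = x) \<and> (\<forall>x\<in>X. \<forall>i j. s \<le> i \<longrightarrow> i < s + k \<longrightarrow>
          F x (i + k * j) = (if j mod ?m < int q then P (shift_by (k * j) x) i else x (i + k * j)))" for q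
  proof (induction q)
    case 0
    have "\<not> j mod ?m < int 0" for j using \<open>0 < m\<close> by (simp add: not_less)
    then show ?case using S(1) by (intro bexI[of _ id]) auto
  next
    case (Suc q)
    show ?case
    proof (cases "q < m")
      case False
      have "j mod ?m < int q" "j mod ?m < int (Suc q)" for j
        using pos_mod_bound[of ?m j] \<open>0 < m\<close> False by linarith+
      then show ?thesis using Suc by simp
    next
      case True
      from Suc obtain F where F0: "F \<in> S" "\<forall>x. x \<notin> X \<longrightarrow> F x = x"
        "\<forall>x\<in>X. \<forall>i j. s \<le> i \<longrightarrow> i < s + k \<longrightarrow>
          F x (i + k * j) = (if j mod ?m < int q then P (shift_by (k * j) x) i else x (i + k * j))" by blast
      note F = F0(1) F0(2,3)[rule_format]
      let ?L = "lattice (k * ?m) (translate (k * int q) P)"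
      have g': "gate (s + k * int q) (s + k + k * int q) (translate (k * int q) P)"
        using gate_translate[OF g] .
      have le: "s + k + k * int q - (s + k * int q) \<le> k * ?m"
        using k \<open>0 < m\<close> by (simp add: mult_le_cancel_left1)
      have L: "?L x (i + k * j) = (if j mod ?m = int q then P (shift_by (k * j) x) i else x (i + k * j))"
        if x: "x \<in> X" "s \<le> i" "i < s + k" for x i j
      proof -
        define b where "b = (j - int q) mod ?m"
        define a where "a = (j - int q) div ?m"
        have ab: "j = int q + ?m * a + b" "0 \<le> b" "b < ?m"
          using \<open>0 < m\<close> by (simp_all add: a_def b_def)
        have kb: "0 \<le> k * b" "k * b + k \<le> k * ?m"
        proof -
          show "0 \<le> k * b" using k ab by simp
          have "k * (b + 1) \<le> k * ?m" using k ab by (intro mult_left_mono) auto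
          then show "k * b + k \<le> k * ?m" by (simp add: distrib_left)
        qed
        have "?L x ((i + k * int q + k * b) + k * ?m * a)
           = translate (k * int q) P (shift_by (k * ?m * a) x) (i + k * int q + k * b)"
          using x kb by (intro lattice_apply[OF g' le]) auto
        moreover have "(i + k * int q + k * b) + k * ?m * a = i + k * j"
          by (simp add: ab(1) algebra_simps)
        ultimately have e: "?L x (i + k * j) = P (shift_by (k * int q + k * ?m * a) x) (i + k * b)"
          by (simp add: translate_apply add.commute add.left_commute)
        have jm: "j mod ?m = int q \<longleftrightarrow> b = 0"
        proof
          assume "j mod ?m = int q"
          then have "(j - int q) mod ?m = 0" by (metis mod_eq_0_iff_dvd minus_mod_self2 dvd_minus_mod)
          then show "b = 0" by (simp add: b_def)
        next
          assume "b = 0"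
          then show "j mod ?m = int q" using ab True by simp
        qed
        show ?thesis
        proof (cases "b = 0")
          case True
          then have "k * int q + k * ?m * a = k * j" by (simp add: ab(1) algebra_simps)
          then show ?thesis using e jm True by simp
        next
          case False
          then have "k * 1 \<le> k * b" using ab k by (intro mult_left_mono) auto
          then have "\<not> i + k * b < s + k - w" using x(2) w_pos by linarith
          then have "P (shift_by (k * int q + k * ?m * a) x) (i + k * b)
             = shift_by (k * int q + k * ?m * a) x (i + k * b)"
            using x by (intro gate_fixes[OF g]) auto
          also have "\<dots> = x (i + k * j)" by (simp add: ab(1) algebra_simps)
          finally show ?thesis using e jm False by simp
        qed
      qed
      have Lin: "?L x \<in> X" if "x \<in> X" for x using lattice_in[OF g' le that] .
      have "(F \<circ> ?L) x (i + k * j) = (if j mod ?m < int (Suc q) then P (shift_by (k * j) x) i else x (i + k * j))"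
        if x: "x \<in> X" "s \<le> i" "i < s + k" for x i j
      proof (cases "j mod ?m < int q")
        case True
        have "P (shift_by (k * j) (?L x)) i = P (shift_by (k * j) x) i"
        proof (rule gate_local[OF g])
          fix i' assume "s \<le> i'" "i' < s + k"
          then show "shift_by (k * j) (?L x) i' = shift_by (k * j) x i'"
            using L[OF x(1), of i' j] True by simp
        qed (use x Lin in auto)
        then show ?thesis using True F(3)[OF Lin[OF x(1)] x(2,3), of j] by simp
      next
        case False
        then have "(F \<circ> ?L) x (i + k * j) = ?L x (i + k * j)"
          using F(3)[OF Lin[OF x(1)] x(2,3), of j] by simp
        also have "\<dots> = (if j mod ?m = int q then P (shift_by (k * j) x) i else x (i + k * j))"
          by (rule L[OF x])
        finally show ?thesis using False by auto
      qed
      moreover have "F \<circ> ?L \<in> S" using F(1) S(2) piece by blast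
      moreover have "(F \<circ> ?L) x = x" if "x \<notin> X" for x using F(2) that by (simp add: lattice_notin)
      ultimately show ?thesis by (intro bexI[of _ "F \<circ> ?L"]) blast+
    qed
  qed
  from this[of m] obtain F where F0: "F \<in> S" "\<forall>x. x \<notin> X \<longrightarrow> F x = x"
    "\<forall>x\<in>X. \<forall>i j. s \<le> i \<longrightarrow> i < s + k \<longrightarrow>
      F x (i + k * j) = (if j mod ?m < ?m then P (shift_by (k * j) x) i else x (i + k * j))" by blast
  note F = F0(1) F0(2,3)[rule_format]
  have "lattice k P x = F x" for x
  proof (cases "x \<in> X")
    case True
    show ?thesis
    proof (rule lattice_unique[OF P True])
      fix i j assume "s \<le> i" "i < s + k"
      moreover have "j mod ?m < ?m" using \<open>0 < m\<close> by simp
      ultimately show "F x (i + k * j) = P (shift_by (k * j) x) i" using F(3)[OF True, of i j] by simp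
    qed
  qed (simp add: F(2) lattice_notin)
  then have "lattice k P = F" by (simp add: fun_eq_iff)
  then show ?thesis using F(1) by simp
qed

end

section \<open>Gates as permutations of words\<close>

locale finite_alphabet_shift = local_shift X w for X :: "(int \<Rightarrow> 'a) set" and w +
  fixes A :: "'a set"
  assumes finite_A: "finite A"
    and alphabet: "\<And>x i. x \<in> X \<Longrightarrow> x i \<in> A"

text \<open>
  The gap \<open>D\<close> needed for gluing a left half of one point to a right half of another expresses mixing.
\<close>

locale mixing_shift = finite_alphabet_shift X w A for X :: "(int \<Rightarrow> 'a) set" and w A +
  fixes D :: int
  assumes D_nonneg: "0 \<le> D"
    and glue: "\<And>x y i. x \<in> X \<Longrightarrow> y \<in> X \<Longrightarrow> \<exists>z\<in>X. (\<forall>j<i. z j = x j) \<and> (\<forall>j\<ge>i + D. z j = y j)"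
    and nontrivial: "\<exists>x\<in>X. \<exists>y\<in>X. x \<noteq> y"
begin

lemma periodic_nat:
  assumes "shift_by p x = x" shows "x (j + p * int n) = x j"
proof (induction n)
  case (Suc n)
  have "x (j + p * int (Suc n)) = shift_by p x (j + p * int n)"
    by (simp add: algebra_simps)
  then show ?case using assms Suc by simp
qed simp

lemma periodic_if_finite:
  assumes "finite X" "x \<in> X" shows "\<exists>p>0. shift_by p x = x"
proof -
  have "(\<lambda>n::nat. shift_by (int n) x) ` UNIV \<subseteq> X" using assms by auto
  then have "\<not> inj (\<lambda>n::nat. shift_by (int n) x)"
    using assms(1) finite_imageD finite_subset infinite_UNIV_nat by blast
  then obtain a b :: nat where "shift_by (int a) x = shift_by (int b) x" "a < b"
    unfolding inj_on_def by (metis linorder_neqE_nat)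
  then have "shift_by (- int a) (shift_by (int a) x) = shift_by (- int a) (shift_by (int b) x)" by simp
  then have "x = shift_by (int b - int a) x" by simp
  then show ?thesis using \<open>a < b\<close> by (intro exI[of _ "int b - int a"]) auto
qed

text \<open>
  If \<open>X\<close> were finite, all points would be periodic. Gluing the left half of \<open>x\<close> to the right half of
  \<open>y\<close> gives a point that equals \<open>x\<close> and \<open>y\<close>, since a common period propagates agreement on a half
  line.
\<close>

lemma infinite_X: "infinite X"
proof
  assume fin: "finite X"
  obtain x y where xy: "x \<in> X" "y \<in> X" "x \<noteq> y" using nontrivial by blast
  obtain z where z: "z \<in> X" "\<forall>j<0. z j = x j" "\<forall>j\<ge>D. z j = y j" using glue[OF xy(1,2), of 0] by auto
  obtain p q r where pqr: "p > 0" "shift_by p x = x" "q > 0" "shift_by q y = y" "r > 0" "shift_by r z = z"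
    using periodic_if_finite[OF fin] xy z by metis
  define L where "L = p * (q * r)"
  have pos: "0 < L" using pqr by (simp add: L_def)
  have per: "x (j + L * int n) = x j" "y (j + L * int n) = y j" "z (j + L * int n) = z j" for j n
  proof -
    have "L * int n = p * int (nat (q * r) * n)" "L * int n = q * int (nat (p * r) * n)"
      "L * int n = r * int (nat (p * q) * n)"
      using pqr by (simp_all add: L_def algebra_simps)
    then show "x (j + L * int n) = x j" "y (j + L * int n) = y j" "z (j + L * int n) = z j"
      using periodic_nat pqr by metis+
  qed
  have big: "int (nat \<bar>m\<bar>) \<le> L * int (nat \<bar>m\<bar>)" for m
    using pos by (simp add: mult_le_cancel_right1)
  have "x j = y j" for j
  proof -
    let ?n = "nat (\<bar>j\<bar> + 1)"
    have n: "\<bar>j\<bar> + 1 \<le> L * int ?n" using big[of "\<bar>j\<bar> + 1"] by simp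
    have "x j = x ((j - L * int ?n) + L * int ?n)" by simp
    also have "\<dots> = x (j - L * int ?n)" by (rule per)
    also have "\<dots> = z (j - L * int ?n)"
    proof -
      have "j - L * int ?n < 0" using n by linarith
      then show ?thesis using z(2)[rule_format, of "j - L * int ?n"] by (simp only:)
    qed
    also have "\<dots> = z ((j - L * int ?n) + L * int ?n)" by (rule per[symmetric])
    finally have xz: "x j = z j" by simp
    let ?m = "nat (\<bar>j\<bar> + \<bar>D\<bar>)"
    have m: "\<bar>j\<bar> + \<bar>D\<bar> \<le> L * int ?m" using big[of "\<bar>j\<bar> + \<bar>D\<bar>"] by simp
    have "y j = y (j + L * int ?m)" by (rule per[symmetric])
    also have "\<dots> = z (j + L * int ?m)"
    proof -
      have "D \<le> j + L * int ?m" using m by linarith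
      then show ?thesis using z(3)[rule_format, of "j + L * int ?m"] by (simp only:)
    qed
    also have "\<dots> = z j" by (rule per)
    finally show ?thesis using xz by simp
  qed
  then show False using xy by auto
qed

lemma embed:
  assumes "x \<in> X" "y \<in> X" "S + w + D \<le> T - w"
  shows "\<exists>z\<in>X. (\<forall>j. j < S + w \<longrightarrow> z j = x j) \<and> (\<forall>j. T - w \<le> j \<longrightarrow> z j = x j) \<and>
           (\<forall>j. S + w + D \<le> j \<longrightarrow> j < T - w - D \<longrightarrow> z j = y j)"
proof -
  obtain a where a: "a \<in> X" "\<forall>j<S + w. a j = x j" "\<forall>j\<ge>S + w + D. a j = y j"
    using glue[OF assms(1,2)] by blast
  obtain b where b: "b \<in> X" "\<forall>j<T - w - D. b j = a j" "\<forall>j\<ge>T - w - D + D. b j = x j"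
    using glue[OF a(1) assms(1)] by blast
  show ?thesis
    using a b assms(3) D_nonneg by (intro bexI[of _ b]) auto
qed

definition word :: "int \<Rightarrow> int \<Rightarrow> (int \<Rightarrow> 'a) \<Rightarrow> int \<Rightarrow> 'a" where
  "word S T x = restrict x {S..<T}"

definition words :: "int \<Rightarrow> int \<Rightarrow> (int \<Rightarrow> 'a) set" where
  "words S T = word S T ` X"

text \<open>
  Gates preserve this pair; it indexes the factors of the group of gates on a window as a product of
  symmetric groups.
\<close>

definition margins :: "int \<Rightarrow> int \<Rightarrow> (int \<Rightarrow> 'a) \<Rightarrow> (int \<Rightarrow> 'a) \<times> (int \<Rightarrow> 'a)" where
  "margins S T u = (\<lambda>i\<in>{0..<w}. u (S + i), \<lambda>i\<in>{0..<w}. u (T - w + i))"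

text \<open>
  An upper bound for the order of the quotient of the gates by \<open>PP\<close>, whatever the window.
\<close>

definition class_bound :: nat where
  "class_bound = 2 ^ card (({0..<w} \<rightarrow>\<^sub>E A) \<times> ({0..<w} \<rightarrow>\<^sub>E A))"

lemma word_eq_iff: "word S T x = word S T y \<longleftrightarrow> (\<forall>i. S \<le> i \<longrightarrow> i < T \<longrightarrow> x i = y i)"
  unfolding word_def by (auto simp: fun_eq_iff restrict_def)

lemma word_apply: "S \<le> i \<Longrightarrow> i < T \<Longrightarrow> word S T x i = x i"
  by (simp add: word_def)

lemma word_in_words: "x \<in> X \<Longrightarrow> word S T x \<in> words S T"
  by (simp add: words_def)

lemma finite_words: "finite (words S T)"
proof (rule finite_subset)
  show "words S T \<subseteq> {S..<T} \<rightarrow>\<^sub>E A" using alphabet by (auto simp: words_def word_def)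
qed (use finite_A in \<open>auto intro: finite_PiE\<close>)

lemma margins_word_eq_iff:
  assumes "S + 2 * w \<le> T"
  shows "margins S T (word S T x) = margins S T (word S T y) \<longleftrightarrow>
    (\<forall>j. S \<le> j \<longrightarrow> j < S + w \<longrightarrow> x j = y j) \<and> (\<forall>j. T - w \<le> j \<longrightarrow> j < T \<longrightarrow> x j = y j)"
proof
  assume e: "margins S T (word S T x) = margins S T (word S T y)"
  have 1: "word S T x (S + i) = word S T y (S + i)" if "0 \<le> i" "i < w" for i
    using fun_cong[OF conjunct1[OF e[unfolded margins_def prod.inject]], of i] that by simp
  have 2: "word S T x (T - w + i) = word S T y (T - w + i)" if "0 \<le> i" "i < w" for i
    using fun_cong[OF conjunct2[OF e[unfolded margins_def prod.inject]], of i] that by simp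
  have "x j = y j" if "S \<le> j" "j < S + w" for j
    using 1[of "j - S"] that assms w_pos by (simp add: word_apply)
  moreover have "x j = y j" if "T - w \<le> j" "j < T" for j
    using 2[of "j - (T - w)"] that assms w_pos by (simp add: word_apply)
  ultimately show "(\<forall>j. S \<le> j \<longrightarrow> j < S + w \<longrightarrow> x j = y j) \<and> (\<forall>j. T - w \<le> j \<longrightarrow> j < T \<longrightarrow> x j = y j)"
    by blast
next
  assume e: "(\<forall>j. S \<le> j \<longrightarrow> j < S + w \<longrightarrow> x j = y j) \<and> (\<forall>j. T - w \<le> j \<longrightarrow> j < T \<longrightarrow> x j = y j)"
  have "word S T x (S + i) = word S T y (S + i)" "word S T x (T - w + i) = word S T y (T - w + i)"
    if "i \<in> {0..<w}" for i
    using e that assms w_pos by (simp_all add: word_apply)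
  then show "margins S T (word S T x) = margins S T (word S T y)"
    unfolding margins_def by (auto intro!: restrict_ext)
qed

lemma card_margins_bound:
  assumes "S + 2 * w \<le> T" shows "2 ^ card (margins S T ` words S T) \<le> class_bound"
proof -
  have "margins S T ` words S T \<subseteq> ({0..<w} \<rightarrow>\<^sub>E A) \<times> ({0..<w} \<rightarrow>\<^sub>E A)"
    using alphabet assms w_pos by (auto simp: margins_def words_def word_apply)
  moreover have "finite (({0..<w} \<rightarrow>\<^sub>E A) \<times> ({0..<w} \<rightarrow>\<^sub>E A))"
    using finite_A by (intro finite_cartesian_product finite_PiE) auto
  ultimately have "card (margins S T ` words S T) \<le> card (({0..<w} \<rightarrow>\<^sub>E A) \<times> ({0..<w} \<rightarrow>\<^sub>E A))"
    using card_mono by blast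
  then show ?thesis unfolding class_bound_def by (simp add: power_increasing)
qed

lemma five_points: "\<exists>F l. F \<subseteq> X \<and> card F = 5 \<and> 0 \<le> l \<and>
    (\<forall>x\<in>F. \<forall>y\<in>F. x \<noteq> y \<longrightarrow> (\<exists>i. - l \<le> i \<and> i < l \<and> x i \<noteq> y i))"
proof -
  obtain F where F: "F \<subseteq> X" "card F = 5" "finite F"
    using infinite_arbitrarily_large[OF infinite_X, of 5] by auto
  define d :: "(int \<Rightarrow> 'a) \<times> (int \<Rightarrow> 'a) \<Rightarrow> int"
    where "d = (\<lambda>(x, y). SOME i. x i \<noteq> (y i :: 'a))"
  have d: "x (d (x, y)) \<noteq> y (d (x, y))" if "x \<noteq> y" for x y :: "int \<Rightarrow> 'a"
  proof -
    have "\<exists>i. x i \<noteq> y i" using that by auto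
    from someI_ex[OF this] show ?thesis by (simp add: d_def)
  qed
  obtain M where M: "\<forall>i\<in>d ` (F \<times> F). \<bar>i\<bar> \<le> M" using finite_int_bound[of "d ` (F \<times> F)"] F by auto
  have "\<exists>i. - (\<bar>M\<bar> + 1) \<le> i \<and> i < \<bar>M\<bar> + 1 \<and> x i \<noteq> y i" if "x \<in> F" "y \<in> F" "x \<noteq> y" for x y
  proof -
    have "\<bar>d (x, y)\<bar> \<le> M" using M that by blast
    then have "- (\<bar>M\<bar> + 1) \<le> d (x, y) \<and> d (x, y) < \<bar>M\<bar> + 1" by linarith
    then show ?thesis using d[OF that(3)] by blast
  qed
  then show ?thesis using F by (intro exI[of _ F] exI[of _ "\<bar>M\<bar> + 1"]) auto
qed

text \<open>
  Five points that are distinguished in the middle are glued into the given margins, which is possible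
  once the window is long enough.
\<close>

lemma five_words:
  "\<exists>L>0. \<forall>S T. S \<le> - L \<longrightarrow> L \<le> T \<longrightarrow> S + 2 * w \<le> T \<and>
     (\<forall>u\<in>words S T. 5 \<le> card {v \<in> words S T. margins S T v = margins S T u})"
proof -
  obtain F l where F: "F \<subseteq> X" "card F = 5" "0 \<le> l"
    "\<forall>x\<in>F. \<forall>y\<in>F. x \<noteq> y \<longrightarrow> (\<exists>i. - l \<le> i \<and> i < l \<and> x i \<noteq> y i)"
    using five_points by blast
  have "5 \<le> card {v \<in> words S T. margins S T v = margins S T u}" and "S + 2 * w \<le> T"
    if ST: "S \<le> - (l + w + D)" "l + w + D \<le> T" "u \<in> words S T" for S T u
  proof -
    show ST2: "S + 2 * w \<le> T" using ST F(3) D_nonneg w_pos by linarith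
    obtain x where x: "x \<in> X" "u = word S T x" using ST by (auto simp: words_def)
    have "\<forall>y\<in>F. \<exists>z. z \<in> X \<and> (\<forall>j. j < S + w \<longrightarrow> z j = x j) \<and> (\<forall>j. T - w \<le> j \<longrightarrow> z j = x j) \<and>
           (\<forall>j. S + w + D \<le> j \<longrightarrow> j < T - w - D \<longrightarrow> z j = y j)"
    proof
      fix y assume "y \<in> F"
      then have "y \<in> X" using F by blast
      show "\<exists>z. z \<in> X \<and> (\<forall>j. j < S + w \<longrightarrow> z j = x j) \<and> (\<forall>j. T - w \<le> j \<longrightarrow> z j = x j) \<and>
           (\<forall>j. S + w + D \<le> j \<longrightarrow> j < T - w - D \<longrightarrow> z j = y j)"
        by (rule embed[unfolded Bex_def, OF x(1) \<open>y \<in> X\<close>]) (use ST F(3) D_nonneg in linarith)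
    qed
    from bchoice[OF this] obtain z where z0:
      "\<forall>y\<in>F. z y \<in> X \<and> (\<forall>j. j < S + w \<longrightarrow> z y j = x j) \<and> (\<forall>j. T - w \<le> j \<longrightarrow> z y j = x j) \<and>
           (\<forall>j. S + w + D \<le> j \<longrightarrow> j < T - w - D \<longrightarrow> z y j = y j)" by blast
    have inj: "inj_on (\<lambda>y. word S T (z y)) F"
    proof (rule inj_onI, rule ccontr)
      fix y y' assume y: "y \<in> F" "y' \<in> F" "word S T (z y) = word S T (z y')" "y \<noteq> y'"
      then obtain i where i: "- l \<le> i" "i < l" "y i \<noteq> y' i" using F(4) by blast
      have b: "S + w + D \<le> i" "i < T - w - D" "S \<le> i" "i < T"
        using i ST D_nonneg w_pos by auto
      have "z y i = y i" "z y' i = y' i" using z0 y b by blast+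
      moreover have "z y i = z y' i" using y(3) b by (simp add: word_eq_iff)
      ultimately show False using i by simp
    qed
    have sub: "(\<lambda>y. word S T (z y)) ` F \<subseteq> {v \<in> words S T. margins S T v = margins S T u}"
    proof
      fix v assume "v \<in> (\<lambda>y. word S T (z y)) ` F"
      then obtain y where y: "y \<in> F" "v = word S T (z y)" by blast
      have "v \<in> words S T" using y z0 by (simp add: word_in_words)
      moreover have "margins S T v = margins S T u"
        unfolding y(2) x(2) margins_word_eq_iff[OF ST2] using z0 y by simp
      ultimately show "v \<in> {v \<in> words S T. margins S T v = margins S T u}" by simp
    qed
    have "card ((\<lambda>y. word S T (z y)) ` F) \<le> card {v \<in> words S T. margins S T v = margins S T u}"
      by (rule card_mono[OF _ sub]) (simp add: finite_words)
    then show "5 \<le> card {v \<in> words S T. margins S T v = margins S T u}"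
      using card_image[OF inj] F(2) by simp
  qed note key = this
  have ne: "words S T \<noteq> {}" for S T using nontrivial by (auto simp: words_def)
  show ?thesis
  proof (intro exI[of _ "l + w + D"] conjI allI impI)
    show "0 < l + w + D" using F(3) D_nonneg w_pos by linarith
    show "S + 2 * w \<le> T" if "S \<le> - (l + w + D)" "l + w + D \<le> T" for S T
      using key(2)[OF that] ne by blast
    show "\<forall>u\<in>words S T. 5 \<le> card {v \<in> words S T. margins S T v = margins S T u}"
      if "S \<le> - (l + w + D)" "l + w + D \<le> T" for S T
      using key(1)[OF that] by blast
  qed
qed

definition word_perm :: "int \<Rightarrow> int \<Rightarrow> ((int \<Rightarrow> 'a) \<Rightarrow> (int \<Rightarrow> 'a)) \<Rightarrow> bool" where
  "word_perm S T p \<longleftrightarrow> p permutes words S T \<and> (\<forall>u\<in>words S T. margins S T (p u) = margins S T u)"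

definition lift :: "int \<Rightarrow> int \<Rightarrow> ((int \<Rightarrow> 'a) \<Rightarrow> (int \<Rightarrow> 'a)) \<Rightarrow> (int \<Rightarrow> 'a) \<Rightarrow> (int \<Rightarrow> 'a)" where
  "lift S T p x = (if x \<in> X then overwrite S T x (p (word S T x)) else x)"

lemma overwrite_word: "overwrite S T x (word S T y) = overwrite S T x y"
  by (auto simp: overwrite_def fun_eq_iff word_apply)

lemma word_perm_word:
  assumes "word_perm S T p" "x \<in> X"
  obtains y where "y \<in> X" "p (word S T x) = word S T y" "margins S T (word S T y) = margins S T (word S T x)"
proof -
  have "p (word S T x) \<in> words S T"
    using assms word_in_words[OF assms(2)] permutes_in_image unfolding word_perm_def by metis
  then obtain y where "y \<in> X" "p (word S T x) = word S T y" by (auto simp: words_def)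
  moreover have "margins S T (p (word S T x)) = margins S T (word S T x)"
    using assms word_in_words[OF assms(2)] by (auto simp: word_perm_def)
  ultimately show ?thesis using that by auto
qed

lemma lift_in:
  assumes "word_perm S T p" "S + 2 * w \<le> T" "x \<in> X"
  shows "lift S T p x \<in> X" "word S T (lift S T p x) = p (word S T x)"
proof -
  obtain y where y: "y \<in> X" "p (word S T x) = word S T y" "margins S T (word S T y) = margins S T (word S T x)"
    using word_perm_word assms by blast
  have m: "(\<forall>j. S \<le> j \<longrightarrow> j < S + w \<longrightarrow> y j = x j) \<and> (\<forall>j. T - w \<le> j \<longrightarrow> j < T \<longrightarrow> y j = x j)"
    using y(3) by (simp only: margins_word_eq_iff[OF assms(2)])
  have e: "lift S T p x = overwrite S T x y" using assms y by (simp add: lift_def overwrite_word)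
  have "overwrite S T x y \<in> X"
  proof (rule overwrite_in[OF assms(3) y(1)])
    show "S + w \<le> T" using assms(2) w_pos by simp
  qed (use m in simp_all)
  then show "lift S T p x \<in> X" using e by simp
  show "word S T (lift S T p x) = p (word S T x)"
    unfolding e y(2) word_eq_iff by (simp add: overwrite_def)
qed

lemma lift_comp:
  assumes "word_perm S T p" "word_perm S T q" "S + 2 * w \<le> T"
  shows "lift S T (p \<circ> q) = lift S T p \<circ> lift S T q"
proof
  fix x
  show "lift S T (p \<circ> q) x = (lift S T p \<circ> lift S T q) x"
  proof (cases "x \<in> X")
    case True
    have "lift S T p (lift S T q x) = overwrite S T (lift S T q x) (p (q (word S T x)))"
      using lift_in[OF assms(2,3) True] by (simp add: lift_def[of S T p])
    also have "\<dots> = overwrite S T x (p (q (word S T x)))"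
      using True by (auto simp: lift_def overwrite_def fun_eq_iff)
    finally show ?thesis using True by (simp add: lift_def)
  qed (simp add: lift_def)
qed

lemma lift_id: "lift S T id = id"
  by (auto simp: lift_def fun_eq_iff overwrite_def word_apply)

lemma word_perm_inv:
  assumes "word_perm S T p" shows "word_perm S T (inv p)"
proof -
  have p: "p permutes words S T" using assms by (simp add: word_perm_def)
  have "margins S T (inv p u) = margins S T u" if "u \<in> words S T" for u
  proof -
    have "inv p u \<in> words S T" using permutes_in_image[OF permutes_inv[OF p]] that by blast
    then have "margins S T (p (inv p u)) = margins S T (inv p u)" using assms by (auto simp: word_perm_def)
    then show ?thesis using permutes_inverses[OF p] by simp
  qed
  then show ?thesis using permutes_inv[OF p] by (auto simp: word_perm_def)
qed

lemma word_perm_comp: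
  "word_perm S T p \<Longrightarrow> word_perm S T q \<Longrightarrow> word_perm S T (p \<circ> q)"
  by (auto simp: word_perm_def permutes_compose permutes_in_image)

lemma word_perm_id: "word_perm S T id"
  by (simp add: word_perm_def permutes_id)

lemma lift_inv_comp:
  assumes "word_perm S T p" "S + 2 * w \<le> T"
  shows "lift S T p \<circ> lift S T (inv p) = id" "lift S T (inv p) \<circ> lift S T p = id"
proof -
  have p: "p permutes words S T" using assms by (simp add: word_perm_def)
  show "lift S T p \<circ> lift S T (inv p) = id"
    using lift_comp[OF assms(1) word_perm_inv[OF assms(1)] assms(2)] permutes_inv_o[OF p] lift_id by simp
  show "lift S T (inv p) \<circ> lift S T p = id"
    using lift_comp[OF word_perm_inv[OF assms(1)] assms(1,2)] permutes_inv_o[OF p] lift_id by simp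
qed

lemma inv_lift:
  assumes "word_perm S T p" "S + 2 * w \<le> T"
  shows "inv (lift S T p) = lift S T (inv p)"
  using lift_inv_comp[OF assms] by (intro inv_unique_comp) auto

lemma gate_lift:
  assumes "word_perm S T p" "S + 2 * w \<le> T"
  shows "gate S T (lift S T p)"
proof (rule gateI[OF assms(2)])
  have "bij (lift S T p)" using lift_inv_comp[OF assms] o_bij by blast
  then show "lift S T p permutes X" by (auto simp: permutes_def bij_iff lift_def)
next
  fix x i assume x: "x \<in> X" and i: "\<not> (S + w \<le> i \<and> i < T - w)"
  obtain y where y: "y \<in> X" "p (word S T x) = word S T y" "margins S T (word S T y) = margins S T (word S T x)"
    using word_perm_word[OF assms(1) x] by blast
  have m: "(\<forall>j. S \<le> j \<longrightarrow> j < S + w \<longrightarrow> y j = x j) \<and> (\<forall>j. T - w \<le> j \<longrightarrow> j < T \<longrightarrow> y j = x j)"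
    using y(3) by (simp only: margins_word_eq_iff[OF assms(2)])
  have "lift S T p x = overwrite S T x y" using x y by (simp add: lift_def overwrite_word)
  then show "lift S T p x i = x i" using m i by (auto simp: overwrite_def)
next
  fix x y i assume xy: "x \<in> X" "y \<in> X" "\<And>i. S \<le> i \<Longrightarrow> i < T \<Longrightarrow> x i = y i" "S \<le> i" "i < T"
  have "word S T x = word S T y" using xy(3) by (simp add: word_eq_iff)
  then show "lift S T p x i = lift S T p y i" using xy by (simp add: lift_def overwrite_def)
qed

lemma gate_word_map:
  assumes "gate S T P"
  obtains p where "\<And>x. x \<in> X \<Longrightarrow> p (word S T x) = word S T (P x)" "\<And>u. u \<notin> words S T \<Longrightarrow> p u = u"
proof -
  define p where "p u = (if u \<in> words S T then word S T (P (SOME x. x \<in> X \<and> word S T x = u)) else u)" for u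
  have "p (word S T x) = word S T (P x)" if x: "x \<in> X" for x
  proof -
    define y where "y = (SOME y. y \<in> X \<and> word S T y = word S T x)"
    have y: "y \<in> X" "word S T y = word S T x"
      using someI[of "\<lambda>y. y \<in> X \<and> word S T y = word S T x" x] x unfolding y_def by auto
    have "p (word S T x) = word S T (P y)" using word_in_words[OF x] by (simp add: p_def y_def)
    also have "\<dots> = word S T (P x)"
      unfolding word_eq_iff using y(2) gate_local[OF assms y(1) x] by (simp add: word_eq_iff)
    finally show ?thesis .
  qed
  moreover have "p u = u" if "u \<notin> words S T" for u using that by (simp add: p_def)
  ultimately show ?thesis using that by blast
qed

text \<open>
  By locality a gate induces a map on words, and the inverse gate induces the inverse map.
\<close>

lemma gate_is_lift:
  assumes "gate S T P"
  shows "\<exists>p. word_perm S T p \<and> P = lift S T p"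
proof -
  obtain p where p: "\<And>x. x \<in> X \<Longrightarrow> p (word S T x) = word S T (P x)" "\<And>u. u \<notin> words S T \<Longrightarrow> p u = u"
    using gate_word_map[OF assms] by blast
  obtain q where q: "\<And>x. x \<in> X \<Longrightarrow> q (word S T x) = word S T (inv P x)" "\<And>u. u \<notin> words S T \<Longrightarrow> q u = u"
    using gate_word_map[OF gate_inv[OF assms]] by blast
  have P: "P permutes X" using assms gate_permutes by blast
  have inX: "P x \<in> X" "inv P x \<in> X" if "x \<in> X" for x
    using that gate_in[OF assms] gate_in[OF gate_inv[OF assms]] by auto
  have len: "S + 2 * w \<le> T" using assms gate_length by blast
  have "p (q u) = u \<and> q (p u) = u" for u
  proof (cases "u \<in> words S T")
    case True
    then obtain x where "x \<in> X" "u = word S T x" by (auto simp: words_def)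
    then show ?thesis using p(1) q(1) inX permutes_inverses[OF P] by simp
  qed (simp add: p(2) q(2))
  then have "bij p" by (intro o_bij[of q p]) (auto simp: fun_eq_iff)
  then have "p permutes words S T" using p(2) by (auto simp: permutes_def bij_iff)
  moreover have "margins S T (p u) = margins S T u" if u: "u \<in> words S T" for u
  proof -
    obtain x where x: "x \<in> X" "u = word S T x" using u by (auto simp: words_def)
    have "\<forall>j. S \<le> j \<longrightarrow> j < S + w \<longrightarrow> P x j = x j" "\<forall>j. T - w \<le> j \<longrightarrow> j < T \<longrightarrow> P x j = x j"
      using gate_fixes[OF assms x(1)] by auto
    then show ?thesis using x p(1)[OF x(1)] by (simp add: margins_word_eq_iff[OF len])
  qed
  ultimately have wp: "word_perm S T p" by (simp add: word_perm_def)
  have "P x = lift S T p x" for x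
  proof (cases "x \<in> X")
    case True
    then show ?thesis
      using gate_fixes[OF assms True] w_pos p(1)[OF True]
      by (auto simp: lift_def overwrite_word overwrite_def word_apply intro!: ext)
  next
    case False
    then show ?thesis using permutes_not_in[OF P] by (simp add: lift_def)
  qed
  then have "P = lift S T p" by (simp add: fun_eq_iff)
  then show ?thesis using wp by blast
qed

lemma word_perm_swap:
  assumes "u \<in> words S T" "v \<in> words S T" "margins S T u = margins S T v"
  shows "word_perm S T (swap u v)"
  using assms by (auto simp: word_perm_def permutes_swap_id Transposition.transpose_def)

end

text \<open>
  A group \<open>PP\<close> that is normalised by all gates and contains a nontrivial gate. On every large window the
  gates in \<open>PP\<close> correspond to a normal subgroup of the class preserving permutations of words, to
  which \<open>class_permutations\<close> applies.
\<close>

locale normal_gates = mixing_shift X w A D for X :: "(int \<Rightarrow> 'a) set" and w A D +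
  fixes PP :: "((int \<Rightarrow> 'a) \<Rightarrow> (int \<Rightarrow> 'a)) set" and s0 t0 P0
  assumes PP_comp: "\<And>P Q. P \<in> PP \<Longrightarrow> Q \<in> PP \<Longrightarrow> P \<circ> Q \<in> PP"
    and PP_inv: "\<And>P. P \<in> PP \<Longrightarrow> inv P \<in> PP"
    and PP_id: "id \<in> PP"
    and PP_conj: "\<And>P Q s t. P \<in> PP \<Longrightarrow> gate s t Q \<Longrightarrow> Q \<circ> P \<circ> inv Q \<in> PP"
    and P0: "P0 \<in> PP" "gate s0 t0 P0" "P0 \<noteq> id"
begin

text \<open>
  That every class is moved follows by gluing: the word moved by \<open>P0\<close> extends to a word with any
  prescribed margins on a window that is larger by at least \<open>w + D\<close> on both sides.
\<close>

lemma large_window: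
  "\<exists>L>0. \<forall>S T. S \<le> - L \<longrightarrow> L \<le> T \<longrightarrow> S + 2 * w \<le> T \<and>
     class_permutations (words S T) (margins S T) {p. word_perm S T p \<and> lift S T p \<in> PP}"
proof -
  obtain L where L: "L > 0" "\<forall>S T. S \<le> - L \<longrightarrow> L \<le> T \<longrightarrow> S + 2 * w \<le> T \<and>
     (\<forall>u\<in>words S T. 5 \<le> card {v \<in> words S T. margins S T v = margins S T u})" using five_words by blast
  obtain y where y: "y \<in> X" "P0 y \<noteq> y"
    using P0 permutes_not_in[OF gate_permutes[OF P0(2)]] by (metis eq_id_iff ext)
  define L' where "L' = L + \<bar>s0\<bar> + \<bar>t0\<bar> + w + D"
  have "class_permutations (words S T) (margins S T) {p. word_perm S T p \<and> lift S T p \<in> PP}"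
    if ST: "S \<le> - L'" "L' \<le> T" for S T
  proof
    have ST': "S \<le> - L" "L \<le> T" using ST D_nonneg w_pos by (auto simp: L'_def)
    then have len: "S + 2 * w \<le> T" and five: "\<And>u. u \<in> words S T \<Longrightarrow> 5 \<le> card {v \<in> words S T. margins S T v = margins S T u}"
      using L(2) by blast+
    have w': "S + w + D \<le> s0" "t0 \<le> T - w - D" "S + w + D \<le> T - w"
      using ST L(1) D_nonneg w_pos by (auto simp: L'_def)
    show "finite (words S T)" by (rule finite_words)
    show "id \<in> {p. word_perm S T p \<and> lift S T p \<in> PP}" using word_perm_id PP_id lift_id by simp
    show "5 \<le> card {v \<in> words S T. margins S T v = margins S T u}" if "u \<in> words S T" for u using five[OF that] .
    fix p assume p: "p \<in> {p. word_perm S T p \<and> lift S T p \<in> PP}"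
    show "p permutes words S T" using p by (simp add: word_perm_def)
    show "margins S T (p u) = margins S T u" if "u \<in> words S T" for u using p that by (simp add: word_perm_def)
    show "inv p \<in> {p. word_perm S T p \<and> lift S T p \<in> PP}"
      using p word_perm_inv inv_lift[OF _ len] PP_inv by (metis (no_types, lifting) mem_Collect_eq)
    show "p \<circ> q \<in> {p. word_perm S T p \<and> lift S T p \<in> PP}"
      if "q \<in> {p. word_perm S T p \<and> lift S T p \<in> PP}" for q
      using p that word_perm_comp lift_comp[OF _ _ len] PP_comp by simp
    show "q \<circ> p \<circ> inv q \<in> {p. word_perm S T p \<and> lift S T p \<in> PP}"
      if q: "q permutes words S T" "\<And>u. u \<in> words S T \<Longrightarrow> margins S T (q u) = margins S T u" for q
    proof -
      have wq: "word_perm S T q" using q by (simp add: word_perm_def)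
      have wp: "word_perm S T p" using p by simp
      have "lift S T (q \<circ> p \<circ> inv q) = lift S T q \<circ> lift S T p \<circ> inv (lift S T q)"
        using lift_comp[OF word_perm_comp[OF wq wp] word_perm_inv[OF wq] len]
          lift_comp[OF wq wp len] inv_lift[OF wq len] by simp
      moreover have "\<dots> \<in> PP" using PP_conj[OF _ gate_lift[OF wq len]] p by simp
      ultimately show ?thesis using word_perm_comp[OF word_perm_comp[OF wq wp] word_perm_inv[OF wq]] by simp
    qed
  next
    fix u assume "u \<in> words S T"
    then obtain x where x: "x \<in> X" "u = word S T x" by (auto simp: words_def)
    have len: "S + 2 * w \<le> T" using ST D_nonneg w_pos L by (auto simp: L'_def)
    have w': "S + w + D \<le> s0" "t0 \<le> T - w - D" "S + w + D \<le> T - w"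
      using ST L(1) D_nonneg w_pos by (auto simp: L'_def)
    obtain z where z: "z \<in> X" "\<forall>j. j < S + w \<longrightarrow> z j = x j" "\<forall>j. T - w \<le> j \<longrightarrow> z j = x j"
      "\<forall>j. S + w + D \<le> j \<longrightarrow> j < T - w - D \<longrightarrow> z j = y j"
      using embed[OF x(1) y(1) w'(3)] by blast
    have zy: "z j = y j" if "s0 \<le> j" "j < t0" for j using z(4) that w' by simp
    obtain i where i: "P0 y i \<noteq> y i" using y(2) by auto
    then have i': "s0 + w \<le> i" "i < t0 - w" using gate_fixes[OF P0(2) y(1)] by blast+
    have "P0 z i = P0 y i" by (rule gate_local[OF P0(2) z(1) y(1) zy]) (use i' w_pos in auto)
    then have zi: "P0 z i \<noteq> z i" using i zy[of i] i' w_pos by auto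
    have g: "gate S T P0" by (rule gate_mono[OF P0(2)]) (use w' D_nonneg w_pos in auto)
    obtain p where p: "word_perm S T p" "P0 = lift S T p" using gate_is_lift[OF g] by blast
    have "S \<le> i" "i < T" using i' w' D_nonneg w_pos by auto
    then have "word S T (P0 z) \<noteq> word S T z" using zi unfolding word_eq_iff by blast
    then have "p (word S T z) \<noteq> word S T z" using lift_in(2)[OF p(1) len z(1)] p(2) by simp
    moreover have "margins S T (word S T z) = margins S T u"
      unfolding x(2) margins_word_eq_iff[OF len] using z by simp
    moreover have "p \<in> {p. word_perm S T p \<and> lift S T p \<in> PP}" using p P0(1) by simp
    ultimately show "\<exists>p\<in>{p. word_perm S T p \<and> lift S T p \<in> PP}. \<exists>v\<in>words S T. margins S T v = margins S T u \<and> p v \<noteq> v"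
      using word_in_words[OF z(1)] by blast
  qed
  moreover have "S + 2 * w \<le> T" if ST: "S \<le> - L'" "L' \<le> T" for S T
    using ST D_nonneg w_pos L by (auto simp: L'_def)
  moreover have "0 < L'" using L(1) D_nonneg w_pos by (simp add: L'_def)
  ultimately show ?thesis by blast
qed

lemma square_in_PP: assumes "gate s t P" shows "P \<circ> P \<in> PP"
proof -
  obtain L where L: "L > 0" "\<forall>S T. S \<le> - L \<longrightarrow> L \<le> T \<longrightarrow> S + 2 * w \<le> T \<and>
     class_permutations (words S T) (margins S T) {p. word_perm S T p \<and> lift S T p \<in> PP}"
    using large_window by blast
  define S T where "S = min s (- L)" and "T = max t L"
  have ST: "S + 2 * w \<le> T" and cp: "class_permutations (words S T) (margins S T) {p. word_perm S T p \<and> lift S T p \<in> PP}"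
    using L(2)[rule_format, of S T] by (auto simp: S_def T_def)
  interpret class_permutations "words S T" "margins S T" "{p. word_perm S T p \<and> lift S T p \<in> PP}" by (rule cp)
  have "gate S T P" by (rule gate_mono[OF assms]) (auto simp: S_def T_def)
  then obtain p where p: "word_perm S T p" "P = lift S T p" using gate_is_lift by blast
  then have "p \<in> class_preserving" by (simp add: class_preserving_def word_perm_def)
  from square_in_N[OF this] show ?thesis using p lift_comp[OF p(1) p(1) ST] by simp
qed

lemma pigeonhole_PP:
  fixes P :: "nat \<Rightarrow> (int \<Rightarrow> 'a) \<Rightarrow> (int \<Rightarrow> 'a)"
  assumes "\<And>i. i \<le> class_bound \<Longrightarrow> gate s t (P i)"
  shows "\<exists>i j. i < j \<and> j \<le> class_bound \<and> P j \<circ> inv (P i) \<in> PP"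
proof -
  obtain L where L: "L > 0" "\<forall>S T. S \<le> - L \<longrightarrow> L \<le> T \<longrightarrow> S + 2 * w \<le> T \<and>
     class_permutations (words S T) (margins S T) {p. word_perm S T p \<and> lift S T p \<in> PP}"
    using large_window by blast
  define S T where "S = min s (- L)" and "T = max t L"
  have ST: "S + 2 * w \<le> T" and cp: "class_permutations (words S T) (margins S T) {p. word_perm S T p \<and> lift S T p \<in> PP}"
    using L(2)[rule_format, of S T] by (auto simp: S_def T_def)
  interpret class_permutations "words S T" "margins S T" "{p. word_perm S T p \<and> lift S T p \<in> PP}" by (rule cp)
  have b: "2 ^ card (margins S T ` words S T) \<le> class_bound" by (rule card_margins_bound[OF ST])
  have "\<forall>i. \<exists>p. i \<le> class_bound \<longrightarrow> word_perm S T p \<and> P i = lift S T p"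
  proof
    fix i
    show "\<exists>p. i \<le> class_bound \<longrightarrow> word_perm S T p \<and> P i = lift S T p"
    proof (cases "i \<le> class_bound")
      case True
      have "gate S T (P i)" by (rule gate_mono[OF assms[OF True]]) (auto simp: S_def T_def)
      then show ?thesis using gate_is_lift by blast
    qed simp
  qed
  from choice[OF this] obtain p where p: "\<And>i. i \<le> class_bound \<Longrightarrow> word_perm S T (p i) \<and> P i = lift S T (p i)"
    by blast
  have pK: "p i \<in> class_preserving" if "i \<le> 2 ^ card (margins S T ` words S T)" for i
    using p[of i] that b by (simp add: class_preserving_def word_perm_def)
  have "\<exists>i j. i < j \<and> j \<le> 2 ^ card (margins S T ` words S T) \<and>
      p j \<circ> inv (p i) \<in> {p. word_perm S T p \<and> lift S T p \<in> PP}"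
    by (rule index_bound) (rule pK)
  then obtain i j where ij: "i < j" "j \<le> 2 ^ card (margins S T ` words S T)"
    "p j \<circ> inv (p i) \<in> {p. word_perm S T p \<and> lift S T p \<in> PP}"
    by blast
  have le: "i \<le> class_bound" "j \<le> class_bound" using ij b by auto
  have "lift S T (p j \<circ> inv (p i)) = P j \<circ> inv (P i)"
    using lift_comp[OF _ word_perm_inv ST] inv_lift[OF _ ST] p[OF le(1)] p[OF le(2)] by simp
  then show ?thesis using ij le by auto
qed

end

section \<open>Groups normalised by lattices of gates\<close>

context local_shift
begin

text \<open>
  Used to replace a gate by its product with a translate, which is even in every class once \<open>k\<close> is
  chosen well.
\<close>

lemma lattice_double:
  assumes P: "gate s t P" "t - s \<le> k"
  shows "lattice k P = lattice (k * 2) (P \<circ> translate k P)"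
proof
  fix x
  have k: "w < k" "0 < k" using period_pos[OF P] w_pos by auto
  have g0: "gate s (s + k) P" by (rule gate_mono[OF P(1)]) (use P in auto)
  have g1: "gate s (t + k) P" by (rule gate_mono[OF P(1)]) (use k in auto)
  have g2: "gate s (t + k) (translate k P)" by (rule gate_mono[OF gate_translate[OF P(1)]]) (use k in auto)
  have len: "t + k - s \<le> k * 2" using P by simp
  show "lattice k P x = lattice (k * 2) (P \<circ> translate k P) x"
  proof (cases "x \<in> X")
    case True
    have "lattice (k * 2) (P \<circ> translate k P) x = lattice k P x"
    proof (rule lattice_unique[OF gate_comp[OF g1 g2] len True])
      fix i j assume i: "s \<le> i" "i < s + k * 2"
      define y where "y = shift_by (k * 2 * j) x"
      have y: "y \<in> X" "translate k P y \<in> X" using True g2 by (simp_all add: y_def)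
      show "lattice k P x (i + k * 2 * j) = (P \<circ> translate k P) (shift_by (k * 2 * j) x) i"
      proof (cases "i < s + k")
        case True
        have "lattice k P x (i + k * (2 * j)) = P (shift_by (k * (2 * j)) x) i"
          by (rule lattice_apply[OF P \<open>x \<in> X\<close> i(1) True])
        moreover have "P y i = P (translate k P y) i"
        proof (rule gate_local[OF g0 y _ i(1) True])
          fix m assume "s \<le> m" "m < s + k"
          then show "y m = translate k P y m"
            using gate_fixes[OF gate_translate[OF P(1)] y(1), of k m] w_pos by simp
        qed
        ultimately show ?thesis by (simp add: y_def mult.assoc)
      next
        case False
        have "lattice k P x ((i - k) + k * (2 * j + 1)) = P (shift_by (k * (2 * j + 1)) x) (i - k)"
          by (rule lattice_apply[OF P \<open>x \<in> X\<close>]) (use False i in auto)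
        moreover have "P (translate k P y) i = translate k P y i"
          using gate_fixes[OF g0 y(2), of i] False w_pos by simp
        moreover have "translate k P y i = P (shift_by (k * (2 * j + 1)) x) (i - k)"
          by (simp add: translate_apply y_def algebra_simps)
        moreover have "(i - k) + k * (2 * j + 1) = i + k * 2 * j" by (simp add: algebra_simps)
        ultimately show ?thesis by (simp add: y_def)
      qed
    qed
    then show ?thesis by simp
  qed (simp add: lattice_notin)
qed

end

context mixing_shift
begin

text \<open>
  The conjugate changes only coordinates within distance \<open>r\<close> of the window. To compute these, \<open>g\<close> reads
  up to distance \<open>2 r\<close>, and its inverse up to \<open>3 r\<close>.
\<close>

lemma gate_conj:
  assumes g: "g permutes X" "has_radius X g r" "has_radius X (inv g) r" "0 \<le> r"
    and P: "gate s t P"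
  shows "gate (s - 3 * r) (t + 3 * r) (g \<circ> P \<circ> inv g)"
proof (rule gateI)
  have gX: "g x \<in> X \<longleftrightarrow> x \<in> X" "inv g x \<in> X \<longleftrightarrow> x \<in> X" for x
    using permutes_in_image[OF g(1)] permutes_in_image[OF permutes_inv[OF g(1)]] by auto
  show "s - 3 * r + 2 * w \<le> t + 3 * r" using gate_length[OF P] g(4) by simp
  show "g \<circ> P \<circ> inv g permutes X"
    using g(1) gate_permutes[OF P] permutes_compose permutes_inv by metis
  have fixed: "(g \<circ> P \<circ> inv g) x i = x i" if "x \<in> X" "i < s + w - r \<or> t - w + r \<le> i" for x i
  proof -
    have "g (P (inv g x)) i = g (inv g x) i"
    proof (rule has_radiusD[OF g(2)])
      fix j assume "\<bar>j - i\<bar> \<le> r"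
      then have "\<not> (s + w \<le> j \<and> j < t - w)" using that by linarith
      then show "P (inv g x) j = inv g x j" using gate_fixes[OF P] that gX by blast
    qed (use that gX gate_in[OF P] in auto)
    then show ?thesis using permutes_inverses[OF g(1)] by simp
  qed
  show "(g \<circ> P \<circ> inv g) x i = x i"
    if "x \<in> X" "\<not> (s - 3 * r + w \<le> i \<and> i < t + 3 * r - w)" for x i
    by (rule fixed[OF that(1)]) (use that(2) g(4) in linarith)
  show "(g \<circ> P \<circ> inv g) x i = (g \<circ> P \<circ> inv g) y i"
    if xy: "x \<in> X" "y \<in> X" "\<And>i. s - 3 * r \<le> i \<Longrightarrow> i < t + 3 * r \<Longrightarrow> x i = y i"
      "s - 3 * r \<le> i" "i < t + 3 * r" for x y i
  proof (cases "s - r \<le> i \<and> i < t + r")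
    case False
    then have "i < s + w - r \<or> t - w + r \<le> i" using w_pos by linarith
    then show ?thesis using fixed xy by simp
  next
    case True
    have a: "inv g x j = inv g y j" if j: "s - 2 * r \<le> j" "j < t + 2 * r" for j
      by (rule has_radiusD[OF g(3) xy(1,2)], rule xy(3)) (use j in auto)
    have "P (inv g x) j = P (inv g y) j" if j: "s - 2 * r \<le> j" "j < t + 2 * r" for j
    proof (cases "s \<le> j \<and> j < t")
      case True
      show ?thesis
      proof (rule gate_local[OF P])
        fix i assume "s \<le> i" "i < t"
        then show "inv g x i = inv g y i" using a[of i] g(4) by simp
      qed (use True xy gX in auto)
    next
      case False
      then have "P (inv g x) j = inv g x j" "P (inv g y) j = inv g y j"
        using gate_fixes[OF P, of "inv g x" j] gate_fixes[OF P, of "inv g y" j] gX xy w_pos by auto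
      then show ?thesis using a j by simp
    qed
    note b = this
    have "g (P (inv g x)) i = g (P (inv g y)) i"
      by (rule has_radiusD[OF g(2) _ _ b]) (use True xy gX gate_in[OF P] in auto)
    then show ?thesis by simp
  qed
qed

text \<open>
  Near one position the lattice agrees with a single gate, and \<open>g\<close> cannot see further than \<open>r\<close>.
\<close>

lemma lattice_conj:
  assumes g: "g permutes X" "has_radius X g r" "has_radius X (inv g) r" "0 \<le> r"
    and P: "gate s t P" and k: "t - s + 6 * r \<le> k"
    and comm: "\<And>x j. x \<in> X \<Longrightarrow> g (shift_by (k * j) x) = shift_by (k * j) (g x)"
  shows "lattice k (g \<circ> P \<circ> inv g) = g \<circ> lattice k P \<circ> inv g"
proof
  fix x
  have gX: "g x \<in> X \<longleftrightarrow> x \<in> X" "inv g x \<in> X \<longleftrightarrow> x \<in> X" for x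
    using permutes_in_image[OF g(1)] permutes_in_image[OF permutes_inv[OF g(1)]] by auto
  have k': "t - s \<le> k" using k g(4) by simp
  have k'': "t + 3 * r - (s - 3 * r) \<le> k" using k by simp
  show "lattice k (g \<circ> P \<circ> inv g) x = (g \<circ> lattice k P \<circ> inv g) x"
  proof (cases "x \<in> X")
    case True
    show ?thesis
    proof (rule lattice_unique[OF gate_conj[OF g P] k'' True])
      fix i j assume i: "s - 3 * r \<le> i" "i < s - 3 * r + k"
      define y where "y = shift_by (k * j) (inv g x)"
      have y: "y \<in> X" using True gX by (simp add: y_def)
      have L: "lattice k P (inv g x) \<in> X" using lattice_in[OF P k'] True gX by blast
      have gy: "inv g (shift_by (k * j) x) = y"
      proof -
        have "g y = shift_by (k * j) x"
          unfolding y_def using comm[of "inv g x" j] True gX permutes_inverses[OF g(1)] by simp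
        then show ?thesis using permutes_inverses(2)[OF g(1), of y] by simp
      qed
      have Ly: "shift_by (k * j) (lattice k P (inv g x)) = lattice k P y"
        unfolding y_def using lattice_shift[OF P k'] True gX by simp
      have near: "lattice k P y m = P y m" if m: "t - k \<le> m" "m < s + k" for m
      proof (cases "s \<le> m")
        case True
        then show ?thesis using lattice_apply[OF P k' y, of m 0] m by simp
      next
        case False
        have "lattice k P y ((m + k) + k * (- 1)) = P (shift_by (k * (- 1)) y) (m + k)"
          by (rule lattice_apply[OF P k' y]) (use False m gate_length[OF P] w_pos in auto)
        also have "\<dots> = shift_by (k * (- 1)) y (m + k)"
          by (rule gate_fixes[OF P]) (use m y w_pos in auto)
        also have "\<dots> = P y m" using gate_fixes[OF P y, of m] False w_pos by simp
        finally show ?thesis by simp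
      qed
      have "(g \<circ> lattice k P \<circ> inv g) x (i + k * j) = shift_by (k * j) (g (lattice k P (inv g x))) i" by simp
      also have "\<dots> = g (lattice k P y) i" using comm[OF L] Ly by metis
      also have "\<dots> = g (P y) i"
      proof (rule has_radiusD[OF g(2)])
        fix m assume "\<bar>m - i\<bar> \<le> r"
        then show "lattice k P y m = P y m" by (intro near) (use i k g(4) in auto)
      qed (use y lattice_in[OF P k' y] gate_in[OF P] in auto)
      also have "\<dots> = (g \<circ> P \<circ> inv g) (shift_by (k * j) x) i" using gy by simp
      finally show "(g \<circ> lattice k P \<circ> inv g) x (i + k * j) = (g \<circ> P \<circ> inv g) (shift_by (k * j) x) i" .
    qed
  next
    case False
    then have "inv g x = x" using permutes_not_in[OF permutes_inv[OF g(1)]] by blast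
    then show ?thesis using False permutes_not_in[OF g(1)] by (simp add: lattice_notin)
  qed
qed

text \<open>
  If \<open>g y \<noteq> y\<close>, a gate can exchange the central word of \<open>y\<close> with a third word and leave \<open>g y\<close> alone.
  It moves \<open>y\<close> but not \<open>g y\<close>, which is impossible for a map that commutes with \<open>g\<close>.
\<close>

lemma gate_not_commuting:
  assumes g: "g permutes X" "g \<noteq> id"
  shows "\<exists>s t P. gate s t P \<and> g \<circ> P \<noteq> P \<circ> g"
proof -
  obtain y where y: "y \<in> X" "g y \<noteq> y"
    using g permutes_not_in[OF g(1)] by (metis eq_id_iff ext)
  have gy: "g y \<in> X" using y permutes_in_image[OF g(1)] by blast
  obtain i where i: "g y i \<noteq> y i" using y(2) by auto
  obtain L where L: "L > 0" "\<forall>S T. S \<le> - L \<longrightarrow> L \<le> T \<longrightarrow> S + 2 * w \<le> T \<and>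
     (\<forall>u\<in>words S T. 5 \<le> card {v \<in> words S T. margins S T v = margins S T u})" using five_words by blast
  define S T where "S = - L - \<bar>i\<bar>" and "T = L + \<bar>i\<bar>"
  have len: "S + 2 * w \<le> T" and five: "\<And>u. u \<in> words S T \<Longrightarrow> 5 \<le> card {v \<in> words S T. margins S T v = margins S T u}"
    using L(2)[rule_format, of S T] by (auto simp: S_def T_def)
  define u where "u = word S T y"
  have u: "u \<in> words S T" using y word_in_words by (simp add: u_def)
  have ug: "word S T (g y) \<noteq> u"
  proof -
    have "S \<le> i" "i < T" using L(1) by (auto simp: S_def T_def)
    then show ?thesis using i unfolding u_def word_eq_iff by blast
  qed
  have "\<not> {v \<in> words S T. margins S T v = margins S T u} \<subseteq> {u, word S T (g y)}"
  proof
    assume "{v \<in> words S T. margins S T v = margins S T u} \<subseteq> {u, word S T (g y)}"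
    then have "card {v \<in> words S T. margins S T v = margins S T u} \<le> card {u, word S T (g y)}"
      by (intro card_mono) auto
    also have "\<dots> \<le> 2" by (simp add: card_insert_if)
    finally show False using five[OF u] by simp
  qed
  then obtain v where v: "v \<in> words S T" "margins S T v = margins S T u" "v \<noteq> u" "v \<noteq> word S T (g y)" by auto
  have wp: "word_perm S T (swap u v)" using u v by (intro word_perm_swap) auto
  define P where "P = lift S T (swap u v)"
  have P: "gate S T P" unfolding P_def by (rule gate_lift[OF wp len])
  have "word S T (P y) = v"
    using lift_in(2)[OF wp len y(1)] by (simp add: P_def u_def)
  then have "P y \<noteq> y" using v(3) by (auto simp: u_def)
  moreover have "P (g y) = g y"
  proof -
    have "swap u v (word S T (g y)) = word S T (g y)" using ug v by (simp add: transpose_apply_other)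
    then show ?thesis unfolding P_def lift_def using gy by (simp add: overwrite_word) (simp add: overwrite_def)
  qed
  ultimately have "(g \<circ> P) y \<noteq> (P \<circ> g) y" using permutes_inj[OF g(1)] by (auto dest: injD)
  then show ?thesis using P by metis
qed

text \<open>
  The set \<open>PP\<close> asks for all translates by multiples of \<open>n\<close> with one threshold \<open>K\<close>. The group \<open>N\<close> need not
  be normalised by the shift, but \<open>g\<close> commutes with \<open>\<sigma>\<^sup>n\<close>, so that these translates come for free; they
  are needed because splitting a lattice produces more translates as it becomes sparser.
\<close>

theorem contains_lattices:
  assumes N_id: "id \<in> N" and N_comp: "\<And>f h. f \<in> N \<Longrightarrow> h \<in> N \<Longrightarrow> f \<circ> h \<in> N"
    and N_inv: "\<And>f. f \<in> N \<Longrightarrow> inv f \<in> N"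
    and N_norm: "\<And>f s t P k. f \<in> N \<Longrightarrow> gate s t P \<Longrightarrow> t - s \<le> k \<Longrightarrow>
        lattice k P \<circ> f \<circ> inv (lattice k P) \<in> N"
    and g: "g \<in> N" "g \<noteq> id" "g permutes X" "has_radius X g r" "has_radius X (inv g) r" "0 \<le> r"
    and n: "0 < n" "\<And>x j. x \<in> X \<Longrightarrow> g (shift_by (n * j) x) = shift_by (n * j) (g x)"
    and gate: "gate s t P" "t - s \<le> k"
  shows "lattice k P \<in> N"
proof -
  define good where "good P K \<longleftrightarrow> (\<forall>k\<ge>K. n dvd k \<longrightarrow> (\<forall>i. lattice k (translate (n * i) P) \<in> N))" for P K
  define PP where "PP = {P. (\<exists>s t. gate s t P) \<and> (\<exists>K. good P K)}"
  have PP_I: "P \<in> PP" if "gate s t P" "\<And>k i. K \<le> k \<Longrightarrow> n dvd k \<Longrightarrow> lattice k (translate (n * i) P) \<in> N" for P s t K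
    using that unfolding PP_def good_def by blast
  have PP_E: "\<exists>s t K. gate s t P \<and> t - s \<le> K \<and> good P K" if "P \<in> PP" for P
  proof -
    from that obtain s t K where stK: "gate s t P" "good P K" unfolding PP_def by blast
    have "good P (max K (t - s))" using stK(2) unfolding good_def by simp
    then show ?thesis using stK(1) by (intro exI[of _ s] exI[of _ t] exI[of _ "max K (t - s)"]) simp
  qed
  have goodD: "lattice k (translate (n * i) P) \<in> N" if "good P K" "K \<le> k" "n dvd k" for P K k i
    using that unfolding good_def by blast
  obtain \<alpha> s\<^sub>\<alpha> t\<^sub>\<alpha> where \<alpha>: "gate s\<^sub>\<alpha> t\<^sub>\<alpha> \<alpha>" "g \<circ> \<alpha> \<noteq> \<alpha> \<circ> g"
    using gate_not_commuting[OF g(3,2)] by blast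
  define P0 where "P0 = (g \<circ> \<alpha> \<circ> inv g) \<circ> inv \<alpha>"
  have gate_a: "gate (s\<^sub>\<alpha> - 3 * r) (t\<^sub>\<alpha> + 3 * r) \<alpha>"
    by (rule gate_mono[OF \<alpha>(1)]) (use g(6) in auto)
  have gate_P0: "gate (s\<^sub>\<alpha> - 3 * r) (t\<^sub>\<alpha> + 3 * r) P0"
    unfolding P0_def by (rule gate_comp[OF gate_conj[OF g(3-6) \<alpha>(1)] gate_inv[OF gate_a]])
  have P0_ne: "P0 \<noteq> id"
  proof
    assume "P0 = id"
    then have "P0 \<circ> \<alpha> \<circ> g = \<alpha> \<circ> g" by simp
    moreover have "P0 \<circ> \<alpha> \<circ> g = g \<circ> \<alpha>"
      using permutes_inverses[OF g(3)] permutes_inverses[OF gate_permutes[OF \<alpha>(1)]]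
      unfolding P0_def by (intro ext) simp
    ultimately show False using \<alpha>(2) by simp
  qed
  have P0_PP: "P0 \<in> PP"
  proof (rule PP_I[OF gate_P0, of "t\<^sub>\<alpha> - s\<^sub>\<alpha> + 6 * r"])
    fix k i assume k: "t\<^sub>\<alpha> - s\<^sub>\<alpha> + 6 * r \<le> k" "n dvd k"
    define \<beta> where "\<beta> = translate (n * i) \<alpha>"
    have gb: "gate (s\<^sub>\<alpha> + n * i) (t\<^sub>\<alpha> + n * i) \<beta>" unfolding \<beta>_def by (rule gate_translate[OF \<alpha>(1)])
    have lenb: "t\<^sub>\<alpha> + n * i - (s\<^sub>\<alpha> + n * i) \<le> k" using k g(6) by simp
    have gb': "gate (s\<^sub>\<alpha> + n * i - 3 * r) (t\<^sub>\<alpha> + n * i + 3 * r) \<beta>"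
      by (rule gate_mono[OF gb]) (use g(6) in auto)
    have lenb': "t\<^sub>\<alpha> + n * i + 3 * r - (s\<^sub>\<alpha> + n * i - 3 * r) \<le> k" using k by simp
    have trg: "translate (n * i) g = g" by (rule translate_eq_if_commutes[OF g(3) n(2)])
    have "translate (n * i) P0 = (translate (n * i) g \<circ> \<beta> \<circ> translate (n * i) (inv g)) \<circ> translate (n * i) (inv \<alpha>)"
      by (simp add: P0_def \<beta>_def translate_comp)
    also have "\<dots> = (g \<circ> \<beta> \<circ> inv g) \<circ> inv \<beta>"
      using translate_inv[OF g(3), of "n * i"] translate_inv[OF gate_permutes[OF \<alpha>(1)], of "n * i"] trg
      by (simp add: \<beta>_def)
    finally have "lattice k (translate (n * i) P0) = lattice k (g \<circ> \<beta> \<circ> inv g) \<circ> lattice k (inv \<beta>)"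
      using lattice_comp[OF gate_conj[OF g(3-6) gb] gate_inv[OF gb'] lenb'] by simp
    also have "lattice k (g \<circ> \<beta> \<circ> inv g) = g \<circ> lattice k \<beta> \<circ> inv g"
    proof (rule lattice_conj[OF g(3-6) gb])
      show "t\<^sub>\<alpha> + n * i - (s\<^sub>\<alpha> + n * i) + 6 * r \<le> k" using k by simp
      fix x j assume "x \<in> X"
      obtain m where "k = n * m" using k(2) by auto
      then have "k * j = n * (m * j)" by simp
      then show "g (shift_by (k * j) x) = shift_by (k * j) (g x)" using n(2)[OF \<open>x \<in> X\<close>] by metis
    qed
    also have "lattice k (inv \<beta>) = inv (lattice k \<beta>)" using inv_lattice[OF gb lenb] by simp
    also have "(g \<circ> lattice k \<beta> \<circ> inv g) \<circ> inv (lattice k \<beta>) = g \<circ> (lattice k \<beta> \<circ> inv g \<circ> inv (lattice k \<beta>))"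
      by (simp add: comp_assoc)
    finally show "lattice k (translate (n * i) P0) \<in> N"
      using N_comp[OF g(1) N_norm[OF N_inv[OF g(1)] gb lenb]] by simp
  qed
  have PP_comp: "P \<circ> Q \<in> PP" if PQ: "P \<in> PP" "Q \<in> PP" for P Q
  proof -
    obtain s t K where P: "gate s t P" "t - s \<le> K" "good P K" using PP_E[OF PQ(1)] by blast
    obtain s' t' K' where Q: "gate s' t' Q" "t' - s' \<le> K'" "good Q K'" using PP_E[OF PQ(2)] by blast
    define a b where "a = min s s'" and "b = max t t'"
    have gP: "gate a b P" by (rule gate_mono[OF P(1)]) (auto simp: a_def b_def)
    have gQ: "gate a b Q" by (rule gate_mono[OF Q(1)]) (auto simp: a_def b_def)
    show ?thesis
    proof (rule PP_I[OF gate_comp[OF gP gQ], of "max (b - a) (max K K')"])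
      fix k i assume k: "max (b - a) (max K K') \<le> k" "n dvd k"
      have "lattice k (translate (n * i) (P \<circ> Q)) = lattice k (translate (n * i) P) \<circ> lattice k (translate (n * i) Q)"
        unfolding translate_comp by (rule lattice_comp[OF gate_translate[OF gP] gate_translate[OF gQ]]) (use k in simp)
      then show "lattice k (translate (n * i) (P \<circ> Q)) \<in> N"
        using N_comp goodD[OF P(3) _ k(2)] goodD[OF Q(3) _ k(2)] k(1) by simp
    qed
  qed
  have PP_inv: "inv P \<in> PP" if PPP: "P \<in> PP" for P
  proof -
    obtain s t K where P: "gate s t P" "t - s \<le> K" "good P K" using PP_E[OF PPP] by blast
    show ?thesis
    proof (rule PP_I[OF gate_inv[OF P(1)], of K])
      fix k i assume k: "K \<le> k" "n dvd k"
      have "lattice k (translate (n * i) (inv P)) = inv (lattice k (translate (n * i) P))"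
        using inv_lattice[OF gate_translate[OF P(1)], of "n * i" k] translate_inv[OF gate_permutes[OF P(1)]] P(2) k by simp
      then show "lattice k (translate (n * i) (inv P)) \<in> N"
        using N_inv goodD[OF P(3) k] by simp
    qed
  qed
  have PP_id: "id \<in> PP"
  proof (rule PP_I[of 0 "2 * w"])
    show "gate 0 (2 * w) id" by (rule gate_id) simp
    fix k i
    have "translate (n * i) id = id" by (simp add: translate_def fun_eq_iff)
    then show "lattice k (translate (n * i) id) \<in> N" using lattice_id N_id by simp
  qed
  have PP_conj: "Q \<circ> P \<circ> inv Q \<in> PP" if PPP: "P \<in> PP" and Q: "gate s' t' Q" for P Q s' t'
  proof -
    obtain s t K where P: "gate s t P" "t - s \<le> K" "good P K" using PP_E[OF PPP] by blast
    define a b where "a = min s s'" and "b = max t t'"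
    have gP: "gate a b P" by (rule gate_mono[OF P(1)]) (auto simp: a_def b_def)
    have gQ: "gate a b Q" by (rule gate_mono[OF Q(1)]) (auto simp: a_def b_def)
    show ?thesis
    proof (rule PP_I[OF gate_comp[OF gate_comp[OF gQ gP] gate_inv[OF gQ]], of "max (b - a) K"])
      fix k i assume k: "max (b - a) K \<le> k" "n dvd k"
      note tP = gate_translate[OF gP, of "n * i"] and tQ = gate_translate[OF gQ, of "n * i"]
      have len: "b + n * i - (a + n * i) \<le> k" using k by simp
      have "lattice k (translate (n * i) (Q \<circ> P \<circ> inv Q))
         = lattice k (translate (n * i) Q) \<circ> lattice k (translate (n * i) P) \<circ> inv (lattice k (translate (n * i) Q))"
        unfolding translate_comp translate_inv[OF gate_permutes[OF gQ], symmetric]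
        using lattice_comp[OF gate_comp[OF tQ tP] gate_inv[OF tQ] len] lattice_comp[OF tQ tP len]
          inv_lattice[OF tQ len] by simp
      then show "lattice k (translate (n * i) (Q \<circ> P \<circ> inv Q)) \<in> N"
        using N_norm[OF goodD[OF P(3) _ k(2)] tQ len] k(1) by simp
    qed
  qed
  interpret normal_gates X w A D PP "s\<^sub>\<alpha> - 3 * r" "t\<^sub>\<alpha> + 3 * r" P0
    by unfold_locales (fact PP_comp PP_inv PP_id PP_conj P0_PP gate_P0 P0_ne)+
  have PP_translate: "translate (n * c) P \<in> PP" if PPP: "P \<in> PP" for P c
  proof -
    obtain s t K where P: "gate s t P" "good P K" using PP_E[OF PPP] by blast
    show ?thesis
    proof (rule PP_I[OF gate_translate[OF P(1)], of K])
      fix k i assume k: "K \<le> k" "n dvd k"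
      have "translate (n * i) (translate (n * c) P) = translate (n * (i + c)) P" by (simp add: translate_translateanslate distrib_left)
      then show "lattice k (translate (n * i) (translate (n * c) P)) \<in> N" using goodD[OF P(2) k] by simp
    qed
  qed
  (* a multiple of every difference that the pigeonhole principle can produce *)
  define B where "B = int (fact class_bound)"
  have B: "0 < B" by (simp add: B_def)
  (* Among the translates by n * i for i up to class_bound, two agree modulo PP, hence so do P and
     its translate by n * d for some d from 1 to class_bound; such a d divides B, and telescoping
     gives all multiples of it. *)
  have translate_cong: "translate (n * (B * c)) P \<circ> inv P \<in> PP" if P: "gate s t P" and c: "0 \<le> c" for P s t c
  proof -
    have perm: "P permutes X" using gate_permutes[OF P] .
    have trg: "gate (s - n * int class_bound) (t + n * int class_bound) (translate (n * int i) P)"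
      if "i \<le> class_bound" for i
    proof (rule gate_mono[OF gate_translate[OF P]])
      have "0 \<le> n * int i" "n * int i \<le> n * int class_bound" using n that by (auto intro: mult_left_mono)
      then show "s - n * int class_bound \<le> s + n * int i" "t + n * int i \<le> t + n * int class_bound"
        by linarith+
    qed
    have "\<exists>i j. i < j \<and> j \<le> class_bound \<and> translate (n * int j) P \<circ> inv (translate (n * int i) P) \<in> PP"
      by (rule pigeonhole_PP) (rule trg)
    then obtain i j where ij: "i < j" "j \<le> class_bound"
      "translate (n * int j) P \<circ> inv (translate (n * int i) P) \<in> PP" by (elim exE conjE)
    define d where "d = int j - int i"
    have d: "0 < d" "d \<le> int class_bound" using ij(1,2) by (simp_all add: d_def)
    have "translate (n * (- int i)) (translate (n * int j) P \<circ> inv (translate (n * int i) P)) \<in> PP" by (rule PP_translate[OF ij(3)])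
    also have "translate (n * (- int i)) (translate (n * int j) P \<circ> inv (translate (n * int i) P)) = translate (n * d) P \<circ> inv P"
    proof -
      have e: "n * (- int i) + n * int j = n * d" "n * (- int i) + n * int i = 0"
        by (simp_all add: d_def right_diff_distrib)
      show ?thesis by (simp only: translate_comp translate_inv[OF perm] translate_translateanslate e translate_0)
    qed
    finally have base: "translate (n * d) P \<circ> inv P \<in> PP" .
    have mult: "translate (n * (d * int m)) P \<circ> inv P \<in> PP" for m
    proof (induction m)
      case 0
      have "translate (n * (d * int 0)) P \<circ> inv P = id"
        using permutes_inv_o[OF perm] by (simp only: of_nat_0 mult_zero_right translate_0)
      then show ?case using PP_id by (simp only:)
    next
      case (Suc m)
      have "translate (n * (d * int m)) (translate (n * d) P \<circ> inv P) \<circ> (translate (n * (d * int m)) P \<circ> inv P) \<in> PP"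
        by (rule PP_comp[OF PP_translate[OF base] Suc])
      also have "translate (n * (d * int m)) (translate (n * d) P \<circ> inv P) \<circ> (translate (n * (d * int m)) P \<circ> inv P)
          = translate (n * (d * int (Suc m))) P \<circ> inv P"
      proof -
        have "n * (d * int m) + n * d = n * (d * int (Suc m))" by (simp add: algebra_simps)
        then have "translate (n * (d * int m)) (translate (n * d) P) = translate (n * (d * int (Suc m))) P"
          by (simp only: translate_translateanslate)
        moreover have "translate (n * (d * int m)) (inv P) \<circ> translate (n * (d * int m)) P = id"
          unfolding translate_def by (intro ext) (simp add: permutes_inverses[OF perm])
        moreover have "(a \<circ> b) \<circ> (c \<circ> e) = a \<circ> ((b \<circ> c) \<circ> e)" for a b c e :: "(int \<Rightarrow> 'a) \<Rightarrow> (int \<Rightarrow> 'a)"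
          by (simp only: comp_assoc)
        ultimately show ?thesis by (simp only: translate_comp id_comp)
      qed
      finally show ?case .
    qed
    have "nat d dvd fact class_bound" using d by (intro dvd_fact) auto
    then obtain e where e: "fact class_bound = nat d * e" by blast
    have "B = d * int e" using e d by (simp add: B_def)
    then have "B * c = d * int (e * nat c)" using c by simp
    then show ?thesis using mult[of "e * nat c"] by simp
  qed
  (* Such a lattice of P is the lattice of R with twice the period, and that is a product of lattices
     of translates of R that are sparse enough to lie in N. *)
  have divisible: "lattice k P \<in> N" if P: "gate s t P" "t - s \<le> k" and k: "n * B dvd k" for k P s t
  proof -
    have kpos: "0 < k" using period_pos[OF P] w_pos by simp
    from k obtain c where "k = n * B * c" by (rule dvdE)
    then have c: "k = n * (B * c)" by (simp only: mult.assoc)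
    have c0: "0 \<le> c"
    proof (rule ccontr)
      assume "\<not> 0 \<le> c"
      then have "B * c \<le> 0" using B by (simp add: mult_nonneg_nonpos)
      then have "n * (B * c) \<le> 0" using n(1) by (simp add: mult_nonneg_nonpos)
      then show False using kpos c by linarith
    qed
    (* modulo PP both factors agree and have order two, so R lies in PP *)
    define R where "R = P \<circ> translate k P"
    have kn: "n dvd k" using c by simp
    have g1: "gate s (t + k) P" by (rule gate_mono[OF P(1)]) (use kpos in auto)
    have g2: "gate s (t + k) (translate k P)" by (rule gate_mono[OF gate_translate[OF P(1)]]) (use kpos in auto)
    have gR: "gate s (t + k) R" unfolding R_def by (rule gate_comp[OF g1 g2])
    have lenR: "t + k - s \<le> k * 2" using P by simp
    have "inv P \<circ> translate k P \<in> PP"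
    proof -
      have "inv P \<circ> (translate k P \<circ> inv P) \<circ> inv (inv P) \<in> PP"
        using PP_conj[OF translate_cong[OF P(1) c0] gate_inv[OF P(1)]] c by simp
      then show ?thesis
        using permutes_inv_inv[OF gate_permutes[OF P(1)]] permutes_inv_o[OF gate_permutes[OF P(1)]]
        by (simp add: comp_assoc)
    qed
    from PP_comp[OF square_in_PP[OF P(1)] this] have "R \<in> PP"
      using permutes_inverses[OF gate_permutes[OF P(1)]] by (simp add: R_def comp_def)
    then obtain K where K: "good R K" using PP_E by blast
    (* sparse enough for the threshold of R *)
    define M where "M = nat \<bar>K\<bar> + 1"
    have "K \<le> k * 2 * int M"
    proof -
      have "int M * 1 \<le> int M * (k * 2)" using kpos by (intro mult_left_mono) auto
      then show ?thesis by (simp add: M_def mult.commute)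
    qed
    have "lattice (k * 2) R \<in> N"
    proof (rule lattice_split[OF gR lenR, of M])
      show "0 < M" by (simp add: M_def)
      fix q
      have "k * 2 * q = n * (B * (c * (2 * q)))" by (simp only: c mult.assoc)
      then show "lattice (k * 2 * int M) (translate (k * 2 * q) R) \<in> N"
        using goodD[OF K \<open>K \<le> k * 2 * int M\<close>] kn by (simp only: dvd_mult2)
    qed (use N_id N_comp in auto)
    then show ?thesis using lattice_double[OF P] by (simp add: R_def)
  qed
  define m where "m = nat (n * B)"
  have m: "int m = n * B" "0 < m" using n(1) B by (auto simp: m_def)
  show ?thesis
  proof (rule lattice_split[OF gate m(2) N_id N_comp])
    fix q
    have kpos: "0 < k" using period_pos[OF gate] w_pos by simp
    have "k * 1 \<le> k * int m" using kpos m by (intro mult_left_mono) auto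
    then show "lattice (k * int m) (translate (k * q) P) \<in> N"
      using gate(2) m by (intro divisible[OF gate_translate[OF gate(1)]]) auto
  qed
qed

end

section \<open>Cuttable automorphisms are products of two lattices\<close>

text \<open>
  A half map of \<open>f\<close> exists. No graph and no conjugacy occurs here, so that, unlike inertness, this
  is visibly preserved by products, inverses and conjugation.
\<close>

definition cuttable :: "(int \<Rightarrow> 'a) set \<Rightarrow> ((int \<Rightarrow> 'a) \<Rightarrow> (int \<Rightarrow> 'a)) \<Rightarrow> bool" where
  "cuttable X f \<longleftrightarrow> (\<exists>g C. g permutes X \<and> (\<exists>q. has_radius X g q) \<and> (\<exists>q. has_radius X (inv g) q) \<and>
     (\<forall>x\<in>X. (\<forall>i\<le>- C. g x i = f x i) \<and> (\<forall>i\<ge>C. g x i = x i)))"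

context local_shift
begin

lemma translate_radius: assumes "has_radius X P r" shows "has_radius X (translate c P) r"
  unfolding has_radius_def
proof (intro ballI allI impI)
  fix x y i assume xy: "x \<in> X" "y \<in> X" "\<forall>j. \<bar>j - i\<bar> \<le> r \<longrightarrow> x j = y j"
  show "translate c P x i = translate c P y i"
    unfolding translate_apply by (rule has_radiusD[OF assms]) (use xy in auto)
qed

lemma lattice_radius_gate:
  assumes "gate s t P" "t - s \<le> k" "has_radius X P r"
  shows "has_radius X (lattice k P) r"
  unfolding has_radius_def
proof (intro ballI allI impI)
  fix x y n assume xy: "x \<in> X" "y \<in> X" "\<forall>j. \<bar>j - n\<bar> \<le> r \<longrightarrow> x j = y j"
  have k: "0 < k" using period_pos[OF assms(1,2)] w_pos by auto
  then obtain i j where ij: "n = i + k * j" "s \<le> i" "i < s + k" using block_position[of k n s] by auto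
  have "P (shift_by (k * j) x) i = P (shift_by (k * j) y) i"
    by (rule has_radiusD[OF assms(3)]) (use xy ij in auto)
  then show "lattice k P x n = lattice k P y n"
    using lattice_apply[OF assms(1,2)] xy ij by simp
qed

lemma fixed_by_inv:
  assumes "F permutes X" "\<And>x. x \<in> X \<Longrightarrow> F x i = x i" "x \<in> X"
  shows "inv F x i = x i"
proof -
  have "inv F x \<in> X" using permutes_in_image[OF permutes_inv[OF assms(1)]] assms(3) by blast
  from assms(2)[OF this] show ?thesis using permutes_inverses(1)[OF assms(1)] by simp
qed

text \<open>
  The fixed windows are wider than the radius, so the image of a period is determined by the period
  itself, and restricting the automorphism to one period gives a gate.
\<close>

lemma lattice_if_fixes_windows:
  assumes F: "F permutes X" "has_radius X F \<rho>" "has_radius X (inv F) \<rho>" "0 \<le> \<rho>"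
    and comm: "\<And>x j. x \<in> X \<Longrightarrow> F (shift_by (k * j) x) = shift_by (k * j) (F x)"
    and fixed: "\<And>x i. x \<in> X \<Longrightarrow> e - (\<rho> + w) \<le> i \<and> i < e + (\<rho> + w) \<or>
        e + k - (\<rho> + w) \<le> i \<and> i < e + k + (\<rho> + w) \<Longrightarrow> F x i = x i"
    and k: "2 * (\<rho> + w) \<le> k"
  shows "\<exists>Q. gate e (e + k) Q \<and> F = lattice k Q"
proof -
  define blk where "blk G x = (if x \<in> X then overwrite e (e + k) x (G x) else x)" for G x
  have FX: "F x \<in> X \<longleftrightarrow> x \<in> X" "inv F x \<in> X \<longleftrightarrow> x \<in> X" for x
    using permutes_in_image[OF F(1)] permutes_in_image[OF permutes_inv[OF F(1)]] by auto
  have key: "blk G x \<in> X \<and> (\<forall>i. \<not> (e + w \<le> i \<and> i < e + k - w) \<longrightarrow> blk G x i = x i) \<and>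
     (\<forall>y\<in>X. (\<forall>i. e \<le> i \<longrightarrow> i < e + k \<longrightarrow> x i = y i) \<longrightarrow> (\<forall>i. e \<le> i \<longrightarrow> i < e + k \<longrightarrow> G x i = G y i))"
    if G: "\<And>x. x \<in> X \<Longrightarrow> G x \<in> X" "has_radius X G \<rho>"
      "\<And>x i. x \<in> X \<Longrightarrow> e - (\<rho> + w) \<le> i \<and> i < e + (\<rho> + w) \<or>
        e + k - (\<rho> + w) \<le> i \<and> i < e + k + (\<rho> + w) \<Longrightarrow> G x i = x i" and x: "x \<in> X" for G x
  proof (intro conjI allI impI ballI)
    show "blk G x \<in> X"
    proof -
      have "overwrite e (e + k) x (G x) \<in> X"
      proof (rule overwrite_in[OF x G(1)[OF x]])
        show "e + w \<le> e + k" using k F(4) w_pos by auto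
        fix j
        show "x j = G x j" if "e \<le> j" "j < e + w"
          by (rule G(3)[OF x, symmetric]) (use that F(4) w_pos in linarith)
        show "x j = G x j" if "e + k - w \<le> j" "j < e + k"
          by (rule G(3)[OF x, symmetric]) (use that F(4) w_pos in linarith)
      qed
      then show ?thesis using x by (simp add: blk_def)
    qed
  next
    fix i assume i: "\<not> (e + w \<le> i \<and> i < e + k - w)"
    show "blk G x i = x i"
    proof (cases "e \<le> i \<and> i < e + k")
      case True
      then have "G x i = x i" by (intro G(3)[OF x]) (use i F(4) w_pos in linarith)
      then show ?thesis using x by (simp add: blk_def overwrite_def)
    next
      case False
      then show ?thesis using x by (auto simp: blk_def overwrite_def)
    qed
  next
    fix y i assume y: "y \<in> X" "\<forall>i. e \<le> i \<longrightarrow> i < e + k \<longrightarrow> x i = y i" and i: "e \<le> i" "i < e + k"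
    show "G x i = G y i"
    proof (cases "e + \<rho> \<le> i \<and> i < e + k - \<rho>")
      case True
      show ?thesis by (rule has_radiusD[OF G(2) x y(1)], rule y(2)[rule_format]) (use True in auto)
    next
      case False
      then have "e - (\<rho> + w) \<le> i \<and> i < e + (\<rho> + w) \<or> e + k - (\<rho> + w) \<le> i \<and> i < e + k + (\<rho> + w)"
        using i F(4) w_pos by linarith
      then have "G x i = x i" "G y i = y i" using G(3) x y(1) by blast+
      then show ?thesis using y(2) i by simp
    qed
  qed
  have fixed': "inv F x i = x i" if "x \<in> X" "e - (\<rho> + w) \<le> i \<and> i < e + (\<rho> + w) \<or>
        e + k - (\<rho> + w) \<le> i \<and> i < e + k + (\<rho> + w)" for x i
    by (rule fixed_by_inv[OF F(1) _ that(1)]) (use fixed that(2) in blast)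
  have kF: "blk F x \<in> X \<and> (\<forall>i. \<not> (e + w \<le> i \<and> i < e + k - w) \<longrightarrow> blk F x i = x i) \<and>
     (\<forall>y\<in>X. (\<forall>i. e \<le> i \<longrightarrow> i < e + k \<longrightarrow> x i = y i) \<longrightarrow> (\<forall>i. e \<le> i \<longrightarrow> i < e + k \<longrightarrow> F x i = F y i))"
    if "x \<in> X" for x
    by (rule key[OF _ F(2) fixed that]) (use FX in auto)
  have kF': "blk (inv F) x \<in> X \<and> (\<forall>i. \<not> (e + w \<le> i \<and> i < e + k - w) \<longrightarrow> blk (inv F) x i = x i) \<and>
     (\<forall>y\<in>X. (\<forall>i. e \<le> i \<longrightarrow> i < e + k \<longrightarrow> x i = y i) \<longrightarrow> (\<forall>i. e \<le> i \<longrightarrow> i < e + k \<longrightarrow> inv F x i = inv F y i))"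
    if "x \<in> X" for x
    by (rule key[OF _ F(3) fixed' that]) (use FX in auto)
  have blk_in: "blk F x i = F x i" "blk (inv F) x i = inv F x i"
    if "x \<in> X" "e \<le> i" "i < e + k" for x i using that by (simp_all add: blk_def overwrite_def)
  have blk_out: "blk G x i = x i" if "\<not> (e \<le> i \<and> i < e + k)" for G x i
    using that by (auto simp: blk_def overwrite_def)
  have inv1: "blk F (blk (inv F) x) = x" for x
  proof (cases "x \<in> X")
    case True
    let ?y = "blk (inv F) x"
    have y: "?y \<in> X" using kF'[OF True] by blast
    have iX: "inv F x \<in> X" using FX True by blast
    have "blk F ?y i = x i" for i
    proof (cases "e \<le> i \<and> i < e + k")
      case True
      have "\<forall>i. e \<le> i \<longrightarrow> i < e + k \<longrightarrow> inv F x i = ?y i" using blk_in(2)[OF \<open>x \<in> X\<close>] by simp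
      then have "F (inv F x) i = F ?y i" using kF[OF iX] y True by blast
      then show ?thesis using blk_in(1)[OF y] True permutes_inverses[OF F(1)] by simp
    next
      case False
      then show ?thesis using blk_out by simp
    qed
    then show ?thesis by blast
  qed (simp add: blk_def)
  have inv2: "blk (inv F) (blk F x) = x" for x
  proof (cases "x \<in> X")
    case True
    let ?y = "blk F x"
    have y: "?y \<in> X" using kF[OF True] by blast
    have iX: "F x \<in> X" using FX True by blast
    have "blk (inv F) ?y i = x i" for i
    proof (cases "e \<le> i \<and> i < e + k")
      case True
      have "\<forall>i. e \<le> i \<longrightarrow> i < e + k \<longrightarrow> F x i = ?y i" using blk_in(1)[OF \<open>x \<in> X\<close>] by simp
      then have "inv F (F x) i = inv F ?y i" using kF'[OF iX] y True by blast
      then show ?thesis using blk_in(2)[OF y] True permutes_inverses[OF F(1)] by simp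
    next
      case False
      then show ?thesis using blk_out by simp
    qed
    then show ?thesis by blast
  qed (simp add: blk_def)
  have g: "gate e (e + k) (blk F)"
  proof (rule gateI)
    show "e + 2 * w \<le> e + k" using k F(4) by simp
    have "bij (blk F)" by (rule o_bij[of "blk (inv F)"]) (auto simp: inv1 inv2)
    then show "blk F permutes X" by (auto simp: permutes_def bij_iff blk_def)
    show "blk F x i = x i" if "x \<in> X" "\<not> (e + w \<le> i \<and> i < e + k - w)" for x i
      using kF[OF that(1)] that(2) by blast
    show "blk F x i = blk F y i"
      if "x \<in> X" "y \<in> X" "\<And>i. e \<le> i \<Longrightarrow> i < e + k \<Longrightarrow> x i = y i" "e \<le> i" "i < e + k" for x y i
    proof -
      have "F x i = F y i" using kF[OF that(1)] that by blast
      then show ?thesis using blk_in(1) that by simp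
    qed
  qed
  have "lattice k (blk F) x = F x" for x
  proof (cases "x \<in> X")
    case True
    show ?thesis
    proof (rule lattice_unique[OF g _ True])
      fix i j assume i: "e \<le> i" "i < e + k"
      have "F x (i + k * j) = F (shift_by (k * j) x) i" using comm[OF True] by simp
      also have "\<dots> = blk F (shift_by (k * j) x) i" using blk_in(1)[OF _ i] True by simp
      finally show "F x (i + k * j) = blk F (shift_by (k * j) x) i" .
    qed simp
  next
    case False
    then show ?thesis using permutes_not_in[OF F(1)] by (simp add: lattice_notin)
  qed
  then show ?thesis using g by (intro exI[of _ "blk F"]) auto
qed

text \<open>
  The translate of \<open>g\<close> by \<open>k\<close> cuts \<open>f\<close> at \<open>k\<close>, so \<open>P = (\<sigma>\<^sup>-\<^sup>k g \<sigma>\<^sup>k) g\<^sup>-\<^sup>1\<close> acts as \<open>f\<close> between \<open>0\<close> and \<open>k\<close> and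
  as the identity outside, up to errors near both ends. The radii of \<open>P\<close> and of its lattice do not
  depend on \<open>k\<close>; for large \<open>k\<close> the quotient of \<open>f\<close> by the lattice therefore fixes windows that are long
  compared to its own radius.
\<close>

theorem cuttable_product_of_lattices:
  assumes f: "f permutes X" "has_radius X f r0" "has_radius X (inv f) r0"
    and n: "0 < n" "\<And>x j. x \<in> X \<Longrightarrow> f (shift_by (n * j) x) = shift_by (n * j) (f x)"
    and cut: "cuttable X f"
  shows "\<exists>k s t P s' t' Q. gate s t P \<and> t - s \<le> k \<and> gate s' t' Q \<and> t' - s' \<le> k \<and>
     f = lattice k P \<circ> lattice k Q"
proof -
  from cut obtain g C0 q1 q2 where g: "g permutes X" "has_radius X g q1" "has_radius X (inv g) q2"
    and cut0: "\<forall>x\<in>X. (\<forall>i\<le>- C0. g x i = f x i) \<and> (\<forall>i\<ge>C0. g x i = x i)"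
    unfolding cuttable_def by (elim exE conjE)
  define C r q where "C = \<bar>C0\<bar>" and "r = \<bar>r0\<bar>" and "q = \<bar>q1\<bar> + \<bar>q2\<bar>"
  have pos: "0 \<le> C" "0 \<le> r" "0 \<le> q" by (simp_all add: C_def r_def q_def)
  have rf: "has_radius X f r" "has_radius X (inv f) r"
    using has_radius_mono[OF f(2)] has_radius_mono[OF f(3)] by (simp_all add: r_def)
  have rg: "has_radius X g q" "has_radius X (inv g) q"
    using has_radius_mono[OF g(2)] has_radius_mono[OF g(3)] by (simp_all add: q_def)
  have left: "g x i = f x i" if "x \<in> X" "i \<le> - C" for x i
  proof -
    have "i \<le> - C0" using that(2) by (simp add: C_def)
    then show ?thesis using cut0 that(1) by blast
  qed
  have right: "g x i = x i" if "x \<in> X" "C \<le> i" for x i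
  proof -
    have "C0 \<le> i" using that(2) by (simp add: C_def)
    then show ?thesis using cut0 that(1) by blast
  qed
  have gX: "g x \<in> X \<longleftrightarrow> x \<in> X" "inv g x \<in> X \<longleftrightarrow> x \<in> X" for x
    using permutes_in_image[OF g(1)] permutes_in_image[OF permutes_inv[OF g(1)]] by auto
  have fX: "f x \<in> X \<longleftrightarrow> x \<in> X" "inv f x \<in> X \<longleftrightarrow> x \<in> X" for x
    using permutes_in_image[OF f(1)] permutes_in_image[OF permutes_inv[OF f(1)]] by auto
  (* the radius of the quotient F2 below; the constant in k makes its fixed windows long enough *)
  define \<rho> where "\<rho> = q + q + r"
  define E where "E = C + 2 * q + w"
  define k where "k = n * (2 * E + 2 * C + 3 * r + 2 * (\<rho> + w))"
  have big: "2 * E + 2 * C + 3 * r + 2 * (\<rho> + w) \<le> k"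
  proof -
    have "1 * (2 * E + 2 * C + 3 * r + 2 * (\<rho> + w)) \<le> k"
      unfolding k_def by (rule mult_right_mono) (use n(1) pos w_pos in \<open>auto simp: E_def \<rho>_def\<close>)
    then show ?thesis by simp
  qed
  have kE: "2 * E \<le> k" and kpos: "0 \<le> k" using big pos w_pos by (auto simp: E_def \<rho>_def)
  have fk: "f (shift_by k x) = shift_by k (f x)" if "x \<in> X" for x
    unfolding k_def by (rule n(2)[OF that])
  have fkj: "f (shift_by (k * 2 * j) x) = shift_by (k * 2 * j) (f x)" if "x \<in> X" for x j
    using n(2)[OF that, of "(2 * E + 2 * C + 3 * r + 2 * (\<rho> + w)) * (2 * j)"] by (simp only: k_def mult.assoc)
  define P where "P = translate k g \<circ> inv g"
  have inv_left: "f (inv g x) i = x i" if "x \<in> X" "i \<le> - C" for x i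
    using left[of "inv g x" i] that gX permutes_inverses[OF g(1)] by simp
  have inv_right: "inv g x i = x i" if "x \<in> X" "C \<le> i" for x i
    using right[of "inv g x" i] that gX permutes_inverses[OF g(1)] by simp
  have P_left: "P x i = f (inv g x) i" if "x \<in> X" "i \<le> k - C" for x i
    using left[of "shift_by k (inv g x)" "i - k"] fk[of "inv g x"] that gX by (simp add: P_def translate_apply)
  have P_right: "P x i = x i" if "x \<in> X" "k + C \<le> i" for x i
    using right[of "shift_by k (inv g x)" "i - k"] inv_right[of x i] that gX kpos
    by (simp add: P_def translate_apply)
  have P_middle: "P x i = f x i" if x: "x \<in> X" "C + r \<le> i" "i \<le> k - C" for x i
  proof -
    have "f (inv g x) i = f x i"
    proof (rule has_radiusD[OF rf(1)])
      fix j assume "\<bar>j - i\<bar> \<le> r"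
      then show "inv g x j = x j" by (intro inv_right) (use x in auto)
    qed (use x gX in auto)
    then show ?thesis using P_left x by simp
  qed
  have radP: "has_radius X P (q + q)"
    unfolding P_def by (rule has_radius_comp[OF translate_radius[OF rg(1)] rg(2)]) (use gX in auto)
  have radP': "has_radius X (inv P) (q + q)"
  proof -
    have tg: "translate k g permutes X" by (rule translate_permutes[OF g(1)])
    have "inv P = g \<circ> translate k (inv g)"
      unfolding P_def using o_inv_distrib[of "translate k g" "inv g"] permutes_bij[OF tg] permutes_bij[OF permutes_inv[OF g(1)]]
        permutes_inv_inv[OF g(1)] translate_inv[OF g(1)] by simp
    moreover have "has_radius X (g \<circ> translate k (inv g)) (q + q)"
      by (rule has_radius_comp[OF rg(1) translate_radius[OF rg(2)]])
        (use permutes_in_image[OF translate_permutes[OF permutes_inv[OF g(1)]]] in blast)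
    ultimately show ?thesis by simp
  qed
  have gateP: "gate (- E) (k + E) P"
  proof (rule gateI)
    show "- E + 2 * w \<le> k + E" using kpos pos by (simp add: E_def)
    show "P permutes X" unfolding P_def
      by (rule permutes_compose[OF permutes_inv[OF g(1)] translate_permutes[OF g(1)]])
    have fx: "P x i = x i" if "x \<in> X" "i < - C \<or> k + C \<le> i" for x i
    proof (cases "i < - C")
      case True
      have "0 \<le> \<rho>" using pos by (simp add: \<rho>_def)
      then have "i \<le> k - C" using True pos big w_pos by (simp add: E_def)
      then show ?thesis using P_left[OF that(1)] inv_left[OF that(1)] True by simp
    next
      case False
      then show ?thesis using P_right[OF that(1)] that(2) by simp
    qed
    show "P x i = x i" if "x \<in> X" "\<not> (- E + w \<le> i \<and> i < k + E - w)" for x i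
      by (rule fx[OF that(1)]) (use that(2) pos in \<open>auto simp: E_def\<close>)
    show "P x i = P y i"
      if xy: "x \<in> X" "y \<in> X" "\<And>i. - E \<le> i \<Longrightarrow> i < k + E \<Longrightarrow> x i = y i" "- E \<le> i" "i < k + E" for x y i
    proof (cases "i < - C \<or> k + C \<le> i")
      case True
      then show ?thesis using fx xy by simp
    next
      case False
      show ?thesis
        by (rule has_radiusD[OF radP xy(1,2)], rule xy(3)) (use False w_pos in \<open>auto simp: E_def\<close>)
    qed
  qed
  have lenP: "k + E - (- E) \<le> k * 2" using kE by simp
  define F1 where "F1 = lattice (k * 2) P"
  define F2 where "F2 = inv F1 \<circ> f"
  have F1: "F1 permutes X" unfolding F1_def by (rule lattice_permutes[OF gateP lenP])
  have F1X: "F1 x \<in> X \<longleftrightarrow> x \<in> X" "inv F1 x \<in> X \<longleftrightarrow> x \<in> X" for x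
    using permutes_in_image[OF F1] permutes_in_image[OF permutes_inv[OF F1]] by auto
  have F2: "F2 permutes X" unfolding F2_def by (rule permutes_compose[OF f(1) permutes_inv[OF F1]])
  have F12: "F1 (F2 x) = f x" for x using permutes_inverses[OF F1] by (simp add: F2_def)
  have invF2: "inv F2 = inv f \<circ> F1"
    unfolding F2_def using o_inv_distrib[of "inv F1" f] permutes_bij[OF f(1)] permutes_bij[OF permutes_inv[OF F1]]
      permutes_inv_inv[OF F1] by simp
  have radF1: "has_radius X F1 (q + q)" unfolding F1_def by (rule lattice_radius_gate[OF gateP lenP radP])
  have radF1': "has_radius X (inv F1) (q + q)"
    unfolding F1_def inv_lattice[OF gateP lenP] by (rule lattice_radius_gate[OF gate_inv[OF gateP] lenP radP'])
  have radF2: "has_radius X F2 \<rho>" unfolding F2_def \<rho>_def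
    by (rule has_radius_comp[OF radF1' rf(1)]) (use fX in auto)
  have radF2': "has_radius X (inv F2) \<rho>"
  proof -
    have "has_radius X (inv f \<circ> F1) (r + (q + q))"
      by (rule has_radius_comp[OF rf(2) radF1]) (use F1X in auto)
    then show ?thesis by (simp add: invF2 \<rho>_def algebra_simps)
  qed
  have F1_shift: "F1 (shift_by (k * 2 * j) x) = shift_by (k * 2 * j) (F1 x)" if "x \<in> X" for x j
    unfolding F1_def by (rule lattice_shift[OF gateP lenP that])
  have F2_shift: "F2 (shift_by (k * 2 * j) x) = shift_by (k * 2 * j) (F2 x)" if x: "x \<in> X" for x j
  proof -
    have F2x: "F2 x \<in> X" using permutes_in_image[OF F2] x by blast
    have "F1 (shift_by (k * 2 * j) (F2 x)) = f (shift_by (k * 2 * j) x)"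
      using F1_shift[OF F2x] F12 fkj[OF x] by simp
    also have "\<dots> = F1 (F2 (shift_by (k * 2 * j) x))" by (simp only: F12)
    finally show ?thesis using permutes_inj[OF F1] by (metis injD)
  qed
  have F1_middle: "F1 x i = f x i" if x: "x \<in> X" and i: "C + r \<le> i" "i \<le> k - C" for x i
  proof -
    have "lattice (k * 2) P x (i + k * 2 * 0) = P (shift_by (k * 2 * 0) x) i"
      by (rule lattice_apply[OF gateP lenP x]) (use i big pos w_pos in \<open>auto simp: E_def \<rho>_def\<close>)
    then show ?thesis using P_middle[OF x i] by (simp add: F1_def)
  qed
  have F2_middle: "F2 x i = x i" if x: "x \<in> X" and i: "C + 2 * r \<le> i" "i \<le> k - C - r" for x i
  proof -
    have F2x: "F2 x \<in> X" using permutes_in_image[OF F2] x by blast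
    have "inv f (f (F2 x)) i = inv f (f x) i"
    proof (rule has_radiusD[OF rf(2)])
      fix j assume "\<bar>j - i\<bar> \<le> r"
      then have "F1 (F2 x) j = f (F2 x) j" by (intro F1_middle[OF F2x]) (use i in auto)
      then show "f (F2 x) j = f x j" by (simp add: F12)
    qed (use fX F2x x in auto)
    then show ?thesis using permutes_inverses[OF f(1)] by simp
  qed
  define e where "e = C + 2 * r + (\<rho> + w)"
  have "\<exists>Q. gate e (e + k * 2) Q \<and> F2 = lattice (k * 2) Q"
  proof (rule lattice_if_fixes_windows[OF F2 radF2 radF2'])
    show "0 \<le> \<rho>" using pos by (simp add: \<rho>_def)
    show "2 * (\<rho> + w) \<le> k * 2" using big pos w_pos kpos by (simp add: E_def)
    show "F2 (shift_by (k * 2 * j) x) = shift_by (k * 2 * j) (F2 x)" if "x \<in> X" for x j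
      by (rule F2_shift[OF that])
    fix x i assume x: "x \<in> X" and i: "e - (\<rho> + w) \<le> i \<and> i < e + (\<rho> + w) \<or>
        e + k * 2 - (\<rho> + w) \<le> i \<and> i < e + k * 2 + (\<rho> + w)"
    have hi: "e + (\<rho> + w) \<le> k - C - r" using big pos w_pos by (simp add: e_def E_def)
    from i show "F2 x i = x i"
    proof
      assume "e - (\<rho> + w) \<le> i \<and> i < e + (\<rho> + w)"
      then show ?thesis by (intro F2_middle[OF x]) (use hi in \<open>auto simp: e_def\<close>)
    next
      assume a: "e + k * 2 - (\<rho> + w) \<le> i \<and> i < e + k * 2 + (\<rho> + w)"
      have "F2 (shift_by (k * 2 * 1) x) (i - k * 2) = shift_by (k * 2 * 1) x (i - k * 2)"
        by (rule F2_middle) (use x a hi in \<open>auto simp: e_def\<close>)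
      then show ?thesis using F2_shift[OF x, of 1] by simp
    qed
  qed
  then obtain Q where Q: "gate e (e + k * 2) Q" "F2 = lattice (k * 2) Q" by blast
  have "f = lattice (k * 2) P \<circ> lattice (k * 2) Q"
    using F12 Q(2) by (simp add: F1_def fun_eq_iff)
  moreover have "e + k * 2 - e \<le> k * 2" by simp
  ultimately show ?thesis using gateP lenP Q(1) by blast
qed

end

section \<open>Inert automorphisms of edge shifts can be cut\<close>

lemma edge_shift_splice:
  assumes "x \<in> edge_shift G" "y \<in> edge_shift G" "head G (x m) = head G (y m)"
  shows "(\<lambda>i. if i \<le> m then x i else y i) \<in> edge_shift G"
  unfolding edge_shift_def
proof (intro CollectI allI)
  fix n
  have x: "x i \<in> arcs G \<and> head G (x i) = tail G (x (i + 1))"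
    and y: "y i \<in> arcs G \<and> head G (y i) = tail G (y (i + 1))" for i
    using assms(1,2) by (auto simp: edge_shift_def)
  consider "n < m" | "n = m" | "n > m" by linarith
  then show "(if n \<le> m then x n else y n) \<in> arcs G \<and>
    head G (if n \<le> m then x n else y n) = tail G (if n + 1 \<le> m then x (n + 1) else y (n + 1))"
    by cases (use x[of n] y[of n] assms(3) in auto)
qed

lemma edge_shift_splice_0:
  assumes "x \<in> edge_shift G" "y \<in> edge_shift G" "x 0 = y 0"
  shows "(\<lambda>i. if i \<le> (0::int) then x i else y i) \<in> edge_shift G"
  using assms by (intro edge_shift_splice) auto

lemma ray_eq_iff:
  assumes "x \<in> edge_shift G" "y \<in> edge_shift G"
  shows "ray G x m = ray G y m \<longleftrightarrow> (\<forall>i\<le>m. x i = y i)"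
proof
  assume "ray G x m = ray G y m"
  moreover have "x \<in> ray G x m" using assms by (simp add: ray_def)
  ultimately show "\<forall>i\<le>m. x i = y i" by (simp add: ray_def)
next
  assume a: "\<forall>i\<le>m. x i = y i"
  show "ray G x m = ray G y m"
    unfolding ray_def using a by (intro Collect_cong conj_cong refl) simp
qed

lemma self_in_ray: "x \<in> edge_shift G \<Longrightarrow> x \<in> ray G x m"
  by (simp add: ray_def)

text \<open>
  The rays counted by \<^const>\<open>beam_vector\<close>.
\<close>

definition rays_to :: "('v, 'e) pre_digraph \<Rightarrow> (int \<Rightarrow> 'e) set \<Rightarrow> int \<Rightarrow> 'v \<Rightarrow> (int \<Rightarrow> 'e) set set" where
  "rays_to G U m v = {ray G x m | x. x \<in> edge_shift G \<and> ray G x m \<subseteq> U \<and> head G (x m) = v}"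

lemma beam_rays:
  assumes "is_beam_at G m U"
  shows "finite (rays_to G U m v)" "U \<subseteq> edge_shift G" "y \<in> U \<Longrightarrow> ray G y m \<subseteq> U"
proof -
  obtain F where F: "finite F" "F \<subseteq> edge_shift G" "U = (\<Union>x\<in>F. ray G x m)"
    using assms unfolding is_beam_at_def by blast
  show sub: "U \<subseteq> edge_shift G" using F by (auto simp: ray_def)
  have in_F: "\<exists>x\<in>F. ray G y m = ray G x m" if y: "y \<in> U" for y
  proof -
    obtain x where x: "x \<in> F" "y \<in> ray G x m" using y F(3) by blast
    then have "ray G y m = ray G x m"
      using ray_eq_iff[of y G x m] F(2) by (auto simp: ray_def)
    then show ?thesis using x by blast
  qed
  show "ray G y m \<subseteq> U" if "y \<in> U" using in_F[OF that] F(3) by blast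
  have "rays_to G U m v \<subseteq> (\<lambda>x. ray G x m) ` F"
  proof
    fix R assume "R \<in> rays_to G U m v"
    then obtain x where x: "R = ray G x m" "x \<in> edge_shift G" "ray G x m \<subseteq> U"
      unfolding rays_to_def by blast
    then have "x \<in> U" using self_in_ray by blast
    then show "R \<in> (\<lambda>x. ray G x m) ` F" using in_F x(1) by blast
  qed
  then show "finite (rays_to G U m v)" using F(1) finite_surj by blast
qed

text \<open>
  Both beams contain equally many \<open>m\<close>-rays ending at each vertex. Rays matched by a bijection have
  the same continuations, so that replacing the coordinates up to \<open>m\<close> maps one onto the other.
\<close>

lemma equivalent_beams_matching:
  assumes G: "fin_digraph G" and U: "is_beam_at G m U" and U': "is_beam_at G m U'"
    and eq: "\<And>v. v \<in> verts G \<Longrightarrow> beam_vector G U m v = beam_vector G U' m v"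
  shows "\<exists>\<beta>. bij_betw \<beta> U U' \<and> (\<forall>y\<in>U. \<forall>i>m. \<beta> y i = y i) \<and>
     (\<forall>y\<in>U. \<forall>y'\<in>U. \<forall>i. (\<forall>j\<le>max m i. y j = y' j) \<longrightarrow> \<beta> y i = \<beta> y' i)"
proof -
  interpret fin_digraph G by (rule G)
  have "\<exists>b. bij_betw b (rays_to G U m v) (rays_to G U' m v)" if "v \<in> verts G" for v
  proof -
    have "card (rays_to G U m v) = card (rays_to G U' m v)"
      using eq[OF that] unfolding beam_vector_def rays_to_def by simp
    then show ?thesis using beam_rays(1)[OF U] beam_rays(1)[OF U'] finite_same_card_bij by blast
  qed
  then obtain b where b: "\<And>v. v \<in> verts G \<Longrightarrow> bij_betw (b v) (rays_to G U m v) (rays_to G U' m v)"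
    by metis
  define z where "z y = (SOME z. z \<in> b (head G (y m)) (ray G y m))" for y
  define \<beta> where "\<beta> y = (\<lambda>i. if i \<le> m then z y i else y i)" for y
  have UY: "y \<in> edge_shift G" if "y \<in> U" for y using beam_rays(2)[OF U] that by blast
  have UY': "y \<in> edge_shift G" if "y \<in> U'" for y using beam_rays(2)[OF U'] that by blast
  have hv: "head G (y m) \<in> verts G" if "y \<in> edge_shift G" for y
    using that head_in_verts by (auto simp: edge_shift_def)
  have own: "ray G y m \<in> rays_to G U m (head G (y m))" if "y \<in> U" for y
    unfolding rays_to_def using UY[OF that] beam_rays(3)[OF U that] by blast
  have own': "ray G y m \<in> rays_to G U' m (head G (y m))" if "y \<in> U'" for y
    unfolding rays_to_def using UY'[OF that] beam_rays(3)[OF U' that] by blast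
  have z: "z y \<in> edge_shift G" "head G (z y m) = head G (y m)"
    "ray G (z y) m = b (head G (y m)) (ray G y m)" "ray G (z y) m \<subseteq> U'" if y: "y \<in> U" for y
  proof -
    have "b (head G (y m)) (ray G y m) \<in> rays_to G U' m (head G (y m))"
      using b[OF hv[OF UY[OF y]]] own[OF y] bij_betwE by blast
    then obtain x where x: "b (head G (y m)) (ray G y m) = ray G x m" "x \<in> edge_shift G"
      "ray G x m \<subseteq> U'" "head G (x m) = head G (y m)" unfolding rays_to_def by blast
    have "z y \<in> ray G x m" unfolding z_def x(1) 
      using self_in_ray[OF x(2), of m] by (rule someI[of "\<lambda>z. z \<in> ray G x m" x])
    then have zy: "z y \<in> edge_shift G" "\<forall>i\<le>m. z y i = x i" by (auto simp: ray_def)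
    have "ray G (z y) m = ray G x m" using ray_eq_iff[OF zy(1) x(2)] zy(2) by blast
    then show "z y \<in> edge_shift G" "head G (z y m) = head G (y m)"
      "ray G (z y) m = b (head G (y m)) (ray G y m)" "ray G (z y) m \<subseteq> U'"
      using zy x by simp_all
  qed
  have \<beta>: "\<beta> y \<in> edge_shift G" "\<beta> y \<in> ray G (z y) m" if y: "y \<in> U" for y
  proof -
    show "\<beta> y \<in> edge_shift G" unfolding \<beta>_def
      by (rule edge_shift_splice[OF z(1)[OF y] UY[OF y] z(2)[OF y]])
    then show "\<beta> y \<in> ray G (z y) m" by (simp add: ray_def \<beta>_def)
  qed
  have ray\<beta>: "ray G (\<beta> y) m = b (head G (y m)) (ray G y m)" "head G (\<beta> y m) = head G (y m)" if y: "y \<in> U" for y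
  proof -
    have "ray G (\<beta> y) m = ray G (z y) m"
      using ray_eq_iff[OF \<beta>(1)[OF y] z(1)[OF y]] by (simp add: \<beta>_def)
    then show "ray G (\<beta> y) m = b (head G (y m)) (ray G y m)" using z(3)[OF y] by simp
    show "head G (\<beta> y m) = head G (y m)" using z(2)[OF y] by (simp add: \<beta>_def)
  qed
  have "bij_betw \<beta> U U'"
    unfolding bij_betw_def
  proof
    show "inj_on \<beta> U"
    proof (rule inj_onI)
      fix y y' assume y: "y \<in> U" "y' \<in> U" and e: "\<beta> y = \<beta> y'"
      have hd: "head G (y m) = head G (y' m)" using ray\<beta>(2) y e by metis
      then have "b (head G (y m)) (ray G y m) = b (head G (y m)) (ray G y' m)"
        using ray\<beta>(1) y e by metis
      then have "ray G y m = ray G y' m"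
        using b[OF hv[OF UY[OF y(1)]]] own[OF y(1)] own[OF y(2)] hd
        unfolding bij_betw_def by (metis inj_on_def)
      then have le: "\<forall>i\<le>m. y i = y' i" using ray_eq_iff[OF UY[OF y(1)] UY[OF y(2)]] by blast
      show "y = y'"
      proof
        fix i
        show "y i = y' i"
          using le fun_cong[OF e, of i] by (cases "i \<le> m") (auto simp: \<beta>_def)
      qed
    qed
    show "\<beta> ` U = U'"
    proof
      show "\<beta> ` U \<subseteq> U'" using \<beta>(2) z(4) by blast
      show "U' \<subseteq> \<beta> ` U"
      proof
        fix u assume u: "u \<in> U'"
        let ?v = "head G (u m)"
        have v: "?v \<in> verts G" using hv[OF UY'[OF u]] .
        obtain R where R: "R \<in> rays_to G U m ?v" "b ?v R = ray G u m"
          using own'[OF u] b[OF v] unfolding bij_betw_def by (metis imageE)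
        then obtain x where x: "R = ray G x m" "x \<in> edge_shift G" "ray G x m \<subseteq> U" "head G (x m) = ?v"
          unfolding rays_to_def by blast
        define y where "y = (\<lambda>i. if i \<le> m then x i else u i)"
        have yY: "y \<in> edge_shift G" unfolding y_def
          by (rule edge_shift_splice[OF x(2) UY'[OF u] x(4)])
        have yx: "ray G y m = R" using ray_eq_iff[OF yY x(2)] x(1) by (simp add: y_def)
        have yU: "y \<in> U" using self_in_ray[OF yY, of m] yx x(1,3) by blast
        have "head G (y m) = ?v" using x(4) by (simp add: y_def)
        then have "ray G (\<beta> y) m = ray G u m" using ray\<beta>(1)[OF yU] R(2) yx by simp
        then have le: "\<forall>i\<le>m. \<beta> y i = u i" using ray_eq_iff[OF \<beta>(1)[OF yU] UY'[OF u]] by blast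
        have "\<beta> y i = u i" for i using le by (cases "i \<le> m") (auto simp: \<beta>_def y_def)
        then have "\<beta> y = u" by blast
        then show "u \<in> \<beta> ` U" using yU by blast
      qed
    qed
  qed
  moreover have "\<forall>y\<in>U. \<forall>i>m. \<beta> y i = y i" by (simp add: \<beta>_def)
  moreover have "\<beta> y i = \<beta> y' i" if y: "y \<in> U" "y' \<in> U" "\<forall>j\<le>max m i. y j = y' j" for y y' i
  proof -
    have "ray G y m = ray G y' m" using ray_eq_iff[OF UY[OF y(1)] UY[OF y(2)]] y(3) by simp
    moreover have "y m = y' m" using y(3) by simp
    ultimately have "z y = z y'" by (simp add: z_def)
    moreover have "y i = y' i" using y(3) by simp
    ultimately show ?thesis by (simp add: \<beta>_def)
  qed
  ultimately show ?thesis by blast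
qed

text \<open>
  Composing the matching of \<open>R\<close> with \<open>f(R)\<close> with the inverse of \<open>f\<close> gives a permutation of the ray \<open>R\<close> after
  which \<open>f\<close> does not change the tail.
\<close>

lemma inert_ray_matching:
  assumes G: "fin_digraph G"
    and f: "\<And>x. x \<in> edge_shift G \<Longrightarrow> fi x \<in> edge_shift G" "\<And>x. x \<in> edge_shift G \<Longrightarrow> fi (f x) = x"
    and rad: "has_radius (edge_shift G) fi r"  "0 \<le> r" and fY: "\<And>x. x \<in> edge_shift G \<Longrightarrow> f x \<in> edge_shift G"
    and x: "x \<in> edge_shift G" and eqv: "beam_equiv G (f ` ray G x 0) (ray G x 0)"
    and ffi: "\<And>x. x \<in> edge_shift G \<Longrightarrow> f (fi x) = x"
  shows "\<exists>\<gamma> m. bij_betw \<gamma> (ray G x 0) (ray G x 0) \<and> (\<forall>y\<in>ray G x 0. \<forall>i>m. f (\<gamma> y) i = y i) \<and>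
     (\<forall>y\<in>ray G x 0. \<forall>y'\<in>ray G x 0. \<forall>i. (\<forall>j\<le>max m (i + r). y j = y' j) \<longrightarrow> \<gamma> y i = \<gamma> y' i)"
proof -
  let ?R = "ray G x 0"
  obtain m where m: "is_beam_at G m (f ` ?R)" "is_beam_at G m ?R"
    "\<forall>v\<in>verts G. beam_vector G (f ` ?R) m v = beam_vector G ?R m v"
    using eqv unfolding beam_equiv_def by blast
  have RY: "y \<in> edge_shift G" if "y \<in> ?R" for y using that by (simp add: ray_def)
  have "\<exists>\<beta>. bij_betw \<beta> ?R (f ` ?R) \<and> (\<forall>y\<in>?R. \<forall>i>m. \<beta> y i = y i) \<and>
    (\<forall>y\<in>?R. \<forall>y'\<in>?R. \<forall>i. (\<forall>j\<le>max m i. y j = y' j) \<longrightarrow> \<beta> y i = \<beta> y' i)"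
    by (rule equivalent_beams_matching[OF G m(2,1)]) (rule m(3)[rule_format, symmetric])
  then obtain \<beta> where \<beta>: "bij_betw \<beta> ?R (f ` ?R)" "\<forall>y\<in>?R. \<forall>i>m. \<beta> y i = y i"
    "\<forall>y\<in>?R. \<forall>y'\<in>?R. \<forall>i. (\<forall>j\<le>max m i. y j = y' j) \<longrightarrow> \<beta> y i = \<beta> y' i"
    by (elim exE conjE)
  define \<gamma> where "\<gamma> = fi \<circ> \<beta>"
  have bR: "\<beta> y \<in> f ` ?R" if "y \<in> ?R" for y using \<beta>(1) that bij_betwE by blast
  have bY: "\<beta> y \<in> edge_shift G" if y: "y \<in> ?R" for y
  proof -
    obtain u where u: "\<beta> y = f u" "u \<in> ?R" using bR[OF y] by (rule imageE)
    show ?thesis unfolding u(1) by (rule fY[OF RY[OF u(2)]])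
  qed
  have fiR: "fi (f y) = y" if "y \<in> ?R" for y by (rule f(2)[OF RY[OF that]])
  have fi_bij: "bij_betw fi (f ` ?R) ?R"
    unfolding bij_betw_def
  proof
    show "inj_on fi (f ` ?R)" by (rule inj_onI) (auto simp: fiR)
    show "fi ` f ` ?R = ?R" by (simp add: image_image fiR)
  qed
  have 1: "bij_betw \<gamma> ?R ?R" unfolding \<gamma>_def by (rule bij_betw_trans[OF \<beta>(1) fi_bij])
  have 2: "\<forall>y\<in>?R. \<forall>i>m. f (\<gamma> y) i = y i" using ffi bY \<beta>(2) by (simp add: \<gamma>_def)
  have 3: "\<gamma> y i = \<gamma> y' i" if y: "y \<in> ?R" "y' \<in> ?R" "\<forall>j\<le>max m (i + r). y j = y' j" for y y' i
    unfolding \<gamma>_def comp_def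
  proof (rule has_radiusD[OF rad(1) bY[OF y(1)] bY[OF y(2)]])
    fix j assume "\<bar>j - i\<bar> \<le> r"
    then have "\<forall>k\<le>max m j. y k = y' k" using y(3) by auto
    then show "\<beta> y j = \<beta> y' j" using \<beta>(3) y(1,2) by blast
  qed
  show ?thesis using 1 2 3 by blast
qed

text \<open>
  The permutations \<open>\<gamma>\<close> of the individual rays must be chosen uniformly, since in general there are
  uncountably many rays. Replacing \<open>x\<close> on the coordinates \<open>i \<le> 0\<close> changes \<open>f x\<close> to the right of \<open>- r\<close> only through the
  coordinates in \<open>{- 2 r..0}\<close>, so it suffices to choose \<open>\<gamma>\<close> for one representative \<open>rep x\<close> of each of
  the finitely many words on that window. The map \<open>\<phi>\<close> transports this choice to all points: it keeps
  \<open>x\<close> on the left, so \<open>f \<circ> \<phi>\<close> agrees with \<open>f\<close> there, and it makes \<open>f \<circ> \<phi>\<close> the identity on the right.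
\<close>

lemma inert_half_map:
  assumes G: "fin_digraph G"
    and f: "\<And>x. x \<in> edge_shift G \<Longrightarrow> f x \<in> edge_shift G" "\<And>x. x \<in> edge_shift G \<Longrightarrow> fi x \<in> edge_shift G"
      "\<And>x. x \<in> edge_shift G \<Longrightarrow> fi (f x) = x" "\<And>x. x \<in> edge_shift G \<Longrightarrow> f (fi x) = x"
    and rad: "has_radius (edge_shift G) f r" "has_radius (edge_shift G) fi r" "0 \<le> r"
    and inert: "\<And>x. x \<in> edge_shift G \<Longrightarrow> beam_equiv G (f ` ray G x 0) (ray G x 0)"
  shows "\<exists>g C. bij_betw g (edge_shift G) (edge_shift G) \<and> 0 \<le> C \<and>
    (\<forall>i. pointwise_local (edge_shift G) (\<lambda>x. g x i)) \<and>
    (\<forall>x\<in>edge_shift G. (\<forall>i\<le>- C. g x i = f x i) \<and> (\<forall>i\<ge>C. g x i = x i))"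
proof -
  interpret fin_digraph G by (rule G)
  let ?Y = "edge_shift G"
  define I where "I = {- (2 * r)..(0::int)}"
  define rep where "rep x = (SOME z. z \<in> ?Y \<and> restrict z I = restrict x I)" for x
  have rep: "rep x \<in> ?Y \<and> restrict (rep x) I = restrict x I" if "x \<in> ?Y" for x
    unfolding rep_def by (rule someI[of _ x]) (use that in simp)
  have repI: "rep x i = x i" if "x \<in> ?Y" "- (2 * r) \<le> i" "i \<le> 0" for x i
  proof -
    have "restrict (rep x) I i = restrict x I i" using rep[OF that(1)] by simp
    then show ?thesis using that by (simp add: I_def)
  qed
  have rep_cong: "rep x = rep y" if "\<And>i. - (2 * r) \<le> i \<Longrightarrow> i \<le> 0 \<Longrightarrow> x i = y i" for x y
  proof -
    have "restrict x I = restrict y I" by (rule restrict_ext) (use that in \<open>auto simp: I_def\<close>)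
    then show ?thesis by (simp add: rep_def)
  qed
  have fin: "finite (rep ` ?Y)"
  proof -
    have "rep ` ?Y \<subseteq> (\<lambda>u. SOME z. z \<in> ?Y \<and> restrict z I = u) ` (I \<rightarrow>\<^sub>E arcs G)"
    proof
      fix z assume "z \<in> rep ` ?Y"
      then obtain x where x: "x \<in> ?Y" "z = rep x" by blast
      have "restrict x I \<in> I \<rightarrow>\<^sub>E arcs G" using x by (auto simp: edge_shift_def)
      then show "z \<in> (\<lambda>u. SOME z. z \<in> ?Y \<and> restrict z I = u) ` (I \<rightarrow>\<^sub>E arcs G)"
        unfolding x(2) rep_def by (rule rev_image_eqI) simp
    qed
    moreover have "finite (I \<rightarrow>\<^sub>E arcs G)" by (rule finite_PiE) (auto simp: I_def)
    ultimately show ?thesis using finite_surj by blast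
  qed
  have "\<forall>x. \<exists>\<gamma> m. x \<in> ?Y \<longrightarrow> bij_betw \<gamma> (ray G x 0) (ray G x 0) \<and> (\<forall>y\<in>ray G x 0. \<forall>i>m. f (\<gamma> y) i = y i) \<and>
     (\<forall>y\<in>ray G x 0. \<forall>y'\<in>ray G x 0. \<forall>i. (\<forall>j\<le>max m (i + r). y j = y' j) \<longrightarrow> \<gamma> y i = \<gamma> y' i)"
  proof
    fix x
    show "\<exists>\<gamma> m. x \<in> ?Y \<longrightarrow> bij_betw \<gamma> (ray G x 0) (ray G x 0) \<and> (\<forall>y\<in>ray G x 0. \<forall>i>m. f (\<gamma> y) i = y i) \<and>
     (\<forall>y\<in>ray G x 0. \<forall>y'\<in>ray G x 0. \<forall>i. (\<forall>j\<le>max m (i + r). y j = y' j) \<longrightarrow> \<gamma> y i = \<gamma> y' i)"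
    proof (cases "x \<in> ?Y")
      case True
      have "\<exists>\<gamma> m. bij_betw \<gamma> (ray G x 0) (ray G x 0) \<and> (\<forall>y\<in>ray G x 0. \<forall>i>m. f (\<gamma> y) i = y i) \<and>
       (\<forall>y\<in>ray G x 0. \<forall>y'\<in>ray G x 0. \<forall>i. (\<forall>j\<le>max m (i + r). y j = y' j) \<longrightarrow> \<gamma> y i = \<gamma> y' i)"
        by (rule inert_ray_matching[OF G f(2,3) rad(2,3) f(1) True inert[OF True] f(4)])
      then show ?thesis by blast
    qed blast
  qed
  from choice[OF this] obtain \<gamma> where "\<forall>x. \<exists>m. x \<in> ?Y \<longrightarrow> bij_betw (\<gamma> x) (ray G x 0) (ray G x 0) \<and>
     (\<forall>y\<in>ray G x 0. \<forall>i>m. f (\<gamma> x y) i = y i) \<and>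
     (\<forall>y\<in>ray G x 0. \<forall>y'\<in>ray G x 0. \<forall>i. (\<forall>j\<le>max m (i + r). y j = y' j) \<longrightarrow> \<gamma> x y i = \<gamma> x y' i)"
    by (elim exE)
  from choice[OF this] obtain m where
    gm: "\<forall>x. x \<in> ?Y \<longrightarrow> bij_betw (\<gamma> x) (ray G x 0) (ray G x 0) \<and> (\<forall>y\<in>ray G x 0. \<forall>i>m x. f (\<gamma> x y) i = y i) \<and>
     (\<forall>y\<in>ray G x 0. \<forall>y'\<in>ray G x 0. \<forall>i. (\<forall>j\<le>max (m x) (i + r). y j = y' j) \<longrightarrow> \<gamma> x y i = \<gamma> x y' i)"
    by (elim exE)
  have \<gamma>_bij: "bij_betw (\<gamma> x) (ray G x 0) (ray G x 0)" if "x \<in> ?Y" for x using gm that by blast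
  have \<gamma>_right: "f (\<gamma> x y) i = y i" if "x \<in> ?Y" "y \<in> ray G x 0" "i > m x" for x y i using gm that by blast
  have \<gamma>_local: "\<gamma> x y i = \<gamma> x y' i"
    if "x \<in> ?Y" "y \<in> ray G x 0" "y' \<in> ray G x 0" "\<forall>j\<le>max (m x) (i + r). y j = y' j" for x y y' i
    using gm that by blast
  define \<sigma> where "\<sigma> x = (\<lambda>i. if i \<le> (0::int) then rep x i else x i)" for x
  define \<phi> where "\<phi> x = (\<lambda>i. if i \<le> (0::int) then x i else \<gamma> (rep x) (\<sigma> x) i)" for x
  have \<sigma>: "\<sigma> x \<in> ray G (rep x) 0" if x: "x \<in> ?Y" for x
  proof -
    have "\<sigma> x \<in> ?Y" unfolding \<sigma>_def
      by (rule edge_shift_splice_0) (use rep[OF x] repI[OF x, of 0] x rad(3) in auto)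
    then show ?thesis by (simp add: ray_def \<sigma>_def)
  qed
  have \<gamma>\<sigma>: "\<gamma> (rep x) (\<sigma> x) \<in> ray G (rep x) 0" if x: "x \<in> ?Y" for x
    using \<gamma>_bij \<sigma>[OF x] rep[OF x] bij_betwE by blast
  have \<phi>Y: "\<phi> x \<in> ?Y" if x: "x \<in> ?Y" for x
    unfolding \<phi>_def
    by (rule edge_shift_splice_0) (use \<gamma>\<sigma>[OF x] x repI[OF x, of 0] rad(3) in \<open>auto simp: ray_def\<close>)
  have inj: "inj_on \<phi> ?Y"
  proof (rule inj_onI)
    fix x y assume xy: "x \<in> ?Y" "y \<in> ?Y" "\<phi> x = \<phi> y"
    have le: "x i = y i" if "i \<le> 0" for i using fun_cong[OF xy(3), of i] that by (simp add: \<phi>_def)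
    then have r: "rep x = rep y" by (intro rep_cong) auto
    have "\<gamma> (rep x) (\<sigma> x) i = \<gamma> (rep x) (\<sigma> y) i" for i
    proof (cases "i \<le> 0")
      case True
      then show ?thesis using \<gamma>\<sigma>[OF xy(1)] \<gamma>\<sigma>[OF xy(2)] r by (simp add: ray_def)
    next
      case False
      then show ?thesis using fun_cong[OF xy(3), of i] r by (simp add: \<phi>_def)
    qed
    then have "\<gamma> (rep x) (\<sigma> x) = \<gamma> (rep x) (\<sigma> y)" by blast
    then have s: "\<sigma> x = \<sigma> y"
      using \<gamma>_bij[of "rep x"] rep[OF xy(1)] \<sigma>[OF xy(1)] \<sigma>[OF xy(2)] r unfolding bij_betw_def by (metis inj_onD)
    have gt: "x i = y i" if "\<not> i \<le> 0" for i using fun_cong[OF s, of i] that by (simp add: \<sigma>_def)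
    show "x = y" using le gt by blast
  qed
  have surj: "\<exists>x\<in>?Y. \<phi> x = y" if y: "y \<in> ?Y" for y
  proof -
    have "\<sigma> y \<in> \<gamma> (rep y) ` ray G (rep y) 0"
      using \<gamma>_bij[of "rep y"] rep[OF y] \<sigma>[OF y] by (simp add: bij_betw_def)
    then obtain v where v: "v \<in> ray G (rep y) 0" "\<gamma> (rep y) v = \<sigma> y" by (metis imageE)
    define x where "x = (\<lambda>i. if i \<le> (0::int) then y i else v i)"
    have x: "x \<in> ?Y" unfolding x_def
      by (rule edge_shift_splice_0) (use v y repI[OF y, of 0] rad(3) in \<open>auto simp: ray_def\<close>)
    have r: "rep x = rep y" by (rule rep_cong) (simp add: x_def)
    have xi: "x i = (if i \<le> 0 then y i else v i)" for i by (simp add: x_def)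
    have "\<sigma> x i = v i" for i
      using v(1) r xi[of i] by (cases "i \<le> 0") (simp_all add: \<sigma>_def ray_def)
    then have \<sigma>x: "\<sigma> x = v" by blast
    have "\<phi> x i = y i" for i
    proof (cases "i \<le> 0")
      case True
      then show ?thesis using xi[of i] by (simp add: \<phi>_def)
    next
      case False
      then have "\<phi> x i = \<sigma> y i" using v(2) r \<sigma>x by (simp add: \<phi>_def)
      then show ?thesis using False by (simp add: \<sigma>_def)
    qed
    then have "\<phi> x = y" by blast
    then show ?thesis using x by blast
  qed
  have bij: "bij_betw \<phi> ?Y ?Y" unfolding bij_betw_def using inj surj \<phi>Y by blast
  have loc: "pointwise_local ?Y (\<lambda>x. \<phi> x i)" for i
    unfolding pointwise_local_def
  proof
    fix x assume x: "x \<in> ?Y"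
    have "\<phi> y i = \<phi> x i"
      if y: "y \<in> ?Y" "\<forall>j. \<bar>j\<bar> \<le> 2 * r + \<bar>i\<bar> + \<bar>m (rep x)\<bar> \<longrightarrow> y j = x j" for y
    proof (cases "i \<le> 0")
      case True
      then show ?thesis using y(2) rad(3) by (simp add: \<phi>_def)
    next
      case False
      have r: "rep y = rep x" by (rule rep_cong) (use y(2) in simp)
      have "\<gamma> (rep x) (\<sigma> y) i = \<gamma> (rep x) (\<sigma> x) i"
      proof (rule \<gamma>_local)
        show "rep x \<in> ?Y" using rep[OF x] by blast
        show "\<sigma> y \<in> ray G (rep x) 0" using \<sigma>[OF y(1)] r by simp
        show "\<sigma> x \<in> ray G (rep x) 0" by (rule \<sigma>[OF x])
        show "\<forall>j\<le>max (m (rep x)) (i + r). \<sigma> y j = \<sigma> x j"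
        proof (intro allI impI)
          fix j assume j: "j \<le> max (m (rep x)) (i + r)"
          show "\<sigma> y j = \<sigma> x j"
          proof (cases "j \<le> 0")
            case True
            then show ?thesis by (simp add: \<sigma>_def r)
          next
            case False
            then have "\<bar>j\<bar> \<le> 2 * r + \<bar>i\<bar> + \<bar>m (rep x)\<bar>" using j rad(3) by auto
            then show ?thesis using y(2) False by (simp add: \<sigma>_def)
          qed
        qed
      qed
      then show ?thesis using False r by (simp add: \<phi>_def)
    qed
    then show "\<exists>M. \<forall>y\<in>?Y. (\<forall>j. \<bar>j\<bar> \<le> M \<longrightarrow> y j = x j) \<longrightarrow> \<phi> y i = \<phi> x i" by blast
  qed
  obtain M where M: "\<forall>i\<in>m ` rep ` ?Y. \<bar>i\<bar> \<le> M" using finite_int_bound[of "m ` rep ` ?Y"] fin by auto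
  define C where "C = r + \<bar>M\<bar> + 1"
  have bijf: "bij_betw f ?Y ?Y" by (rule bij_betw_byWitness[of _ fi]) (use f in auto)
  have "bij_betw (f \<circ> \<phi>) ?Y ?Y" by (rule bij_betw_trans[OF bij bijf])
  moreover have "0 \<le> C" using rad(3) by (simp add: C_def)
  moreover have "pointwise_local ?Y (\<lambda>x. (f \<circ> \<phi>) x i)" for i
  proof -
    have 1: "continuous_map (shift_topology ?Y) (shift_topology ?Y) \<phi>"
      unfolding continuous_map_shift_topology using \<phi>Y loc by blast
    have 2: "continuous_map (shift_topology ?Y) (shift_topology ?Y) f"
      unfolding continuous_map_shift_topology using f(1) has_radius_pointwise_local[OF rad(1)] by blast
    show ?thesis using continuous_map_compose[OF 1 2] unfolding continuous_map_shift_topology by blast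
  qed
  moreover have "(f \<circ> \<phi>) x i = f x i" if x: "x \<in> ?Y" "i \<le> - C" for x i
  proof -
    have "f (\<phi> x) i = f x i"
      by (rule has_radiusD[OF rad(1) \<phi>Y[OF x(1)] x(1)]) (use x(2) in \<open>auto simp: \<phi>_def C_def\<close>)
    then show ?thesis by simp
  qed
  moreover have "(f \<circ> \<phi>) x i = x i" if x: "x \<in> ?Y" "C \<le> i" for x i
  proof -
    have i: "0 < i" "r < i" "M < i" using x(2) rad(3) by (auto simp: C_def)
    have "f (\<phi> x) i = f (\<gamma> (rep x) (\<sigma> x)) i"
    proof (rule has_radiusD[OF rad(1) \<phi>Y[OF x(1)]])
      show "\<gamma> (rep x) (\<sigma> x) \<in> ?Y" using \<gamma>\<sigma>[OF x(1)] by (simp add: ray_def)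
      fix j assume "\<bar>j - i\<bar> \<le> r"
      then have "0 < j" using i by auto
      then show "\<phi> x j = \<gamma> (rep x) (\<sigma> x) j" by (simp add: \<phi>_def)
    qed
    also have "\<dots> = \<sigma> x i"
    proof (rule \<gamma>_right)
      show "rep x \<in> ?Y" using rep[OF x(1)] by blast
      show "\<sigma> x \<in> ray G (rep x) 0" by (rule \<sigma>[OF x(1)])
      have "\<bar>m (rep x)\<bar> \<le> M" using M x(1) by blast
      then show "m (rep x) < i" using i by linarith
    qed
    also have "\<dots> = x i" using i by (simp add: \<sigma>_def)
    finally show ?thesis by simp
  qed
  ultimately show ?thesis by blast
qed

section \<open>Cuttable automorphisms form a normal subgroup\<close>

lemma shift_intertwining_mult:
  assumes inX: "\<And>x q. x \<in> X \<Longrightarrow> shift_by (a * q) x \<in> X"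
    and h: "\<And>x. x \<in> X \<Longrightarrow> h (shift_by a x) = shift_by b (h x)" and x: "x \<in> X"
  shows "h (shift_by (a * q) x) = shift_by (b * q) (h x)"
proof -
  have nonneg: "h (shift_by (a * int m) y) = shift_by (b * int m) (h y)" if y: "y \<in> X" for m y
  proof (induction m)
    case (Suc m)
    have e: "a * int (Suc m) = a + a * int m" "b * int (Suc m) = b + b * int m"
      by (simp_all add: algebra_simps)
    have "h (shift_by (a * int (Suc m)) y) = h (shift_by a (shift_by (a * int m) y))"
      by (simp only: e shift_by_shift_by)
    also have "\<dots> = shift_by b (h (shift_by (a * int m) y))" by (rule h[OF inX[OF y]])
    also have "\<dots> = shift_by b (shift_by (b * int m) (h y))" by (simp only: Suc)
    finally show ?case by (simp only: e shift_by_shift_by)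
  qed simp
  show ?thesis
  proof (cases "0 \<le> q")
    case True
    then show ?thesis using nonneg[OF x, of "nat q"] by simp
  next
    case False
    define y where "y = shift_by (a * q) x"
    have y: "y \<in> X" using inX[OF x] by (simp add: y_def)
    have "h (shift_by (a * int (nat (- q))) y) = shift_by (b * int (nat (- q))) (h y)"
      by (rule nonneg[OF y])
    moreover have "shift_by (a * int (nat (- q))) y = x" using False by (simp add: y_def)
    ultimately have "shift_by (b * q) (h x) = shift_by (b * q) (shift_by (b * int (nat (- q))) (h y))" by simp
    also have "\<dots> = h y" using False by simp
    finally show ?thesis by (simp add: y_def)
  qed
qed

lemma edge_shift_shift: "p \<in> edge_shift G \<Longrightarrow> shift_by q p \<in> edge_shift G"
proof -
  assume p: "p \<in> edge_shift G"
  show ?thesis unfolding edge_shift_def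
  proof (intro CollectI allI)
    fix n
    have "p (n + q) \<in> arcs G \<and> head G (p (n + q)) = tail G (p (n + q + 1))"
      using p unfolding edge_shift_def by blast
    moreover have "n + 1 + q = n + q + 1" by simp
    ultimately show "shift_by q p n \<in> arcs G \<and> head G (shift_by q p n) = tail G (shift_by q p (n + 1))"
      by (simp only: shift_by_apply)
  qed
qed

text \<open>
  The elements of \<^const>\<open>shift_Aut\<close>, extended by the identity outside \<open>X\<close>. They are then permutations in
  the sense of the library, with the usual composition and inverse.
\<close>

definition shiftaut :: "(int \<Rightarrow> 'a) set \<Rightarrow> int \<Rightarrow> ((int \<Rightarrow> 'a) \<Rightarrow> (int \<Rightarrow> 'a)) \<Rightarrow> bool" where
  "shiftaut X n f \<longleftrightarrow> f permutes X \<and> homeomorphic_map (shift_topology X) (shift_topology X) f \<and>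
     (\<forall>x\<in>X. f (shift_by n x) = shift_by n (f x))"

lemma inv_into_permutes:
  assumes "f permutes X" "x \<in> X" shows "inv_into X f x = inv f x"
proof (rule inv_into_f_eq)
  show "inj_on f X" using permutes_inj[OF assms(1)] inj_on_subset by blast
  show "inv f x \<in> X" using permutes_in_image[OF permutes_inv[OF assms(1)]] assms(2) by blast
  show "f (inv f x) = x" using permutes_inverses[OF assms(1)] by simp
qed

lemma pointwise_local_cong:
  assumes "\<And>x. x \<in> X \<Longrightarrow> \<phi> x = \<psi> x"
  shows "pointwise_local X \<phi> \<longleftrightarrow> pointwise_local X \<psi>"
  unfolding pointwise_local_def by (simp add: assms cong: ball_cong)

lemma pointwise_local_inv:
  assumes "f permutes X" "homeomorphic_map (shift_topology X) (shift_topology X) f"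
  shows "pointwise_local X (\<lambda>x. inv f x i)"
proof -
  have "pointwise_local X (\<lambda>x. inv_into X f x i)"
    by (rule homeomorphic_map_shift_topologyD(3)[OF assms(2)])
  moreover have "pointwise_local X (\<lambda>x. inv_into X f x i) \<longleftrightarrow> pointwise_local X (\<lambda>x. inv f x i)"
    by (rule pointwise_local_cong) (simp add: inv_into_permutes[OF assms(1)])
  ultimately show ?thesis by simp
qed

locale compact_shift =
  fixes X :: "(int \<Rightarrow> 'a) set"
  assumes compact: "compact_space (shift_topology X)"
    and shift_inX: "\<And>x n. x \<in> X \<Longrightarrow> shift_by n x \<in> X"
begin

lemma shiftaut_mult:
  assumes "shiftaut X n f" "x \<in> X" shows "f (shift_by (n * q) x) = shift_by (n * q) (f x)"
proof -
  have comm: "f (shift_by n x) = shift_by n (f x)" if "x \<in> X" for x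
    using assms(1) that unfolding shiftaut_def by simp
  show ?thesis
    by (rule shift_intertwining_mult[where h = f and a = n and b = n and X = X, OF shift_inX comm assms(2)])
qed

lemma homeomorphic_if_radius:
  assumes "f permutes X" "has_radius X f r"
  shows "homeomorphic_map (shift_topology X) (shift_topology X) f"
  by (rule homeomorphic_map_shift_topologyI[OF compact])
    (use assms permutes_imp_bij has_radius_pointwise_local in blast)+

lemma shiftaut_inv:
  assumes "shiftaut X n f" shows "shiftaut X n (inv f)"
proof -
  have f: "f permutes X" "homeomorphic_map (shift_topology X) (shift_topology X) f"
    using assms by (auto simp: shiftaut_def)
  have "homeomorphic_map (shift_topology X) (shift_topology X) (inv f)"
    by (rule homeomorphic_map_shift_topologyI[OF compact permutes_imp_bij[OF permutes_inv[OF f(1)]]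
          pointwise_local_inv[OF f]])
  moreover have "inv f (shift_by n x) = shift_by n (inv f x)" if x: "x \<in> X" for x
  proof -
    have "inv f x \<in> X" using permutes_in_image[OF permutes_inv[OF f(1)]] x by blast
    then have "f (shift_by n (inv f x)) = shift_by n x"
      using assms permutes_inverses[OF f(1)] by (simp add: shiftaut_def)
    then show ?thesis using permutes_inverses(2)[OF f(1)] by metis
  qed
  ultimately show ?thesis using permutes_inv[OF f(1)] by (simp add: shiftaut_def)
qed

lemma shiftaut_comp:
  assumes "shiftaut X n f" "shiftaut X m g" shows "shiftaut X (n * m) (f \<circ> g)"
proof -
  have "homeomorphic_map (shift_topology X) (shift_topology X) (f \<circ> g)"
    using assms homeomorphic_map_compose by (auto simp: shiftaut_def)
  moreover have "(f \<circ> g) (shift_by (n * m) x) = shift_by (n * m) ((f \<circ> g) x)" if x: "x \<in> X" for x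
  proof -
    have gX: "g x \<in> X" using permutes_in_image[of g X] assms(2) x by (auto simp: shiftaut_def)
    have "g (shift_by (n * m) x) = shift_by (n * m) (g x)"
      using shiftaut_mult[OF assms(2) x, of n] by (simp add: mult.commute)
    then show ?thesis using shiftaut_mult[OF assms(1) gX, of m] by simp
  qed
  ultimately show ?thesis
    using assms permutes_compose by (auto simp: shiftaut_def simp del: shift_by_apply)
qed

lemma shiftaut_radius:
  assumes "shiftaut X n f" "0 < n"
  shows "\<exists>r\<ge>0. has_radius X f r \<and> has_radius X (inv f) r"
proof -
  have ex: "\<exists>r\<ge>0. has_radius X f r" if "shiftaut X n f" for f
  proof (rule has_radius_exists[OF compact _ assms(2)])
    show "pointwise_local X (\<lambda>x. f x i)" for i
      using homeomorphic_map_shift_topologyD(2) that by (auto simp: shiftaut_def)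
    show "f (shift_by (n * q) x) = shift_by (n * q) (f x)" if "x \<in> X" for x q
      by (rule shiftaut_mult[OF \<open>shiftaut X n f\<close> that])
  qed (rule shift_inX)
  obtain r1 r2 where "0 \<le> r1" "has_radius X f r1" "0 \<le> r2" "has_radius X (inv f) r2"
    using ex[OF assms(1)] ex[OF shiftaut_inv[OF assms(1)]] by blast
  then show ?thesis
    by (intro exI[of _ "max r1 r2"]) (auto intro: has_radius_mono)
qed

text \<open>
  Only the finitely many coordinates between \<open>- C\<close> and \<open>C\<close> need compactness.
\<close>

lemma half_map_radius:
  assumes loc: "\<And>i. pointwise_local X (\<lambda>x. g x i)" and p: "has_radius X p r"
    and left: "\<And>x i. x \<in> X \<Longrightarrow> i \<le> - C \<Longrightarrow> g x i = p x i"
    and right: "\<And>x i. x \<in> X \<Longrightarrow> C \<le> i \<Longrightarrow> g x i = x i"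
  shows "\<exists>q. has_radius X g q"
proof -
  have "\<exists>M\<ge>0. \<forall>x\<in>X. \<forall>y\<in>X. (\<forall>j. \<bar>j\<bar> \<le> M \<longrightarrow> x j = y j) \<longrightarrow> (\<forall>i\<in>{-C..C}. g x i = g y i)"
    by (rule uniformly_local_finite[OF compact]) (use loc in auto)
  then obtain M where M: "0 \<le> M" "\<forall>x\<in>X. \<forall>y\<in>X. (\<forall>j. \<bar>j\<bar> \<le> M \<longrightarrow> x j = y j) \<longrightarrow> (\<forall>i\<in>{-C..C}. g x i = g y i)"
    by blast
  have "has_radius X g (M + \<bar>C\<bar> + \<bar>r\<bar>)"
    unfolding has_radius_def
  proof (intro ballI allI impI)
    fix x y i assume xy: "x \<in> X" "y \<in> X" and e: "\<forall>j. \<bar>j - i\<bar> \<le> M + \<bar>C\<bar> + \<bar>r\<bar> \<longrightarrow> x j = y j"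
    consider "i \<le> - C" | "C \<le> i" | "i \<in> {-C..C}" by force
    then show "g x i = g y i"
    proof cases
      case 1
      have "p x i = p y i" by (rule has_radiusD[OF p xy]) (use e M(1) in auto)
      then show ?thesis using left xy 1 by simp
    next
      case 2
      have "x i = y i" using e M(1) by simp
      then show ?thesis using right xy 2 by simp
    next
      case 3
      have "\<forall>j. \<bar>j\<bar> \<le> M \<longrightarrow> x j = y j"
      proof (intro allI impI)
        fix j assume "\<bar>j\<bar> \<le> M"
        then have "\<bar>j - i\<bar> \<le> M + \<bar>C\<bar> + \<bar>r\<bar>" using 3 by auto
        then show "x j = y j" using e by blast
      qed
      then show ?thesis using M(2) xy 3 by blast
    qed
  qed
  then show ?thesis by blast
qed

lemma cuttableI:
  assumes f: "shiftaut X n f" "0 < n"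
    and g: "g permutes X" "\<And>i. pointwise_local X (\<lambda>x. g x i)"
    and left: "\<And>x i. x \<in> X \<Longrightarrow> i \<le> - C \<Longrightarrow> g x i = f x i"
    and right: "\<And>x i. x \<in> X \<Longrightarrow> C \<le> i \<Longrightarrow> g x i = x i"
  shows "cuttable X f"
proof -
  obtain r where r: "0 \<le> r" "has_radius X f r" "has_radius X (inv f) r" using shiftaut_radius[OF f] by blast
  have fp: "f permutes X" using f by (simp add: shiftaut_def)
  have rg: "\<exists>q. has_radius X g q" by (rule half_map_radius[OF g(2) r(2) left right])
  have hg: "homeomorphic_map (shift_topology X) (shift_topology X) g"
    by (rule homeomorphic_map_shift_topologyI[OF compact permutes_imp_bij[OF g(1)] g(2)])
  have gX: "inv g x \<in> X" if "x \<in> X" for x using permutes_in_image[OF permutes_inv[OF g(1)]] that by blast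
  have fX: "f x \<in> X" if "x \<in> X" for x using permutes_in_image[OF fp] that by blast
  have "\<exists>q. has_radius X (inv g) q"
  proof (rule half_map_radius[OF pointwise_local_inv[OF g(1) hg] r(3)])
    show "inv g x i = inv f x i" if x: "x \<in> X" "i \<le> - (\<bar>C\<bar> + r)" for x i
    proof -
      have "inv f (f (inv g x)) i = inv f x i"
      proof (rule has_radiusD[OF r(3) fX[OF gX[OF x(1)]] x(1)])
        fix j assume "\<bar>j - i\<bar> \<le> r"
        then have "j \<le> - C" using x(2) by auto
        then have "g (inv g x) j = f (inv g x) j" by (rule left[OF gX[OF x(1)]])
        then show "f (inv g x) j = x j" using permutes_inverses[OF g(1)] by simp
      qed
      then show ?thesis using permutes_inverses[OF fp] by simp
    qed
    show "inv g x i = x i" if x: "x \<in> X" "\<bar>C\<bar> + r \<le> i" for x i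
    proof -
      have "C \<le> i" using x(2) r(1) by auto
      then have "g (inv g x) i = inv g x i" by (rule right[OF gX[OF x(1)]])
      then show ?thesis using permutes_inverses[OF g(1)] by simp
    qed
  qed
  then show ?thesis unfolding cuttable_def using g(1) rg left right by blast
qed

text \<open>
  Agreement of two points of the edge shift on a half line passes through the conjugacy up to a
  bounded error, so a half map on the edge shift gives one on \<open>X\<close>.
\<close>

lemma inert_cuttable:
  assumes f: "shiftaut X n f" "0 < n" and G: "fin_digraph G"
    and conj: "conjugacy (shift_topology X) (shift_by n) (shift_topology (edge_shift G)) (shift_by 1) h"
    and inert: "\<And>x. x \<in> edge_shift G \<Longrightarrow>
        beam_equiv G ((h \<circ> f \<circ> inv_into X h) ` ray G x 0) (ray G x 0)"
  shows "cuttable X f"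
proof -
  let ?Y = "edge_shift G"
  let ?TX = "shift_topology X" and ?TY = "shift_topology (edge_shift G)"
  define k where "k = inv_into X h"
  have hh: "homeomorphic_map ?TX ?TY h" and hs: "\<And>x. x \<in> X \<Longrightarrow> h (shift_by n x) = shift_by 1 (h x)"
    using conj by (simp_all add: conjugacy_def)
  have bh: "bij_betw h X ?Y" by (rule homeomorphic_map_shift_topologyD(1)[OF hh])
  have kX: "k y \<in> X" "h (k y) = y" if "y \<in> ?Y" for y
    using bh that unfolding k_def bij_betw_def by (auto simp: inv_into_into f_inv_into_f)
  have hY: "h x \<in> ?Y" "k (h x) = x" if "x \<in> X" for x
    using bh that unfolding k_def bij_betw_def by auto
  have kloc: "pointwise_local ?Y (\<lambda>y. k y i)" for i
    unfolding k_def by (rule homeomorphic_map_shift_topologyD(3)[OF hh])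
  have compY: "compact_space ?TY"
    using compact homeomorphic_compact_space homeomorphic_map_imp_homeomorphic_space[OF hh] by blast
  have hsm: "h (shift_by (n * q) x) = shift_by q (h x)" if "x \<in> X" for x q
  proof -
    have "h (shift_by (n * q) x) = shift_by (1 * q) (h x)"
      by (rule shift_intertwining_mult[where h = h and a = n and b = 1 and X = X, OF shift_inX hs that])
    then show ?thesis by (simp only: mult_1)
  qed
  have ksm: "k (shift_by q y) = shift_by (n * q) (k y)" if y: "y \<in> ?Y" for y q
  proof -
    have "h (shift_by (n * q) (k y)) = shift_by q y" using hsm[OF kX(1)[OF y]] kX(2)[OF y] by simp
    then show ?thesis using hY(2)[OF shift_inX[OF kX(1)[OF y]]] by metis
  qed
  have fp: "f permutes X" using f by (simp add: shiftaut_def)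
  have fX: "f x \<in> X" "inv f x \<in> X" if "x \<in> X" for x
    using that permutes_in_image[OF fp] permutes_in_image[OF permutes_inv[OF fp]] by auto
  have ch: "continuous_map ?TX ?TY h" by (rule homeomorphic_imp_continuous_map[OF hh])
  have ck: "continuous_map ?TY ?TX k" using kX(1) kloc by (auto simp: continuous_map_shift_topology)
  have cf: "continuous_map ?TX ?TX p" if "shiftaut X n p" for p
    using that homeomorphic_imp_continuous_map by (auto simp: shiftaut_def)
  have rad: "\<exists>r\<ge>0. has_radius ?Y (h \<circ> p \<circ> k) r" if p: "shiftaut X n p" for p
  proof (rule has_radius_exists[OF compY, of _ 1])
    have "continuous_map ?TY ?TY (h \<circ> (p \<circ> k))"
      by (rule continuous_map_compose[OF continuous_map_compose[OF ck cf[OF p]] ch])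
    then show "pointwise_local ?Y (\<lambda>y. (h \<circ> p \<circ> k) y i)" for i
      unfolding continuous_map_shift_topology comp_assoc by blast
    show "(h \<circ> p \<circ> k) (shift_by (1 * q) y) = shift_by (1 * q) ((h \<circ> p \<circ> k) y)" if y: "y \<in> ?Y" for y q
    proof -
      have "p (k y) \<in> X" using p kX(1)[OF y] permutes_in_image[of p X] by (auto simp: shiftaut_def)
      then show ?thesis
        using ksm[OF y] shiftaut_mult[OF p kX(1)[OF y]] hsm by simp
    qed
  qed (auto intro: edge_shift_shift)
  obtain r1 r2 where r12: "0 \<le> r1" "has_radius ?Y (h \<circ> f \<circ> k) r1" "0 \<le> r2" "has_radius ?Y (h \<circ> inv f \<circ> k) r2"
    using rad[OF f(1)] rad[OF shiftaut_inv[OF f(1)]] by blast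
  have "\<exists>g C. bij_betw g ?Y ?Y \<and> 0 \<le> C \<and> (\<forall>i. pointwise_local ?Y (\<lambda>x. g x i)) \<and>
    (\<forall>x\<in>?Y. (\<forall>i\<le>- C. g x i = (h \<circ> f \<circ> k) x i) \<and> (\<forall>i\<ge>C. g x i = x i))"
  proof (rule inert_half_map[OF G])
    show "has_radius ?Y (h \<circ> f \<circ> k) (max r1 r2)" using r12 has_radius_mono by fastforce
    show "has_radius ?Y (h \<circ> inv f \<circ> k) (max r1 r2)" using r12 has_radius_mono by fastforce
    show "0 \<le> max r1 r2" using r12 by simp
    show "beam_equiv G ((h \<circ> f \<circ> k) ` ray G x 0) (ray G x 0)" if "x \<in> ?Y" for x
      using inert[OF that] by (simp add: k_def)
    fix x assume x: "x \<in> ?Y"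
    show "(h \<circ> f \<circ> k) x \<in> ?Y" "(h \<circ> inv f \<circ> k) x \<in> ?Y" using x kX fX hY by simp_all
    show "(h \<circ> inv f \<circ> k) ((h \<circ> f \<circ> k) x) = x" "(h \<circ> f \<circ> k) ((h \<circ> inv f \<circ> k) x) = x"
      using kX(1)[OF x] kX(2)[OF x] hY(2) fX permutes_inverses[OF fp] by simp_all
  qed
  then obtain g' C where g': "bij_betw g' ?Y ?Y" "0 \<le> C" "\<forall>i. pointwise_local ?Y (\<lambda>x. g' x i)"
    "\<forall>x\<in>?Y. (\<forall>i\<le>- C. g' x i = (h \<circ> f \<circ> k) x i) \<and> (\<forall>i\<ge>C. g' x i = x i)" by (elim exE conjE)
  have g'Y: "g' y \<in> ?Y" if "y \<in> ?Y" for y using g'(1) that bij_betwE by blast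
  define g where "g x = (if x \<in> X then k (g' (h x)) else x)" for x
  have gx: "g x = (k \<circ> (g' \<circ> h)) x" if "x \<in> X" for x using that by (simp add: g_def)
  have bk: "bij_betw k ?Y X" unfolding k_def by (rule bij_betw_inv_into[OF bh])
  have "bij_betw (k \<circ> (g' \<circ> h)) X X"
    by (rule bij_betw_trans[OF bij_betw_trans[OF bh g'(1)] bk])
  then have "bij_betw g X X" using gx bij_betw_cong[of X g "k \<circ> (g' \<circ> h)" X] by blast
  then have gp: "g permutes X" by (rule bij_imp_permutes) (simp add: g_def)
  have cg: "continuous_map ?TX ?TX (k \<circ> (g' \<circ> h))"
  proof (rule continuous_map_compose[OF continuous_map_compose[OF ch] ck])
    show "continuous_map ?TY ?TY g'" using g'Y g'(3) by (auto simp: continuous_map_shift_topology)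
  qed
  have gloc: "pointwise_local X (\<lambda>x. g x i)" for i
  proof -
    have "pointwise_local X (\<lambda>x. (k \<circ> (g' \<circ> h)) x i)" using cg unfolding continuous_map_shift_topology by blast
    moreover have "pointwise_local X (\<lambda>x. (k \<circ> (g' \<circ> h)) x i) \<longleftrightarrow> pointwise_local X (\<lambda>x. g x i)"
      by (rule pointwise_local_cong) (simp add: g_def)
    ultimately show ?thesis by simp
  qed
  have "\<exists>M\<ge>0. \<forall>x\<in>?Y. \<forall>y\<in>?Y. \<forall>q. (\<forall>j. \<bar>j - 1 * q\<bar> \<le> M \<longrightarrow> x j = y j) \<longrightarrow>
     (\<forall>i. n * q \<le> i \<and> i < n * q + n \<longrightarrow> k x i = k y i)"
    by (rule shift_equivariant_locality[OF compY kloc f(2)])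
      (simp_all only: mult_1 ksm edge_shift_shift)
  then obtain M where M: "0 \<le> M" "\<forall>x\<in>?Y. \<forall>y\<in>?Y. \<forall>q. (\<forall>j. \<bar>j - 1 * q\<bar> \<le> M \<longrightarrow> x j = y j) \<longrightarrow>
     (\<forall>i. n * q \<le> i \<and> i < n * q + n \<longrightarrow> k x i = k y i)" by blast
  have kloc': "k y i = k z i" if "y \<in> ?Y" "z \<in> ?Y" "\<forall>j. \<bar>j - i div n\<bar> \<le> M \<longrightarrow> y j = z j" for y z i
  proof -
    have "n * (i div n) + i mod n = i" by simp
    then have "n * (i div n) \<le> i \<and> i < n * (i div n) + n"
      using f(2) pos_mod_sign[of n i] pos_mod_bound[of n i] by linarith
    moreover have "\<forall>j. \<bar>j - 1 * (i div n)\<bar> \<le> M \<longrightarrow> y j = z j" using that(3) by simp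
    ultimately show ?thesis using M(2) that(1,2) by blast
  qed
  show ?thesis
  proof (rule cuttableI[OF f gp gloc])
    fix x i assume x: "x \<in> X"
    note Y = hY(1)[OF x] g'Y[OF hY(1)[OF x]]
    show "g x i = f x i" if i: "i \<le> - (n * (C + M))"
    proof -
      have "i \<le> n * (- (C + M))" using i by (simp only: mult_minus_right)
      from zdiv_mono1[OF this f(2)] have d: "i div n \<le> - (C + M)"
        using nonzero_mult_div_cancel_left[of n "- (C + M)"] f(2) by linarith
      have "k (g' (h x)) i = k ((h \<circ> f \<circ> k) (h x)) i"
      proof (rule kloc'[OF Y(2)])
        show "(h \<circ> f \<circ> k) (h x) \<in> ?Y" using x hY fX by simp
        show "\<forall>j. \<bar>j - i div n\<bar> \<le> M \<longrightarrow> g' (h x) j = (h \<circ> f \<circ> k) (h x) j"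
        proof (intro allI impI)
          fix j assume "\<bar>j - i div n\<bar> \<le> M"
          then have "j \<le> - C" using d by linarith
          then show "g' (h x) j = (h \<circ> f \<circ> k) (h x) j" using g'(4) Y(1) by blast
        qed
      qed
      then show ?thesis using x hY fX by (simp add: g_def)
    qed
    show "g x i = x i" if i: "n * (C + M) \<le> i"
    proof -
      have "(n * (C + M)) div n \<le> i div n" using i f(2) by (intro zdiv_mono1) auto
      then have d: "C + M \<le> i div n" using f(2) by simp
      have "k (g' (h x)) i = k (h x) i"
      proof (rule kloc'[OF Y(2,1)], intro allI impI)
        fix j assume "\<bar>j - i div n\<bar> \<le> M"
        then have "C \<le> j" using d by linarith
        then show "g' (h x) j = h x j" using g'(4) Y(1) by blast
      qed
      then show ?thesis using x hY by (simp add: g_def)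
    qed
  qed
qed

lemma cuttable_comp:
  assumes f: "shiftaut X n f" "0 < n" "cuttable X f" and f': "shiftaut X n' f'" "0 < n'" "cuttable X f'"
  shows "cuttable X (f \<circ> f')"
proof -
  obtain g C where g: "g permutes X" "\<exists>q. has_radius X g q" "\<forall>x\<in>X. (\<forall>i\<le>- C. g x i = f x i) \<and> (\<forall>i\<ge>C. g x i = x i)"
    using f(3) unfolding cuttable_def by blast
  obtain g' C' where g': "g' permutes X" "\<exists>q. has_radius X g' q" "\<forall>x\<in>X. (\<forall>i\<le>- C'. g' x i = f' x i) \<and> (\<forall>i\<ge>C'. g' x i = x i)"
    using f'(3) unfolding cuttable_def by blast
  obtain r where r: "0 \<le> r" "has_radius X f r" using shiftaut_radius[OF f(1,2)] by blast
  have g'X: "g' x \<in> X" if "x \<in> X" for x using permutes_in_image[OF g'(1)] that by blast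
  have f'X: "f' x \<in> X" if "x \<in> X" for x using permutes_in_image[of f' X] f'(1) that by (auto simp: shiftaut_def)
  obtain q q' where q: "has_radius X g q" "has_radius X g' q'" using g(2) g'(2) by blast
  have gg: "has_radius X (g \<circ> g') (q + q')" by (rule has_radius_comp[OF q g'X])
  show ?thesis
  proof (rule cuttableI[OF shiftaut_comp[OF f(1) f'(1)] _ permutes_compose[OF g'(1) g(1)]
        has_radius_pointwise_local[OF gg]])
    show "0 < n * n'" using f(2) f'(2) by simp
    fix x i assume x: "x \<in> X"
    show "(g \<circ> g') x i = (f \<circ> f') x i" if i: "i \<le> - (\<bar>C\<bar> + \<bar>C'\<bar> + r)"
    proof -
      have "g (g' x) i = f (g' x) i"
      proof -
        have "i \<le> - C" using i r(1) by linarith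
        then show ?thesis using g(3) g'X[OF x] by blast
      qed
      also have "\<dots> = f (f' x) i"
      proof (rule has_radiusD[OF r(2) g'X[OF x] f'X[OF x]])
        fix j assume "\<bar>j - i\<bar> \<le> r"
        then have "j \<le> - C'" using i by linarith
        then show "g' x j = f' x j" using g'(3) x by blast
      qed
      finally show ?thesis by simp
    qed
    show "(g \<circ> g') x i = x i" if i: "\<bar>C\<bar> + \<bar>C'\<bar> + r \<le> i"
    proof -
      have "C \<le> i" "C' \<le> i" using i r(1) by linarith+
      then have "g (g' x) i = g' x i" "g' x i = x i" using g(3) g'(3) g'X[OF x] x by blast+
      then show ?thesis by simp
    qed
  qed
qed

lemma cuttable_inv:
  assumes f: "shiftaut X n f" "0 < n" "cuttable X f"
  shows "cuttable X (inv f)"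
proof -
  obtain g C where g: "g permutes X" "\<exists>q. has_radius X (inv g) q" "\<forall>x\<in>X. (\<forall>i\<le>- C. g x i = f x i) \<and> (\<forall>i\<ge>C. g x i = x i)"
    using f(3) unfolding cuttable_def by blast
  obtain r where r: "0 \<le> r" "has_radius X (inv f) r" using shiftaut_radius[OF f(1,2)] by blast
  obtain q where q: "has_radius X (inv g) q" using g(2) by blast
  have fp: "f permutes X" using f by (simp add: shiftaut_def)
  have gX: "inv g x \<in> X" if "x \<in> X" for x using permutes_in_image[OF permutes_inv[OF g(1)]] that by blast
  have fX: "f x \<in> X" if "x \<in> X" for x using permutes_in_image[OF fp] that by blast
  show ?thesis
  proof (rule cuttableI[OF shiftaut_inv[OF f(1)] f(2) permutes_inv[OF g(1)] has_radius_pointwise_local[OF q]])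
    fix x i assume x: "x \<in> X"
    show "inv g x i = inv f x i" if i: "i \<le> - (\<bar>C\<bar> + r)"
    proof -
      have "inv f (f (inv g x)) i = inv f x i"
      proof (rule has_radiusD[OF r(2) fX[OF gX[OF x]] x])
        fix j assume "\<bar>j - i\<bar> \<le> r"
        then have "j \<le> - C" using i by linarith
        then have "g (inv g x) j = f (inv g x) j" using g(3) gX[OF x] by blast
        then show "f (inv g x) j = x j" using permutes_inverses[OF g(1)] by simp
      qed
      then show ?thesis using permutes_inverses[OF fp] by simp
    qed
    show "inv g x i = x i" if i: "\<bar>C\<bar> + r \<le> i"
    proof -
      have "C \<le> i" using i r(1) by linarith
      then have "g (inv g x) i = inv g x i" using g(3) gX[OF x] by blast
      then show ?thesis using permutes_inverses[OF g(1)] by simp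
    qed
  qed
qed

text \<open>
  Conjugating a half map of \<open>f\<close> gives a half map of the conjugate, with both ends moved by the
  radius of \<open>a\<close>.
\<close>

lemma cuttable_conj:
  assumes f: "shiftaut X n f" "0 < n" "cuttable X f" and a: "shiftaut X n' a" "0 < n'"
  shows "cuttable X (a \<circ> f \<circ> inv a)"
proof -
  obtain g C where g: "g permutes X" "\<exists>q. has_radius X g q" "\<forall>x\<in>X. (\<forall>i\<le>- C. g x i = f x i) \<and> (\<forall>i\<ge>C. g x i = x i)"
    using f(3) unfolding cuttable_def by blast
  obtain r where r: "0 \<le> r" "has_radius X a r" "has_radius X (inv a) r" using shiftaut_radius[OF a] by blast
  obtain q where q: "has_radius X g q" using g(2) by blast
  have ap: "a permutes X" using a by (simp add: shiftaut_def)
  have fp: "f permutes X" using f by (simp add: shiftaut_def)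
  have gX: "g x \<in> X" if "x \<in> X" for x using permutes_in_image[OF g(1)] that by blast
  have fX: "f x \<in> X" if "x \<in> X" for x using permutes_in_image[OF fp] that by blast
  have aX: "inv a x \<in> X" if "x \<in> X" for x using permutes_in_image[OF permutes_inv[OF ap]] that by blast
  have rad: "has_radius X (a \<circ> (g \<circ> inv a)) (r + (q + r))"
    by (rule has_radius_comp[OF r(2) has_radius_comp[OF q r(3) aX]]) (simp_all add: gX aX)
  have perm: "a \<circ> (g \<circ> inv a) permutes X"
    by (rule permutes_compose[OF permutes_compose[OF permutes_inv[OF ap] g(1)] ap])
  have "cuttable X (a \<circ> (f \<circ> inv a))"
  proof (rule cuttableI[OF shiftaut_comp[OF a(1) shiftaut_comp[OF f(1) shiftaut_inv[OF a(1)]]] _ perm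
        has_radius_pointwise_local[OF rad]])
    show "0 < n' * (n * n')" using f(2) a(2) by simp
    fix x i assume x: "x \<in> X"
    note iX = aX[OF x]
    show "(a \<circ> (g \<circ> inv a)) x i = (a \<circ> (f \<circ> inv a)) x i" if i: "i \<le> - (C + r)"
    proof -
      have "a (g (inv a x)) i = a (f (inv a x)) i"
      proof (rule has_radiusD[OF r(2) gX[OF iX] fX[OF iX]])
        fix j assume "\<bar>j - i\<bar> \<le> r"
        then have "j \<le> - C" using i by linarith
        then show "g (inv a x) j = f (inv a x) j" using g(3) iX by blast
      qed
      then show ?thesis by simp
    qed
    show "(a \<circ> (g \<circ> inv a)) x i = x i" if i: "C + r \<le> i"
    proof -
      have "a (g (inv a x)) i = a (inv a x) i"
      proof (rule has_radiusD[OF r(2) gX[OF iX] iX])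
        fix j assume "\<bar>j - i\<bar> \<le> r"
        then have "C \<le> j" using i by linarith
        then show "g (inv a x) j = inv a x j" using g(3) iX by blast
      qed
      then show ?thesis using permutes_inverses[OF ap] by simp
    qed
  qed
  then show ?thesis by (simp add: comp_assoc)
qed

end

section \<open>Lattices of gates are inert\<close>

text \<open>
  Such an automorphism permutes the \<open>m\<close>-rays and keeps the vertices at which they end, so it does not
  even change the vector of a beam.
\<close>

lemma inert_if_permutes_edges:
  assumes bij: "bij_betw f (edge_shift G) (edge_shift G)"
    and block: "\<And>p q i. p \<in> edge_shift G \<Longrightarrow> q \<in> edge_shift G \<Longrightarrow> f p i = f q i \<longleftrightarrow> p i = q i"
    and head: "\<And>p i. p \<in> edge_shift G \<Longrightarrow> head G (f p i) = head G (p i)"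
  shows "inert_on_edge_shift G f"
  unfolding inert_on_edge_shift_def
proof (intro allI impI)
  let ?Y = "edge_shift G"
  fix U assume "is_beam G U"
  then obtain m F where F: "finite F" "F \<subseteq> ?Y" "U = (\<Union>x\<in>F. ray G x m)"
    unfolding is_beam_def is_beam_at_def by blast
  have fY: "f p \<in> ?Y" if "p \<in> ?Y" for p using bij that bij_betwE by blast
  have inj: "inj_on f ?Y" using bij by (simp add: bij_betw_def)
  have sur: "\<exists>q\<in>?Y. f q = p" if "p \<in> ?Y" for p using bij that unfolding bij_betw_def by (metis imageE)
  have rayY: "ray G p m \<subseteq> ?Y" for p by (auto simp: ray_def)
  have img: "f ` ray G p m = ray G (f p) m" if p: "p \<in> ?Y" for p
  proof
    show "f ` ray G p m \<subseteq> ray G (f p) m"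
      using block[OF _ p] fY by (auto simp: ray_def)
    show "ray G (f p) m \<subseteq> f ` ray G p m"
    proof
      fix y assume y: "y \<in> ray G (f p) m"
      then obtain q where q: "q \<in> ?Y" "f q = y" using sur by (auto simp: ray_def)
      have "\<forall>i\<le>m. q i = p i" using y block[OF q(1) p] q(2) by (simp add: ray_def)
      then have "q \<in> ray G p m" using q(1) by (simp add: ray_def)
      then show "y \<in> f ` ray G p m" using q(2) by blast
    qed
  qed
  have b1: "is_beam_at G m U" unfolding is_beam_at_def using F by blast
  have "f ` U = (\<Union>x\<in>F. f ` ray G x m)" unfolding F(3) by (rule image_UN)
  also have "\<dots> = (\<Union>x\<in>F. ray G (f x) m)" by (rule SUP_cong[OF refl]) (use img F(2) in blast)
  also have "\<dots> = (\<Union>x\<in>f ` F. ray G x m)" by simp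
  finally have b2: "is_beam_at G m (f ` U)"
    unfolding is_beam_at_def using F fY by (intro exI[of _ "f ` F"]) auto
  have UY: "U \<subseteq> ?Y" using beam_rays(2)[OF b1] .
  have "rays_to G (f ` U) m v = (\<lambda>R. f ` R) ` rays_to G U m v" for v
  proof
    show "(\<lambda>R. f ` R) ` rays_to G U m v \<subseteq> rays_to G (f ` U) m v"
    proof
      fix R' assume "R' \<in> (\<lambda>R. f ` R) ` rays_to G U m v"
      then obtain x where x: "R' = f ` ray G x m" "x \<in> ?Y" "ray G x m \<subseteq> U" "head G (x m) = v"
        unfolding rays_to_def by blast
      have "R' = ray G (f x) m" using x(1) img[OF x(2)] by simp
      moreover have "ray G (f x) m \<subseteq> f ` U" using image_mono[OF x(3), of f] img[OF x(2)] by simp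
      moreover have "head G (f x m) = v" using head[OF x(2)] x(4) by simp
      ultimately show "R' \<in> rays_to G (f ` U) m v" unfolding rays_to_def using fY[OF x(2)] by blast
    qed
    show "rays_to G (f ` U) m v \<subseteq> (\<lambda>R. f ` R) ` rays_to G U m v"
    proof
      fix R' assume "R' \<in> rays_to G (f ` U) m v"
      then obtain y where y: "R' = ray G y m" "y \<in> ?Y" "ray G y m \<subseteq> f ` U" "head G (y m) = v"
        unfolding rays_to_def by blast
      obtain x where x: "x \<in> ?Y" "f x = y" using sur[OF y(2)] by blast
      have e: "R' = f ` ray G x m" using img[OF x(1)] x(2) y(1) by simp
      then have "f ` ray G x m \<subseteq> f ` U" using y(1,3) by simp
      then have "ray G x m \<subseteq> U" using inj_on_image_subset_iff[OF inj rayY UY] by blast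
      moreover have "head G (x m) = v" using head[OF x(1), of m] x(2) y(4) by simp
      ultimately have "ray G x m \<in> rays_to G U m v" unfolding rays_to_def using x(1) by blast
      then show "R' \<in> (\<lambda>R. f ` R) ` rays_to G U m v" using e by blast
    qed
  qed
  moreover have "inj_on (\<lambda>R. f ` R) (rays_to G U m v)" for v
  proof (rule inj_onI)
    fix R R' assume "R \<in> rays_to G U m v" "R' \<in> rays_to G U m v" "f ` R = f ` R'"
    then show "R = R'" using inj_on_image_eq_iff[OF inj] rayY unfolding rays_to_def by blast
  qed
  ultimately have "card (rays_to G (f ` U) m v) = card (rays_to G U m v)" for v
    by (simp add: card_image)
  then have "beam_vector G (f ` U) m v = beam_vector G U m v" for v
    unfolding beam_vector_def rays_to_def by simp
  then show "beam_equiv G (f ` U) U" unfolding beam_equiv_def using b1 b2 by blast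
qed

context local_shift
begin

definition prefix :: "int \<Rightarrow> (int \<Rightarrow> 'a) \<Rightarrow> int \<Rightarrow> 'a" where
  "prefix L x = restrict x {0..<L}"

lemma prefix_eq_iff: "prefix L x = prefix L y \<longleftrightarrow> (\<forall>i. 0 \<le> i \<longrightarrow> i < L \<longrightarrow> x i = y i)"
  unfolding prefix_def by (auto simp: fun_eq_iff restrict_def)

lemma prefix_prefix: "L \<le> L' \<Longrightarrow> prefix L (prefix L' x) = prefix L x"
  unfolding prefix_eq_iff by (simp add: prefix_def)

lemma prefix_shift_prefix:
  "0 \<le> k \<Longrightarrow> k + L \<le> L' \<Longrightarrow> prefix L (shift_by k (prefix L' x)) = prefix L (shift_by k x)"
  unfolding prefix_eq_iff by (simp add: prefix_def)

text \<open>
  Vertices and edges of the graph are to be natural numbers, so words are numbered. The functions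
  below are injective because there are finitely many words.
\<close>

definition vcode :: "(int \<Rightarrow> 'a) \<Rightarrow> nat" where
  "vcode = to_nat_on (prefix w ` X)"

definition ecode :: "int \<Rightarrow> (int \<Rightarrow> 'a) \<Rightarrow> nat" where
  "ecode k = to_nat_on (prefix (k + w) ` X)"

definition edecode :: "int \<Rightarrow> nat \<Rightarrow> (int \<Rightarrow> 'a)" where
  "edecode k = inv_into (prefix (k + w) ` X) (ecode k)"

text \<open>
  The higher block graph of \<open>(X, \<sigma>\<^sup>k)\<close>: an edge is a word of length \<open>k + w\<close>, from its first \<open>w\<close> symbols to
  its last \<open>w\<close> symbols.
\<close>

definition block_graph :: "int \<Rightarrow> (nat, nat) pre_digraph" where
  "block_graph k = \<lparr>verts = vcode ` prefix w ` X, arcs = ecode k ` prefix (k + w) ` X,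
     tail = (\<lambda>e. vcode (prefix w (edecode k e))),
     head = (\<lambda>e. vcode (prefix w (shift_by k (edecode k e))))\<rparr>"

definition block_code :: "int \<Rightarrow> int \<Rightarrow> (int \<Rightarrow> 'a) \<Rightarrow> int \<Rightarrow> nat" where
  "block_code s k x = (\<lambda>j. ecode k (prefix (k + w) (shift_by (s + k * j) x)))"

end

context finite_alphabet_shift
begin

lemma finite_prefixes: "finite (prefix L ` X)"
proof (rule finite_subset)
  show "prefix L ` X \<subseteq> {0..<L} \<rightarrow>\<^sub>E A" using alphabet by (auto simp: prefix_def)
qed (use finite_A in \<open>auto intro: finite_PiE\<close>)

lemma vcode_eq_iff: "x \<in> X \<Longrightarrow> y \<in> X \<Longrightarrow> vcode (prefix w x) = vcode (prefix w y) \<longleftrightarrow> prefix w x = prefix w y"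
  unfolding vcode_def
  by (rule inj_on_eq_iff[OF inj_on_to_nat_on[OF countable_finite[OF finite_prefixes]]]) auto

lemma inj_ecode: "inj_on (ecode k) (prefix (k + w) ` X)"
  unfolding ecode_def by (rule inj_on_to_nat_on[OF countable_finite[OF finite_prefixes]])

lemma ecode_eq_iff:
  "x \<in> X \<Longrightarrow> y \<in> X \<Longrightarrow> ecode k (prefix (k + w) x) = ecode k (prefix (k + w) y) \<longleftrightarrow> prefix (k + w) x = prefix (k + w) y"
  by (rule inj_on_eq_iff[OF inj_ecode]) auto

lemma edecode: "x \<in> X \<Longrightarrow> edecode k (ecode k (prefix (k + w) x)) = prefix (k + w) x"
  unfolding edecode_def by (rule inv_into_f_f[OF inj_ecode]) simp

lemma block_graph_simps:
  assumes "0 < k" "x \<in> X"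
  shows "ecode k (prefix (k + w) x) \<in> arcs (block_graph k)"
    "tail (block_graph k) (ecode k (prefix (k + w) x)) = vcode (prefix w x)"
    "head (block_graph k) (ecode k (prefix (k + w) x)) = vcode (prefix w (shift_by k x))"
proof -
  show "ecode k (prefix (k + w) x) \<in> arcs (block_graph k)" using assms by (simp add: block_graph_def)
  show "tail (block_graph k) (ecode k (prefix (k + w) x)) = vcode (prefix w x)"
    using assms by (simp add: block_graph_def edecode prefix_prefix)
  show "head (block_graph k) (ecode k (prefix (k + w) x)) = vcode (prefix w (shift_by k x))"
    using assms prefix_shift_prefix[of k w "k + w" x] by (simp add: block_graph_def edecode)
qed

lemma arcs_block_graph:
  assumes "e \<in> arcs (block_graph k)" obtains x where "x \<in> X" "e = ecode k (prefix (k + w) x)"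
  using assms by (auto simp: block_graph_def)

lemma verts_block_graph:
  assumes "v \<in> verts (block_graph k)" obtains x where "x \<in> X" "v = vcode (prefix w x)"
  using assms by (auto simp: block_graph_def)

lemma essential_block_graph:
  assumes k: "0 < k" shows "essential_graph (block_graph k)"
proof -
  let ?G = "block_graph k"
  have vin: "vcode (prefix w x) \<in> verts ?G" if "x \<in> X" for x using that by (simp add: block_graph_def)
  have fin: "fin_digraph ?G"
  proof
    show "finite (verts ?G)" "finite (arcs ?G)" using finite_prefixes by (simp_all add: block_graph_def)
    fix e assume "e \<in> arcs ?G"
    then obtain x where x: "x \<in> X" "e = ecode k (prefix (k + w) x)" by (rule arcs_block_graph)
    show "tail ?G e \<in> verts ?G" "head ?G e \<in> verts ?G"
      unfolding x(2) block_graph_simps[OF k x(1)] using vin x(1) shift_in by blast+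
  qed
  then interpret fin_digraph ?G .
  have "in_degree ?G v > 0 \<and> out_degree ?G v > 0" if v: "v \<in> verts ?G" for v
  proof -
    obtain x where x: "x \<in> X" "v = vcode (prefix w x)" using v by (rule verts_block_graph)
    have x': "shift_by (- k) x \<in> X" using x(1) by (rule shift_in)
    have "ecode k (prefix (k + w) x) \<in> out_arcs ?G v"
      using block_graph_simps[OF k x(1)] x(2) by (simp add: out_arcs_def)
    moreover have "ecode k (prefix (k + w) (shift_by (- k) x)) \<in> in_arcs ?G v"
      using block_graph_simps[OF k x'] x(2) by (simp add: in_arcs_def)
    ultimately show ?thesis unfolding in_degree_def out_degree_def
      by (auto simp: card_gt_0_iff)
  qed
  then show ?thesis using fin by (simp add: essential_graph_def)
qed

lemma block_code_edge_shift:
  assumes k: "0 < k" and x: "x \<in> X" shows "block_code s k x \<in> edge_shift (block_graph k)"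
  unfolding edge_shift_def
proof (intro CollectI allI conjI)
  fix n
  have X: "shift_by (s + k * n) x \<in> X" "shift_by (s + k * (n + 1)) x \<in> X" using x by (rule shift_in)+
  show "block_code s k x n \<in> arcs (block_graph k)"
    unfolding block_code_def by (rule block_graph_simps(1)[OF k X(1)])
  have "shift_by k (shift_by (s + k * n) x) = shift_by (s + k * (n + 1)) x"
  proof -
    have "k + (s + k * n) = s + k * (n + 1)" by (simp add: algebra_simps)
    then show ?thesis by (simp only: shift_by_shift_by)
  qed
  then show "head (block_graph k) (block_code s k x n) = tail (block_graph k) (block_code s k x (n + 1))"
    unfolding block_code_def block_graph_simps(3)[OF k X(1)] block_graph_simps(2)[OF k X(2)] by (simp only:)
qed

lemma block_code_eq_iff:
  assumes "x \<in> X" "y \<in> X"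
  shows "block_code s k x j = block_code s k y j \<longleftrightarrow>
     (\<forall>i. s \<le> i \<longrightarrow> i < s + k + w \<longrightarrow> x (i + k * j) = y (i + k * j))"
proof -
  have "block_code s k x j = block_code s k y j \<longleftrightarrow>
     prefix (k + w) (shift_by (s + k * j) x) = prefix (k + w) (shift_by (s + k * j) y)"
    unfolding block_code_def using assms by (intro ecode_eq_iff) simp_all
  also have "\<dots> \<longleftrightarrow> (\<forall>i. 0 \<le> i \<longrightarrow> i < k + w \<longrightarrow> x (i + (s + k * j)) = y (i + (s + k * j)))"
    by (simp add: prefix_eq_iff)
  also have "\<dots> \<longleftrightarrow> (\<forall>i. s \<le> i \<longrightarrow> i < s + k + w \<longrightarrow> x (i + k * j) = y (i + k * j))"
  proof (intro iffI allI impI)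
    fix i assume a: "\<forall>i. 0 \<le> i \<longrightarrow> i < k + w \<longrightarrow> x (i + (s + k * j)) = y (i + (s + k * j))" "s \<le> i" "i < s + k + w"
    have "0 \<le> i - s" "i - s < k + w" using a(2,3) by auto
    then have "x ((i - s) + (s + k * j)) = y ((i - s) + (s + k * j))" using a(1) by blast
    moreover have "(i - s) + (s + k * j) = i + k * j" by simp
    ultimately show "x (i + k * j) = y (i + k * j)" by (simp only:)
  next
    fix i assume a: "\<forall>i. s \<le> i \<longrightarrow> i < s + k + w \<longrightarrow> x (i + k * j) = y (i + k * j)" "0 \<le> i" "i < k + w"
    have "s \<le> i + s" "i + s < s + k + w" using a(2,3) by auto
    then have "x ((i + s) + k * j) = y ((i + s) + k * j)" using a(1) by blast
    then show "x (i + (s + k * j)) = y (i + (s + k * j))" by (simp only: add.assoc)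
  qed
  finally show ?thesis .
qed

text \<open>
  Surjectivity is where membership in \<open>X\<close> is tested on windows: consecutive edges of a path overlap
  in \<open>w\<close> symbols, so every window of length \<open>w + 1\<close> of the assembled configuration lies in one edge.
\<close>

lemma block_code_bij:
  assumes k: "w \<le> k" shows "bij_betw (block_code s k) X (edge_shift (block_graph k))"
  unfolding bij_betw_def
proof
  have kpos: "0 < k" using k w_pos by simp
  show "inj_on (block_code s k) X"
  proof (rule inj_onI)
    fix x y assume xy: "x \<in> X" "y \<in> X" "block_code s k x = block_code s k y"
    have "x n = y n" for n
    proof -
      obtain i j where ij: "n = i + k * j" "s \<le> i" "i < s + k" using block_position[OF kpos, of n s] by blast
      have "block_code s k x j = block_code s k y j" using xy(3) by simp
      then show ?thesis using block_code_eq_iff[OF xy(1,2)] ij w_pos by simp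
    qed
    then show "x = y" by blast
  qed
  show "block_code s k ` X = edge_shift (block_graph k)"
  proof
    show "block_code s k ` X \<subseteq> edge_shift (block_graph k)" using block_code_edge_shift[OF kpos] by blast
    show "edge_shift (block_graph k) \<subseteq> block_code s k ` X"
    proof
      fix p assume p: "p \<in> edge_shift (block_graph k)"
      have "\<forall>j. \<exists>y. y \<in> X \<and> p j = ecode k (prefix (k + w) y)"
      proof
        fix j
        have "p j \<in> arcs (block_graph k)" using p by (simp add: edge_shift_def)
        then show "\<exists>y. y \<in> X \<and> p j = ecode k (prefix (k + w) y)" using arcs_block_graph by metis
      qed
      from choice[OF this] obtain y where y: "\<forall>j. y j \<in> X \<and> p j = ecode k (prefix (k + w) (y j))" by blast
      have overlap: "y j (i + k) = y (j + 1) i" if i: "0 \<le> i" "i < w" for i j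
      proof -
        have "head (block_graph k) (p j) = tail (block_graph k) (p (j + 1))" using p by (simp add: edge_shift_def)
        then have "vcode (prefix w (shift_by k (y j))) = vcode (prefix w (y (j + 1)))"
          using y block_graph_simps[OF kpos, of "y j"] block_graph_simps[OF kpos, of "y (j + 1)"] by simp
        then have "prefix w (shift_by k (y j)) = prefix w (y (j + 1))"
          using vcode_eq_iff[of "shift_by k (y j)" "y (j + 1)"] y by simp
        then show ?thesis using i by (simp add: prefix_eq_iff)
      qed
      define x where "x n = y ((n - s) div k) ((n - s) mod k)" for n
      have x1: "x (s + k * j + i) = y j i" if i: "0 \<le> i" "i < k" for i j
      proof -
        have "(s + k * j + i - s) div k = j" "(s + k * j + i - s) mod k = i" using i by simp_all
        then show ?thesis by (simp only: x_def)
      qed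
      have x2: "x (s + k * j + i) = y j i" if i: "0 \<le> i" "i < k + w" for i j
      proof (cases "i < k")
        case True
        then show ?thesis using x1 i by simp
      next
        case False
        have "x (s + k * (j + 1) + (i - k)) = y (j + 1) (i - k)" using x1[of "i - k" "j + 1"] False i k by simp
        moreover have "s + k * (j + 1) + (i - k) = s + k * j + i" by (simp add: algebra_simps)
        moreover have "y (j + 1) (i - k) = y j i" using overlap[of "i - k" j] False i by simp
        ultimately show ?thesis by (simp only:)
      qed
      have xX: "x \<in> X"
      proof (rule local)
        fix n
        obtain i0 j where ij: "n = i0 + k * j" "s \<le> i0" "i0 < s + k" using block_position[OF kpos, of n s] by blast
        have "shift_by (- (s + k * j)) (y j) m = x m" if m: "n \<le> m \<and> m \<le> n + w" for m
        proof -
          have "x (s + k * j + (m + - (s + k * j))) = y j (m + - (s + k * j))"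
            by (rule x2) (use m ij in auto)
          moreover have "s + k * j + (m + - (s + k * j)) = m" by simp
          ultimately show ?thesis by (simp only: shift_by_apply)
        qed
        moreover have "shift_by (- (s + k * j)) (y j) \<in> X" using y shift_in by blast
        ultimately show "\<exists>z\<in>X. \<forall>m. n \<le> m \<and> m \<le> n + w \<longrightarrow> z m = x m" by blast
      qed
      have pj: "block_code s k x j = p j" for j
      proof -
        have "prefix (k + w) (shift_by (s + k * j) x) = prefix (k + w) (y j)"
          unfolding prefix_eq_iff using x2[of _ j] by (simp add: add.commute)
        then show ?thesis using y by (simp add: block_code_def)
      qed
      have "block_code s k x = p" using pj by (rule ext)
      then show "p \<in> block_code s k ` X" using xX by blast
    qed
  qed
qed

lemma block_code_conjugacy:
  assumes k: "w \<le> k" and comp: "compact_space (shift_topology X)"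
  shows "conjugacy (shift_topology X) (shift_by k) (shift_topology (edge_shift (block_graph k))) (shift_by 1) (block_code s k)"
  unfolding conjugacy_def
proof
  show "homeomorphic_map (shift_topology X) (shift_topology (edge_shift (block_graph k))) (block_code s k)"
  proof (rule homeomorphic_map_shift_topologyI[OF comp block_code_bij[OF k]])
    fix j
    show "pointwise_local X (\<lambda>x. block_code s k x j)"
      unfolding pointwise_local_def
    proof
      fix x assume x: "x \<in> X"
      have "block_code s k y j = block_code s k x j"
        if y: "y \<in> X" "\<forall>i. \<bar>i\<bar> \<le> \<bar>s\<bar> + \<bar>k * j\<bar> + k + w \<longrightarrow> y i = x i" for y
        unfolding block_code_eq_iff[OF y(1) x]
      proof (intro allI impI)
        fix i assume "s \<le> i" "i < s + k + w"
        then have "\<bar>i + k * j\<bar> \<le> \<bar>s\<bar> + \<bar>k * j\<bar> + k + w" using k w_pos by linarith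
        then show "y (i + k * j) = x (i + k * j)" using y(2) by blast
      qed
      then show "\<exists>M. \<forall>y\<in>X. (\<forall>i. \<bar>i\<bar> \<le> M \<longrightarrow> y i = x i) \<longrightarrow> block_code s k y j = block_code s k x j" by blast
    qed
  qed
  have "block_code s k (shift_by k x) j = shift_by 1 (block_code s k x) j" for x j
  proof -
    have "s + k * j + k = s + k * (j + 1)" by (simp add: algebra_simps)
    then show ?thesis by (simp only: block_code_def shift_by_shift_by shift_by_apply)
  qed
  then show "\<forall>x\<in>topspace (shift_topology X). block_code s k (shift_by k x) = shift_by 1 (block_code s k x)" by blast
qed

text \<open>
  Aligning the blocks with the window of the gate, the lattice permutes the words of length \<open>k + w\<close>
  of each block separately and fixes the overlaps with the next blocks.
\<close>

theorem lattice_inert: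
  assumes P: "gate s t P" "t - s \<le> k" and comp: "compact_space (shift_topology X)"
    and F: "\<And>x. x \<in> X \<Longrightarrow> F x = lattice k P x"
  shows "\<exists>(G :: (nat, nat) pre_digraph) h. essential_graph G \<and>
     conjugacy (shift_topology X) (shift_by k) (shift_topology (edge_shift G)) (shift_by 1) h \<and>
     inert_on_edge_shift G (h \<circ> F \<circ> inv_into X h)"
proof -
  have k: "w \<le> k" "0 < k" using period_pos[OF P] w_pos by auto
  define h where "h = block_code s k"
  let ?G = "block_graph k"
  let ?f = "h \<circ> F \<circ> inv_into X h"
  have bh: "bij_betw h X (edge_shift ?G)" unfolding h_def by (rule block_code_bij[OF k(1)])
  have F_perm: "lattice k P permutes X" by (rule lattice_permutes[OF P])
  have FX: "F x \<in> X" if "x \<in> X" for x using F[OF that] permutes_in_image[OF F_perm] that by simp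
  have bF: "bij_betw F X X"
    using permutes_imp_bij[OF F_perm] F bij_betw_cong[of X F "lattice k P" X] by blast
  have hp: "\<exists>x\<in>X. p = h x" if "p \<in> edge_shift ?G" for p
    using bh that unfolding bij_betw_def by (metis imageE)
  have fh: "?f (h x) = h (F x)" if "x \<in> X" for x
    using bh that by (simp add: bij_betw_def)
  have bf: "bij_betw ?f (edge_shift ?G) (edge_shift ?G)"
    using bij_betw_trans[OF bij_betw_inv_into[OF bh] bij_betw_trans[OF bF bh]] by (simp add: comp_assoc)
  have g: "gate s (s + k) P" by (rule gate_mono[OF P(1)]) (use P in auto)
  have Fval: "F x (i + k * j) = P (shift_by (k * j) x) i" if "x \<in> X" "s \<le> i" "i < s + k" for x i j
    using lattice_apply[OF P that] F[OF that(1)] by simp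
  have Ffix: "F x (i + k * j) = x (i + k * j)" if "x \<in> X" "s + k \<le> i" "i < s + k + w" for x i j
  proof -
    have "F x ((i - k) + k * (j + 1)) = P (shift_by (k * (j + 1)) x) (i - k)"
      by (rule Fval) (use that k in auto)
    also have "\<dots> = shift_by (k * (j + 1)) x (i - k)"
      by (rule gate_fixes[OF g]) (use that in auto)
    also have "\<dots> = x ((i - k) + k * (j + 1))" by simp
    also have "(i - k) + k * (j + 1) = i + k * j" by (simp add: algebra_simps)
    finally show ?thesis .
  qed
  have ig: "gate s (s + k) (inv P)" by (rule gate_inv[OF g])
  have agree: "F x (i + k * j) = F y (i + k * j)"
    if xy: "x \<in> X" "y \<in> X" "\<forall>i. s \<le> i \<longrightarrow> i < s + k + w \<longrightarrow> x (i + k * j) = y (i + k * j)"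
      and i: "s \<le> i" "i < s + k + w" for x y i j
  proof (cases "i < s + k")
    case True
    have "P (shift_by (k * j) x) i = P (shift_by (k * j) y) i"
    proof (rule gate_local[OF g])
      fix m assume "s \<le> m" "m < s + k"
      then show "shift_by (k * j) x m = shift_by (k * j) y m" using xy(3) w_pos by simp
    qed (use xy i True in auto)
    then show ?thesis using Fval xy i True by simp
  next
    case False
    then show ?thesis using Ffix xy i by simp
  qed
  have agree': "x (i + k * j) = y (i + k * j)"
    if xy: "x \<in> X" "y \<in> X" "\<forall>i. s \<le> i \<longrightarrow> i < s + k + w \<longrightarrow> F x (i + k * j) = F y (i + k * j)"
      and i: "s \<le> i" "i < s + k + w" for x y i j
  proof (cases "i < s + k")
    case True
    have X: "P (shift_by (k * j) x) \<in> X" "P (shift_by (k * j) y) \<in> X" using xy gate_in[OF g] by simp_all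
    have "inv P (P (shift_by (k * j) x)) i = inv P (P (shift_by (k * j) y)) i"
    proof (rule gate_local[OF ig X])
      fix m assume m: "s \<le> m" "m < s + k"
      then show "P (shift_by (k * j) x) m = P (shift_by (k * j) y) m"
        using xy(3)[rule_format, of m] Fval[OF xy(1) m, of j] Fval[OF xy(2) m, of j] w_pos by simp
    qed (use i True in auto)
    then have "shift_by (k * j) x i = shift_by (k * j) y i"
      by (simp only: permutes_inverses[OF gate_permutes[OF g]])
    then show ?thesis by simp
  next
    case False
    then show ?thesis using Ffix[OF xy(1), of i j] Ffix[OF xy(2), of i j] xy(3) i by simp
  qed
  have "inert_on_edge_shift ?G ?f"
  proof (rule inert_if_permutes_edges[OF bf])
    fix p q j assume "p \<in> edge_shift ?G" "q \<in> edge_shift ?G"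
    then obtain x y where xy: "x \<in> X" "p = h x" "y \<in> X" "q = h y" using hp by metis
    have "h (F x) j = h (F y) j \<longleftrightarrow> h x j = h y j"
      unfolding h_def
        block_code_eq_iff[OF xy(1,3)] block_code_eq_iff[OF FX[OF xy(1)] FX[OF xy(3)]]
      using agree[OF xy(1,3), of j] agree'[OF xy(1,3), of j] by blast
    then show "?f p j = ?f q j \<longleftrightarrow> p j = q j"
      unfolding xy(2,4) fh[OF xy(1)] fh[OF xy(3)] .
  next
    fix p j assume "p \<in> edge_shift ?G"
    then obtain x where x: "x \<in> X" "p = h x" using hp by metis
    have hd: "head ?G (h z j) = vcode (prefix w (shift_by k (shift_by (s + k * j) z)))" if "z \<in> X" for z
      unfolding h_def block_code_def by (rule block_graph_simps(3)[OF k(2)]) (simp add: that)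
    have "prefix w (shift_by k (shift_by (s + k * j) (F x))) = prefix w (shift_by k (shift_by (s + k * j) x))"
      unfolding prefix_eq_iff
    proof (intro allI impI)
      fix i assume i: "0 \<le> i" "i < w"
      have e: "i + (k + (s + k * j)) = (i + s + k) + k * j" by simp
      have "F x ((i + s + k) + k * j) = x ((i + s + k) + k * j)" by (rule Ffix[OF x(1)]) (use i in auto)
      then show "shift_by k (shift_by (s + k * j) (F x)) i = shift_by k (shift_by (s + k * j) x) i"
        by (simp only: shift_by_shift_by shift_by_apply e)
    qed
    then show "head ?G (?f p j) = head ?G (p j)"
      unfolding x(2) fh[OF x(1)] hd[OF x(1)] hd[OF FX[OF x(1)]] by (simp only:)
  qed
  then show ?thesis
    using essential_block_graph[OF k(2)] block_code_conjugacy[OF k(1) comp, of s] unfolding h_def by blast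
qed

end

section \<open>Mixing subshifts of finite type\<close>

lemma shift_invariant_int:
  assumes "shift_by 1 ` X = X" "x \<in> X" shows "shift_by n x \<in> X"
proof -
  have fwd: "shift_by 1 y \<in> X" if "y \<in> X" for y using assms(1) that by blast
  have bwd: "shift_by (- 1) y \<in> X" if y: "y \<in> X" for y
  proof -
    have "y \<in> shift_by 1 ` X" using assms(1) y by simp
    then obtain z where z: "y = shift_by 1 z" "z \<in> X" by (rule imageE)
    show ?thesis unfolding z(1) using z(2) by (simp only: shift_by_shift_by left_minus shift_by_0)
  qed
  show ?thesis
  proof (induction n rule: int_induct[where k = 0])
    case base
    then show ?case using assms(2) by simp
  next
    case (step1 i)
    have "shift_by (i + 1) x = shift_by 1 (shift_by i x)" by (simp only: shift_by_shift_by add.commute)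
    then show ?case using fwd[OF step1(2)] by (simp only:)
  next
    case (step2 i)
    have "shift_by (i - 1) x = shift_by (- 1) (shift_by i x)" by (simp only: shift_by_shift_by add.commute diff_conv_add_uminus)
    then show ?case using bwd[OF step2(2)] by (simp only:)
  qed
qed

lemma subshiftD:
  assumes "subshift A X"
  shows "finite A" "x \<in> X \<Longrightarrow> x i \<in> A" "compact_space (shift_topology X)" "x \<in> X \<Longrightarrow> shift_by n x \<in> X"
proof -
  show "finite A" using assms by (simp add: subshift_def)
  have cl: "closedin (shift_topology (full_shift A)) X" using assms by (simp add: subshift_def)
  show "x i \<in> A" if "x \<in> X" using closedin_subset[OF cl] that by (auto simp: full_shift_def)
  show "compact_space (shift_topology X)" by (rule compact_subshift[OF \<open>finite A\<close> cl])
  show "shift_by n x \<in> X" if "x \<in> X"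
    using assms that shift_invariant_int by (auto simp: subshift_def)
qed

text \<open>
  A clopen set depends on a window \<open>{-M..M}\<close> by compactness, so a configuration lies in all
  translates of it as soon as its windows of that length look like windows of points of \<open>X\<close>.
\<close>

lemma SFT_windows:
  assumes "SFT A X"
  shows "\<exists>w\<ge>1. \<forall>y. (\<forall>i. \<exists>z\<in>X. \<forall>j. i \<le> j \<and> j \<le> i + w \<longrightarrow> z j = y j) \<longrightarrow> y \<in> X"
proof -
  let ?T = "shift_topology (full_shift A)"
  have sub: "subshift A X" using assms by (simp add: SFT_def)
  obtain C where C: "openin ?T C" "closedin ?T C" "X = (\<Inter>n. shift_by n ` C)"
    using assms unfolding SFT_def by blast
  have Csub: "C \<subseteq> full_shift A" using openin_subset[OF C(1)] by simp
  have op: "openin ?T (full_shift A - C)" using C(2) by (simp add: closedin_def)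
  have "pointwise_local (full_shift A) (\<lambda>x. x \<in> C)"
    unfolding pointwise_local_def
  proof
    fix x assume x: "x \<in> full_shift A"
    show "\<exists>M. \<forall>y\<in>full_shift A. (\<forall>j. \<bar>j\<bar> \<le> M \<longrightarrow> y j = x j) \<longrightarrow> (y \<in> C) = (x \<in> C)"
    proof (cases "x \<in> C")
      case True
      from bspec[OF C(1)[unfolded openin_shift_topology, THEN conjunct2] True] True
      show ?thesis by blast
    next
      case False
      then have "x \<in> full_shift A - C" using x by blast
      from bspec[OF op[unfolded openin_shift_topology, THEN conjunct2] this] False
      show ?thesis by blast
    qed
  qed
  from pointwise_local_uniform[OF compact_full_shift[OF subshiftD(1)[OF sub]] this]
  obtain M where M: "\<forall>x\<in>full_shift A. \<forall>y\<in>full_shift A. (\<forall>j. \<bar>j\<bar> \<le> M \<longrightarrow> x j = y j) \<longrightarrow> (x \<in> C) = (y \<in> C)"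
    by blast
  define w where "w = 2 * \<bar>M\<bar> + 1"
  have "y \<in> X" if y: "\<forall>i. \<exists>z\<in>X. \<forall>j. i \<le> j \<and> j \<le> i + w \<longrightarrow> z j = y j" for y
  proof -
    have "y i \<in> A" for i
    proof -
      obtain z where z: "z \<in> X" "\<forall>j. i \<le> j \<and> j \<le> i + w \<longrightarrow> z j = y j" using y by blast
      have "z i = y i" using z(2) by (simp add: w_def)
      then show ?thesis using subshiftD(2)[OF sub z(1), of i] by simp
    qed
    then have yA: "shift_by n y \<in> full_shift A" for n by (auto simp: full_shift_def)
    have "y \<in> shift_by n ` C" for n
    proof -
      obtain z where z: "z \<in> X" "\<forall>j. - n - \<bar>M\<bar> \<le> j \<and> j \<le> - n - \<bar>M\<bar> + w \<longrightarrow> z j = y j" using y by blast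
      have "z \<in> shift_by n ` C" using z(1) C(3) by blast
      then obtain c where c: "c \<in> C" "z = shift_by n c" by blast
      have "\<forall>j. \<bar>j\<bar> \<le> M \<longrightarrow> c j = shift_by (- n) y j"
      proof (intro allI impI)
        fix j assume "\<bar>j\<bar> \<le> M"
        then have "- n - \<bar>M\<bar> \<le> j - n \<and> j - n \<le> - n - \<bar>M\<bar> + w" by (auto simp: w_def)
        then have "z (j - n) = y (j - n)" using z(2) by blast
        then show "c j = shift_by (- n) y j" using c(2) by simp
      qed
      then have "(c \<in> C) = (shift_by (- n) y \<in> C)" using M Csub c(1) yA by blast
      then have "shift_by (- n) y \<in> C" using c(1) by blast
      moreover have "y = shift_by n (shift_by (- n) y)" by (simp only: shift_by_shift_by right_minus shift_by_0)
      ultimately show ?thesis by blast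
    qed
    then show ?thesis using C(3) by blast
  qed
  then show ?thesis by (intro exI[of _ w]) (simp add: w_def)
qed

lemma path_of_adj_power:
  assumes "adj_power G k u v > 0"
  shows "\<exists>p c. c 0 = u \<and> c k = v \<and> (\<forall>i<k. p i \<in> arcs G \<and> tail G (p i) = c i \<and> head G (p i) = c (Suc i))"
  using assms
proof (induction k arbitrary: u)
  case 0
  then show ?case by (intro exI[of _ undefined] exI[of _ "\<lambda>_. u"]) (auto split: if_splits)
next
  case (Suc k)
  have "(\<Sum>x\<in>verts G. adj_matrix G u x * adj_power G k x v) \<noteq> 0" using Suc.prems by simp
  then obtain x where x: "x \<in> verts G" "adj_matrix G u x * adj_power G k x v \<noteq> 0"
    by (rule sum.not_neutral_contains_not_neutral)
  then have "adj_power G k x v > 0" by simp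
  from Suc.IH[OF this] obtain p c where pc: "c 0 = x" "c k = v"
    "\<forall>i<k. p i \<in> arcs G \<and> tail G (p i) = c i \<and> head G (p i) = c (Suc i)" by (elim exE conjE)
  have "{e \<in> arcs G. tail G e = u \<and> head G e = x} \<noteq> {}"
  proof
    assume "{e \<in> arcs G. tail G e = u \<and> head G e = x} = {}"
    then have "adj_matrix G u x = 0" by (simp only: adj_matrix_def card.empty)
    then show False using x by simp
  qed
  then obtain e where e: "e \<in> arcs G" "tail G e = u" "head G e = x" by blast
  define p' c' where "p' = case_nat e p" and "c' = case_nat u c"
  have "p' i \<in> arcs G \<and> tail G (p' i) = c' i \<and> head G (p' i) = c' (Suc i)" if "i < Suc k" for i
    using that e pc by (cases i) (auto simp: p'_def c'_def)
  then show ?case using pc by (intro exI[of _ p'] exI[of _ c']) (auto simp: c'_def)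
qed

lemma edge_shift_glue:
  assumes G: "wf_digraph G" and k: "1 \<le> k" "\<And>u v. u \<in> verts G \<Longrightarrow> v \<in> verts G \<Longrightarrow> adj_power G k u v > 0"
    and x: "x \<in> edge_shift G" and y: "y \<in> edge_shift G"
  shows "\<exists>z\<in>edge_shift G. (\<forall>j<i. z j = x j) \<and> (\<forall>j\<ge>i + int k. z j = y j)"
proof -
  interpret wf_digraph G by (rule G)
  have ex: "x n \<in> arcs G \<and> head G (x n) = tail G (x (n + 1))"
    and ey: "y n \<in> arcs G \<and> head G (y n) = tail G (y (n + 1))" for n
    using x y unfolding edge_shift_def by blast+
  have "adj_power G k (head G (x (i - 1))) (tail G (y (i + int k))) > 0"
    by (rule k(2)) (use ex ey in auto)
  from path_of_adj_power[OF this] obtain p c where pc: "c 0 = head G (x (i - 1))" "c k = tail G (y (i + int k))"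
    "\<forall>i<k. p i \<in> arcs G \<and> tail G (p i) = c i \<and> head G (p i) = c (Suc i)" by (elim exE conjE)
  define z where "z n = (if n < i then x n else if n < i + int k then p (nat (n - i)) else y n)" for n
  have "z n \<in> arcs G \<and> head G (z n) = tail G (z (n + 1))" for n
  proof -
    consider "n < i - 1" | "n = i - 1" | "i \<le> n" "n < i + int k - 1" | "i \<le> n" "n = i + int k - 1" | "n \<ge> i + int k"
      by linarith
    then show ?thesis
    proof cases
      case 1
      then show ?thesis using ex[of n] by (simp add: z_def)
    next
      case 2
      then have "z n = x (i - 1)" "z (n + 1) = p 0" using k(1) by (simp_all add: z_def)
      then show ?thesis using ex[of "i - 1"] pc(1,3) k(1) by simp
    next
      case 3
      define m where "m = nat (n - i)"
      have m: "Suc m < k" "n = i + int m" using 3 by (auto simp: m_def)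
      then have "z n = p m" "z (n + 1) = p (Suc m)" by (simp_all add: z_def nat_add_distrib)
      then show ?thesis using pc(3) m(1) by simp
    next
      case 4
      define m where "m = nat (n - i)"
      have m: "Suc m = k" "n = i + int m" using 4 by (auto simp: m_def)
      have e: "n + 1 = i + int k" using m by auto
      have "m < k" using m(1) by simp
      then have "z n = p m" using m(2) by (simp add: z_def)
      moreover have "z (n + 1) = y (i + int k)" unfolding e by (simp add: z_def)
      ultimately show ?thesis using pc(2) pc(3)[rule_format, OF \<open>m < k\<close>] m(1) by simp
    next
      case 5
      then show ?thesis using ey[of n] k(1) by (simp add: z_def)
    qed
  qed
  then have "z \<in> edge_shift G" by (simp add: edge_shift_def)
  then show ?thesis by (intro bexI[of _ z]) (auto simp: z_def)
qed

text \<open>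
  Paths of one common length between all vertices give gluing in the edge shift, and the conjugacy
  widens the gap by its radius on either side.
\<close>

lemma mixing_SFT_glue:
  assumes "mixing_SFT A X"
  shows "\<exists>D\<ge>0. \<forall>x\<in>X. \<forall>y\<in>X. \<forall>i. \<exists>z\<in>X. (\<forall>j<i. z j = x j) \<and> (\<forall>j\<ge>i + D. z j = y j)"
proof -
  have sub: "subshift A X" using assms by (simp add: mixing_SFT_def SFT_def)
  obtain G :: "(nat, nat) pre_digraph" and h where G: "essential_graph G" "primitive_graph G"
    "conjugacy (shift_topology X) (shift_by 1) (shift_topology (edge_shift G)) (shift_by 1) h"
    using assms unfolding mixing_SFT_def by blast
  let ?Y = "edge_shift G"
  interpret fin_digraph G using G(1) by (simp add: essential_graph_def)
  obtain K where K: "1 \<le> K" "\<forall>u\<in>verts G. \<forall>v\<in>verts G. adj_power G K u v > 0"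
    using G(2) unfolding primitive_graph_def by blast
  define k where "k = inv_into X h"
  have hh: "homeomorphic_map (shift_topology X) (shift_topology ?Y) h"
    and hs: "\<And>x. x \<in> X \<Longrightarrow> h (shift_by 1 x) = shift_by 1 (h x)"
    using G(3) by (simp_all add: conjugacy_def)
  have bh: "bij_betw h X ?Y" by (rule homeomorphic_map_shift_topologyD(1)[OF hh])
  have kX: "k y \<in> X" "h (k y) = y" if "y \<in> ?Y" for y
    using bh that unfolding k_def bij_betw_def by (auto simp: inv_into_into f_inv_into_f)
  have hY: "h x \<in> ?Y" "k (h x) = x" if "x \<in> X" for x
    using bh that unfolding k_def bij_betw_def by auto
  have kloc: "pointwise_local ?Y (\<lambda>y. k y i)" for i
    unfolding k_def by (rule homeomorphic_map_shift_topologyD(3)[OF hh])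
  have compY: "compact_space (shift_topology ?Y)"
    using subshiftD(3)[OF sub] homeomorphic_compact_space homeomorphic_map_imp_homeomorphic_space[OF hh] by blast
  note shX = subshiftD(4)[OF sub]
  have hsm: "h (shift_by (1 * q) x) = shift_by (1 * q) (h x)" if "x \<in> X" for x q
    by (rule shift_intertwining_mult[where h = h and a = 1 and b = 1 and X = X, OF shX hs that])
  have ksm: "k (shift_by (1 * q) y) = shift_by (1 * q) (k y)" if y: "y \<in> ?Y" for y q
  proof -
    have "h (shift_by (1 * q) (k y)) = shift_by (1 * q) y" using hsm[OF kX(1)[OF y]] kX(2)[OF y] by simp
    then show ?thesis using hY(2)[OF shX[OF kX(1)[OF y]]] by metis
  qed
  have "\<exists>r\<ge>0. has_radius ?Y k r"
    by (rule has_radius_exists[OF compY kloc, of 1]) (simp_all only: zero_less_one ksm edge_shift_shift)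
  then obtain r where r: "0 \<le> r" "has_radius ?Y k r" by blast
  have "\<exists>z\<in>X. (\<forall>j<i. z j = x j) \<and> (\<forall>j\<ge>i + (2 * r + int K). z j = y j)" if xy: "x \<in> X" "y \<in> X" for x y i
  proof -
    obtain z where z: "z \<in> ?Y" "\<forall>j<i + r. z j = h x j" "\<forall>j\<ge>i + r + int K. z j = h y j"
      using edge_shift_glue[OF wf_digraph_axioms K(1) _ hY(1)[OF xy(1)] hY(1)[OF xy(2)], of "i + r"] K(2) by blast
    have "k z j = x j" if j: "j < i" for j
    proof -
      have "k z j = k (h x) j"
        by (rule has_radiusD[OF r(2) z(1) hY(1)[OF xy(1)]]) (use z(2) j in auto)
      then show ?thesis using hY(2)[OF xy(1)] by simp
    qed
    moreover have "k z j = y j" if j: "i + (2 * r + int K) \<le> j" for j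
    proof -
      have "k z j = k (h y) j"
        by (rule has_radiusD[OF r(2) z(1) hY(1)[OF xy(2)]]) (use z(3) j in auto)
      then show ?thesis using hY(2)[OF xy(2)] by simp
    qed
    ultimately show ?thesis using kX(1)[OF z(1)] by blast
  qed
  then show ?thesis using r(1) by (intro exI[of _ "2 * r + int K"]) simp
qed

section \<open>The groups of automorphisms\<close>

definition Aut_perms :: "(int \<Rightarrow> 'a) set \<Rightarrow> ((int \<Rightarrow> 'a) \<Rightarrow> (int \<Rightarrow> 'a)) set" where
  "Aut_perms X = {p. \<exists>n>0. shiftaut X n p}"

lemma restrict_in_shift_Aut:
  assumes "shiftaut X (int n) p" "\<And>x. x \<in> X \<Longrightarrow> shift_by (int n) x \<in> X"
  shows "restrict p X \<in> shift_Aut X n"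
proof -
  have p: "p permutes X" "homeomorphic_map (shift_topology X) (shift_topology X) p"
    "\<And>x. x \<in> X \<Longrightarrow> p (shift_by (int n) x) = shift_by (int n) (p x)"
    using assms(1) by (auto simp: shiftaut_def simp del: shift_by_apply)
  have "bij_betw (restrict p X) X X"
    using permutes_imp_bij[OF p(1)] bij_betw_cong[of X "restrict p X" p X] by simp
  then have "restrict p X \<in> Bij X" by (simp add: Bij_def)
  moreover have "homeomorphic_map (shift_topology X) (shift_topology X) (restrict p X)"
    by (rule homeomorphic_map_eq[OF p(2)]) simp
  ultimately show ?thesis
    using p(3) assms(2) by (simp add: shift_Aut_def)
qed

lemma shift_Aut_cases:
  assumes "f \<in> shift_Aut X n" "\<And>x. x \<in> X \<Longrightarrow> shift_by (int n) x \<in> X"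
  obtains p where "shiftaut X (int n) p" "f = restrict p X"
proof -
  define p where "p x = (if x \<in> X then f x else x)" for x
  have f: "bij_betw f X X" "f \<in> extensional X" "homeomorphic_map (shift_topology X) (shift_topology X) f"
    "\<And>x. x \<in> X \<Longrightarrow> f (shift_by (int n) x) = shift_by (int n) (f x)"
    using assms(1) by (auto simp: shift_Aut_def Bij_def simp del: shift_by_apply)
  have "bij_betw p X X" using f(1) bij_betw_cong[of X p f X] by (simp add: p_def)
  then have "p permutes X" by (rule bij_imp_permutes) (simp add: p_def)
  moreover have "homeomorphic_map (shift_topology X) (shift_topology X) p"
    by (rule homeomorphic_map_eq[OF f(3)]) (simp add: p_def)
  ultimately have "shiftaut X (int n) p"
    using f(4) assms(2) by (simp add: shiftaut_def p_def)
  moreover have "f = restrict p X"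
    using f(2) by (auto simp: p_def restrict_def extensional_def fun_eq_iff simp del: shift_by_apply)
  ultimately show ?thesis using that by blast
qed

context compact_shift
begin

abbreviation "res p \<equiv> restrict p X"

lemma Aut_perms_permutes: "p \<in> Aut_perms X \<Longrightarrow> p permutes X"
  by (auto simp: Aut_perms_def shiftaut_def)

lemma Aut_perms_comp: "p \<in> Aut_perms X \<Longrightarrow> q \<in> Aut_perms X \<Longrightarrow> p \<circ> q \<in> Aut_perms X"
  unfolding Aut_perms_def using shiftaut_comp by (auto intro: mult_pos_pos)

lemma Aut_perms_inv: "p \<in> Aut_perms X \<Longrightarrow> inv p \<in> Aut_perms X"
  unfolding Aut_perms_def using shiftaut_inv by blast

lemma id_Aut_perms: "id \<in> Aut_perms X"
proof -
  have "shiftaut X 1 id" by (simp add: shiftaut_def permutes_id homeomorphic_map_id)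
  then show ?thesis unfolding Aut_perms_def by (intro CollectI exI[of _ 1]) simp
qed

lemma res_Bij: "p permutes X \<Longrightarrow> res p \<in> Bij X"
  using permutes_imp_bij[of p X] bij_betw_cong[of X "res p" p X] by (simp add: Bij_def)

lemma carrier_SAut: "carrier (SAut X) = res ` Aut_perms X"
proof -
  have "(\<Union>n\<in>{1..}. shift_Aut X n) = res ` Aut_perms X"
  proof
    show "(\<Union>n\<in>{1..}. shift_Aut X n) \<subseteq> res ` Aut_perms X"
    proof
      fix f assume "f \<in> (\<Union>n\<in>{1..}. shift_Aut X n)"
      then obtain n :: nat where n: "1 \<le> n" "f \<in> shift_Aut X n" by auto
      obtain p where p: "shiftaut X (int n) p" "f = res p" using shift_Aut_cases[OF n(2) shift_inX] by blast
      have "0 < int n" using n(1) by simp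
      then show "f \<in> res ` Aut_perms X" unfolding Aut_perms_def using p by blast
    qed
    show "res ` Aut_perms X \<subseteq> (\<Union>n\<in>{1..}. shift_Aut X n)"
    proof
      fix f assume "f \<in> res ` Aut_perms X"
      then obtain p n where p: "f = res p" "0 < n" "shiftaut X n p" unfolding Aut_perms_def by blast
      then have "shiftaut X (int (nat n)) p" by simp
      from restrict_in_shift_Aut[OF this shift_inX] have "f \<in> shift_Aut X (nat n)" using p(1) by simp
      moreover have "nat n \<in> {1..}" using p(2) by auto
      ultimately show "f \<in> (\<Union>n\<in>{1..}. shift_Aut X n)" by blast
    qed
  qed
  then show ?thesis by (simp add: SAut_def)
qed

lemma res_mult: "p permutes X \<Longrightarrow> q permutes X \<Longrightarrow> res p \<otimes>\<^bsub>SAut X\<^esub> res q = res (p \<circ> q)"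
  using res_Bij[of p] res_Bij[of q] permutes_in_image[of q X]
  by (auto simp: SAut_def BijGroup_def compose_def restrict_def fun_eq_iff simp del: shift_by_apply)

lemma one_SAut: "\<one>\<^bsub>SAut X\<^esub> = res id"
  by (auto simp: SAut_def BijGroup_def restrict_def)

lemma group_SAut: "group (SAut X)"
proof (rule groupI)
  fix a b c assume abc: "a \<in> carrier (SAut X)" "b \<in> carrier (SAut X)" "c \<in> carrier (SAut X)"
  then obtain p q s where p: "p \<in> Aut_perms X" "q \<in> Aut_perms X" "s \<in> Aut_perms X"
    "a = res p" "b = res q" "c = res s" unfolding carrier_SAut by blast
  note perm = Aut_perms_permutes[OF p(1)] Aut_perms_permutes[OF p(2)] Aut_perms_permutes[OF p(3)]
  show "a \<otimes>\<^bsub>SAut X\<^esub> b \<otimes>\<^bsub>SAut X\<^esub> c = a \<otimes>\<^bsub>SAut X\<^esub> (b \<otimes>\<^bsub>SAut X\<^esub> c)"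
    unfolding p(4,5,6) res_mult[OF perm(1,2)] res_mult[OF perm(2,3)]
      res_mult[OF permutes_compose[OF perm(2,1)] perm(3)] res_mult[OF perm(1) permutes_compose[OF perm(3,2)]]
      comp_assoc ..
next
  fix a b assume "a \<in> carrier (SAut X)" "b \<in> carrier (SAut X)"
  then obtain p q where p: "p \<in> Aut_perms X" "q \<in> Aut_perms X" "a = res p" "b = res q"
    unfolding carrier_SAut by blast
  have "a \<otimes>\<^bsub>SAut X\<^esub> b = res (p \<circ> q)"
    unfolding p(3,4) by (rule res_mult[OF Aut_perms_permutes[OF p(1)] Aut_perms_permutes[OF p(2)]])
  then show "a \<otimes>\<^bsub>SAut X\<^esub> b \<in> carrier (SAut X)"
    unfolding carrier_SAut using Aut_perms_comp[OF p(1,2)] by blast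
next
  show "\<one>\<^bsub>SAut X\<^esub> \<in> carrier (SAut X)" unfolding one_SAut carrier_SAut using id_Aut_perms by blast
next
  fix a assume "a \<in> carrier (SAut X)"
  then obtain p where p: "p \<in> Aut_perms X" "a = res p" unfolding carrier_SAut by blast
  note perm = Aut_perms_permutes[OF p(1)]
  show "\<one>\<^bsub>SAut X\<^esub> \<otimes>\<^bsub>SAut X\<^esub> a = a"
    unfolding one_SAut p(2) by (simp add: res_mult[OF permutes_id perm])
  have "res (inv p) \<otimes>\<^bsub>SAut X\<^esub> a = \<one>\<^bsub>SAut X\<^esub>"
    unfolding one_SAut p(2) by (simp add: res_mult[OF permutes_inv[OF perm] perm] permutes_inv_o[OF perm])
  then show "\<exists>y\<in>carrier (SAut X). y \<otimes>\<^bsub>SAut X\<^esub> a = \<one>\<^bsub>SAut X\<^esub>"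
    unfolding carrier_SAut using Aut_perms_inv[OF p(1)] by blast
qed

lemma res_inv: assumes "p \<in> Aut_perms X" shows "m_inv (SAut X) (res p) = res (inv p)"
proof -
  interpret group "SAut X" by (rule group_SAut)
  note perm = Aut_perms_permutes[OF assms]
  show ?thesis
  proof (rule inv_equality)
    show "res (inv p) \<otimes>\<^bsub>SAut X\<^esub> res p = \<one>\<^bsub>SAut X\<^esub>"
      unfolding one_SAut by (simp add: res_mult[OF permutes_inv[OF perm] perm] permutes_inv_o[OF perm])
    show "res p \<in> carrier (SAut X)" "res (inv p) \<in> carrier (SAut X)"
      unfolding carrier_SAut using assms Aut_perms_inv by blast+
  qed
qed

definition Cut :: "((int \<Rightarrow> 'a) \<Rightarrow> (int \<Rightarrow> 'a)) set" where
  "Cut = {p \<in> Aut_perms X. cuttable X p}"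

lemma Cut_Aut: "p \<in> Cut \<Longrightarrow> p \<in> Aut_perms X"
  by (simp add: Cut_def)

lemma Cut_comp: "p \<in> Cut \<Longrightarrow> q \<in> Cut \<Longrightarrow> p \<circ> q \<in> Cut"
  unfolding Cut_def using Aut_perms_comp cuttable_comp by (auto simp: Aut_perms_def)

lemma Cut_inv: "p \<in> Cut \<Longrightarrow> inv p \<in> Cut"
  unfolding Cut_def using Aut_perms_inv cuttable_inv by (auto simp: Aut_perms_def)

lemma Cut_conj: "p \<in> Cut \<Longrightarrow> a \<in> Aut_perms X \<Longrightarrow> a \<circ> p \<circ> inv a \<in> Cut"
  unfolding Cut_def using Aut_perms_comp Aut_perms_inv cuttable_conj
  by (auto simp: Aut_perms_def)

lemma id_Cut: "id \<in> Cut"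
proof -
  have "cuttable X id"
    unfolding cuttable_def
    by (intro exI[of _ id] exI[of _ 0])
      (auto simp: permutes_id inv_id has_radius_def intro!: exI[of _ 0])
  then show ?thesis using id_Aut_perms by (simp add: Cut_def)
qed

lemma normal_Cut: "res ` Cut \<lhd> SAut X"
proof -
  interpret group "SAut X" by (rule group_SAut)
  have "subgroup (res ` Cut) (SAut X)"
  proof
    show "res ` Cut \<subseteq> carrier (SAut X)" unfolding carrier_SAut using Cut_Aut by blast
    show "\<one>\<^bsub>SAut X\<^esub> \<in> res ` Cut" unfolding one_SAut using id_Cut by blast
    fix a assume "a \<in> res ` Cut"
    then obtain p where p: "p \<in> Cut" "a = res p" by blast
    show "m_inv (SAut X) a \<in> res ` Cut"
      unfolding p(2) res_inv[OF Cut_Aut[OF p(1)]] using Cut_inv[OF p(1)] by blast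
    fix b assume "b \<in> res ` Cut"
    then obtain q where q: "q \<in> Cut" "b = res q" by blast
    show "a \<otimes>\<^bsub>SAut X\<^esub> b \<in> res ` Cut"
      unfolding p(2) q(2) res_mult[OF Aut_perms_permutes[OF Cut_Aut[OF p(1)]] Aut_perms_permutes[OF Cut_Aut[OF q(1)]]]
      using Cut_comp[OF p(1) q(1)] by blast
  qed
  moreover have "x \<otimes>\<^bsub>SAut X\<^esub> y \<otimes>\<^bsub>SAut X\<^esub> m_inv (SAut X) x \<in> res ` Cut"
    if xy: "x \<in> carrier (SAut X)" "y \<in> res ` Cut" for x y
  proof -
    obtain a where a: "a \<in> Aut_perms X" "x = res a" using xy(1) unfolding carrier_SAut by blast
    obtain p where p: "p \<in> Cut" "y = res p" using xy(2) by blast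
    note perm = Aut_perms_permutes[OF a(1)] Aut_perms_permutes[OF Cut_Aut[OF p(1)]]
    have "x \<otimes>\<^bsub>SAut X\<^esub> y \<otimes>\<^bsub>SAut X\<^esub> m_inv (SAut X) x = res (a \<circ> p \<circ> inv a)"
      unfolding a(2) p(2) res_inv[OF a(1)] res_mult[OF perm]
      by (rule res_mult[OF permutes_compose[OF perm(2,1)] permutes_inv[OF perm(1)]])
    then show ?thesis using Cut_conj[OF p(1) a(1)] by blast
  qed
  ultimately show ?thesis unfolding normal_inv_iff by blast
qed

lemma inert_in_Cut:
  assumes n: "1 \<le> n" and f: "f \<in> inert_Aut X n" shows "f \<in> res ` Cut"
proof -
  obtain G :: "(nat, nat) pre_digraph" and h where G: "essential_graph G"
    "conjugacy (shift_topology X) (shift_by (int n)) (shift_topology (edge_shift G)) (shift_by 1) h"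
    "inert_on_edge_shift G (h \<circ> f \<circ> inv_into X h)" and fA: "f \<in> shift_Aut X n"
    using f unfolding inert_Aut_def by blast
  obtain p where p: "shiftaut X (int n) p" "f = res p" using shift_Aut_cases[OF fA shift_inX] by blast
  have npos: "0 < int n" using n by simp
  have bh: "bij_betw h X (edge_shift G)"
    using G(2) homeomorphic_map_shift_topologyD(1) by (auto simp: conjugacy_def)
  have "cuttable X p"
  proof (rule inert_cuttable[OF p(1) npos _ G(2)])
    show "fin_digraph G" using G(1) by (simp add: essential_graph_def)
    fix x assume x: "x \<in> edge_shift G"
    have "is_beam G (ray G x 0)"
      unfolding is_beam_def is_beam_at_def using x by (intro exI[of _ 0] exI[of _ "{x}"]) auto
    then have "beam_equiv G ((h \<circ> f \<circ> inv_into X h) ` ray G x 0) (ray G x 0)"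
      using G(3) unfolding inert_on_edge_shift_def by blast
    moreover have "(h \<circ> f \<circ> inv_into X h) ` ray G x 0 = (h \<circ> p \<circ> inv_into X h) ` ray G x 0"
    proof (rule image_cong[OF refl])
      fix y assume "y \<in> ray G x 0"
      then have "inv_into X h y \<in> X"
        using bh by (auto simp: ray_def bij_betw_def inv_into_into)
      then show "(h \<circ> f \<circ> inv_into X h) y = (h \<circ> p \<circ> inv_into X h) y" by (simp add: p(2))
    qed
    ultimately show "beam_equiv G ((h \<circ> p \<circ> inv_into X h) ` ray G x 0) (ray G x 0)" by simp
  qed
  then show ?thesis using p npos unfolding Cut_def Aut_perms_def by blast
qed

end

locale compact_mixing_shift = mixing_shift + compact_shift
begin

lemma shiftaut_lattice:
  assumes "gate s t P" "t - s \<le> k" shows "shiftaut X k (lattice k P)"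
proof -
  have "lattice k P (shift_by k x) = shift_by k (lattice k P x)" if "x \<in> X" for x
    using lattice_shift[OF assms that, of 1] by (simp only: mult_1_right)
  then show ?thesis unfolding shiftaut_def
    using lattice_permutes[OF assms] homeomorphic_if_radius[OF lattice_permutes[OF assms] lattice_radius[OF assms]] by blast
qed

lemma lattice_SIAut:
  assumes "gate s t P" "t - s \<le> k" shows "res (lattice k P) \<in> SIAut_carrier X"
proof -
  have kpos: "0 < k" using period_pos[OF assms] w_pos by simp
  have "\<exists>(G :: (nat, nat) pre_digraph) h. essential_graph G \<and>
     conjugacy (shift_topology X) (shift_by k) (shift_topology (edge_shift G)) (shift_by 1) h \<and>
     inert_on_edge_shift G (h \<circ> res (lattice k P) \<circ> inv_into X h)"
    by (rule lattice_inert[OF assms compact]) simp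
  moreover have "res (lattice k P) \<in> shift_Aut X (nat k)"
    by (rule restrict_in_shift_Aut) (use shiftaut_lattice[OF assms] kpos shift_inX in simp_all)
  ultimately have "res (lattice k P) \<in> inert_Aut X (nat k)"
    using kpos by (simp add: inert_Aut_def)
  moreover have "nat k \<in> {1..}" using kpos by auto
  ultimately show ?thesis unfolding SIAut_carrier_def by (intro generate.incl) blast
qed

lemma Cut_lattices:
  assumes "p \<in> Cut"
  obtains k s t P s' t' Q where "gate s t P" "t - s \<le> k" "gate s' t' Q" "t' - s' \<le> k"
    "p = lattice k P \<circ> lattice k Q"
proof -
  obtain n where n: "0 < n" "shiftaut X n p" and cut: "cuttable X p"
    using assms unfolding Cut_def Aut_perms_def by blast
  obtain r where r: "has_radius X p r" "has_radius X (inv p) r" using shiftaut_radius[OF n(2,1)] by blast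
  have pp: "p permutes X" using n(2) by (simp add: shiftaut_def)
  from cuttable_product_of_lattices[OF pp r n(1) shiftaut_mult[OF n(2)] cut]
  show ?thesis using that by blast
qed

text \<open>
  The inert automorphisms are cuttable, the cuttable ones are products of lattices, and lattices
  are inert.
\<close>

theorem SIAut_carrier_eq: "SIAut_carrier X = res ` Cut"
proof
  interpret group "SAut X" by (rule group_SAut)
  have sub: "subgroup (res ` Cut) (SAut X)" using normal_Cut by (rule normal_imp_subgroup)
  show "SIAut_carrier X \<subseteq> res ` Cut"
    unfolding SIAut_carrier_def
    by (rule generate_subgroup_incl[OF _ sub]) (use inert_in_Cut in auto)
  show "res ` Cut \<subseteq> SIAut_carrier X"
  proof
    fix f assume "f \<in> res ` Cut"
    then obtain p where p: "p \<in> Cut" "f = res p" by blast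
    obtain k s t P s' t' Q where L: "gate s t P" "t - s \<le> k" "gate s' t' Q" "t' - s' \<le> k"
      "p = lattice k P \<circ> lattice k Q" using Cut_lattices[OF p(1)] .
    have "res p = res (lattice k P) \<otimes>\<^bsub>SAut X\<^esub> res (lattice k Q)"
      unfolding L(5) by (rule res_mult[symmetric, OF lattice_permutes[OF L(1,2)] lattice_permutes[OF L(3,4)]])
    then show "f \<in> SIAut_carrier X"
      using lattice_SIAut[OF L(1,2)] lattice_SIAut[OF L(3,4)] generate.eng
      unfolding p(2) SIAut_carrier_def by metis
  qed
qed

lemma lattice_Cut:
  assumes "gate s t P" "t - s \<le> k" shows "lattice k P \<in> Cut"
proof -
  obtain p where p: "p \<in> Cut" "res (lattice k P) = res p"
    using lattice_SIAut[OF assms] unfolding SIAut_carrier_eq by blast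
  have "lattice k P x = p x" for x
  proof (cases "x \<in> X")
    case True
    then show ?thesis using fun_cong[OF p(2), of x] by simp
  next
    case False
    then show ?thesis
      using permutes_not_in[OF Aut_perms_permutes[OF Cut_Aut[OF p(1)]]] by (simp add: lattice_notin)
  qed
  then have "lattice k P = p" by blast
  then show ?thesis using p(1) by simp
qed

lemma nontrivial_SIAut: "SIAut_carrier X \<noteq> {\<one>\<^bsub>SAut X\<^esub>}"
proof -
  obtain L where L: "L > 0" "\<forall>S T. S \<le> - L \<longrightarrow> L \<le> T \<longrightarrow> S + 2 * w \<le> T \<and>
     (\<forall>u\<in>words S T. 5 \<le> card {v \<in> words S T. margins S T v = margins S T u})" using five_words by blast
  have len: "- L + 2 * w \<le> L" using L(2) by blast
  obtain x where x: "x \<in> X" using nontrivial by blast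
  define u where "u = word (- L) L x"
  have u: "u \<in> words (- L) L" using x word_in_words by (simp add: u_def)
  have "\<not> {v \<in> words (- L) L. margins (- L) L v = margins (- L) L u} \<subseteq> {u}"
  proof
    assume "{v \<in> words (- L) L. margins (- L) L v = margins (- L) L u} \<subseteq> {u}"
    then have "card {v \<in> words (- L) L. margins (- L) L v = margins (- L) L u} \<le> card {u}" by (rule card_mono[rotated]) simp
    moreover have "5 \<le> card {v \<in> words (- L) L. margins (- L) L v = margins (- L) L u}" using L(2) u by blast
    ultimately show False by simp
  qed
  then obtain v where v: "v \<in> words (- L) L" "margins (- L) L v = margins (- L) L u" "v \<noteq> u" by auto
  have wp: "word_perm (- L) L (swap u v)" using u v by (intro word_perm_swap) auto
  define P where "P = lift (- L) L (swap u v)"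
  have P: "gate (- L) L P" unfolding P_def by (rule gate_lift[OF wp len])
  have "word (- L) L (P x) = v" using lift_in(2)[OF wp len x] by (simp add: P_def u_def)
  then have "\<exists>i. - L \<le> i \<and> i < L \<and> P x i \<noteq> x i" using v(3) unfolding u_def by (auto simp: word_eq_iff)
  then obtain i where i: "- L \<le> i" "i < L" "P x i \<noteq> x i" by blast
  have "lattice (L - - L) P x (i + (L - - L) * 0) = P (shift_by ((L - - L) * 0) x) i"
    by (rule lattice_apply[OF P _ x]) (use i in auto)
  then have "res (lattice (L - - L) P) x i \<noteq> res id x i" using i(3) x by simp
  then have "res (lattice (L - - L) P) \<noteq> \<one>\<^bsub>SAut X\<^esub>" unfolding one_SAut by metis
  then show ?thesis using lattice_SIAut[OF P order_refl] by blast
qed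

text \<open>
  The common core of simplicity and of the monolith property.
\<close>

lemma normalised_subgroup_contains_SIAut:
  assumes N: "subgroup N (SAut X)" "N \<noteq> {\<one>\<^bsub>SAut X\<^esub>}"
    and norm: "\<And>a f. a \<in> SIAut_carrier X \<Longrightarrow> f \<in> N \<Longrightarrow> a \<otimes>\<^bsub>SAut X\<^esub> f \<otimes>\<^bsub>SAut X\<^esub> m_inv (SAut X) a \<in> N"
  shows "SIAut_carrier X \<subseteq> N"
proof -
  interpret group "SAut X" by (rule group_SAut)
  define N' where "N' = {p \<in> Aut_perms X. res p \<in> N}"
  have oneN: "\<one>\<^bsub>SAut X\<^esub> \<in> N" by (rule subgroup.one_closed[OF N(1)])
  obtain f where f: "f \<in> N" "f \<noteq> \<one>\<^bsub>SAut X\<^esub>" using N(2) oneN by blast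
  have "f \<in> carrier (SAut X)" using subgroup.subset[OF N(1)] f(1) by blast
  then obtain g where g: "g \<in> Aut_perms X" "f = res g" unfolding carrier_SAut by blast
  obtain n where n: "0 < n" "shiftaut X n g" using g(1) unfolding Aut_perms_def by blast
  obtain r where r: "0 \<le> r" "has_radius X g r" "has_radius X (inv g) r" using shiftaut_radius[OF n(2,1)] by blast
  have gN: "g \<in> N'" using g f(1) by (simp add: N'_def)
  have gne: "g \<noteq> id" using f(2) g(2) by (auto simp: one_SAut)
  have gp: "g permutes X" by (rule Aut_perms_permutes[OF g(1)])
  have lat: "lattice k P \<in> N'" if "gate s t P" "t - s \<le> k" for s t P k
  proof (rule contains_lattices[OF _ _ _ _ gN gne gp r(2,3,1) n(1) shiftaut_mult[OF n(2)] that])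
    show "id \<in> N'" using id_Aut_perms oneN by (simp add: N'_def one_SAut)
    show "p \<circ> q \<in> N'" if pq: "p \<in> N'" "q \<in> N'" for p q
    proof -
      have A: "p \<in> Aut_perms X" "q \<in> Aut_perms X" and R: "res p \<in> N" "res q \<in> N" using pq by (auto simp: N'_def)
      have "res (p \<circ> q) \<in> N"
        using subgroup.m_closed[OF N(1) R] res_mult[OF Aut_perms_permutes[OF A(1)] Aut_perms_permutes[OF A(2)]] by simp
      then show ?thesis using Aut_perms_comp[OF A] by (simp add: N'_def)
    qed
    show "inv p \<in> N'" if p: "p \<in> N'" for p
    proof -
      have A: "p \<in> Aut_perms X" and R: "res p \<in> N" using p by (auto simp: N'_def)
      have "res (inv p) \<in> N" using subgroup.m_inv_closed[OF N(1) R] res_inv[OF A] by simp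
      then show ?thesis using Aut_perms_inv[OF A] by (simp add: N'_def)
    qed
    show "lattice k P \<circ> p \<circ> inv (lattice k P) \<in> N'" if p: "p \<in> N'" and P: "gate s t P" "t - s \<le> k" for p s t P k
    proof -
      have A: "p \<in> Aut_perms X" and R: "res p \<in> N" using p by (auto simp: N'_def)
      have L: "lattice k P \<in> Aut_perms X" by (rule Cut_Aut[OF lattice_Cut[OF P]])
      note perm = Aut_perms_permutes[OF L] Aut_perms_permutes[OF A]
      have "res (lattice k P) \<otimes>\<^bsub>SAut X\<^esub> res p \<otimes>\<^bsub>SAut X\<^esub> m_inv (SAut X) (res (lattice k P)) \<in> N"
        by (rule norm[OF lattice_SIAut[OF P] R])
      also have "res (lattice k P) \<otimes>\<^bsub>SAut X\<^esub> res p \<otimes>\<^bsub>SAut X\<^esub> m_inv (SAut X) (res (lattice k P))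
          = res (lattice k P \<circ> p \<circ> inv (lattice k P))"
        unfolding res_inv[OF L] res_mult[OF perm]
        by (rule res_mult[OF permutes_compose[OF perm(2,1)] permutes_inv[OF perm(1)]])
      finally show ?thesis
        using Aut_perms_comp[OF Aut_perms_comp[OF L A] Aut_perms_inv[OF L]] unfolding N'_def by blast
    qed
  qed
  show ?thesis
  proof
    fix a assume "a \<in> SIAut_carrier X"
    then obtain p where p: "p \<in> Cut" "a = res p" unfolding SIAut_carrier_eq by blast
    obtain k s t P s' t' Q where L: "gate s t P" "t - s \<le> k" "gate s' t' Q" "t' - s' \<le> k"
      "p = lattice k P \<circ> lattice k Q" using Cut_lattices[OF p(1)] .
    have R: "res (lattice k P) \<in> N" "res (lattice k Q) \<in> N"
      using lat[OF L(1,2)] lat[OF L(3,4)] by (simp_all add: N'_def)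
    have "res p = res (lattice k P) \<otimes>\<^bsub>SAut X\<^esub> res (lattice k Q)"
      unfolding L(5) by (rule res_mult[symmetric, OF lattice_permutes[OF L(1,2)] lattice_permutes[OF L(3,4)]])
    then show "a \<in> N" using subgroup.m_closed[OF N(1) R] p(2) by simp
  qed
qed

theorem simple_and_monolith: "is_simple (SIAut X) \<and> is_monolith (SIAut_carrier X) (SAut X)"
proof
  interpret group "SAut X" by (rule group_SAut)
  have norm: "SIAut_carrier X \<lhd> SAut X" unfolding SIAut_carrier_eq by (rule normal_Cut)
  then have sub: "subgroup (SIAut_carrier X) (SAut X)" by (rule normal_imp_subgroup)
  have one: "\<one>\<^bsub>SIAut X\<^esub> = \<one>\<^bsub>SAut X\<^esub>" and car: "carrier (SIAut X) = SIAut_carrier X"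
    by (simp_all add: SIAut_def)
  have grp: "group (SIAut X)" unfolding SIAut_def by (rule subgroup_imp_group[OF sub])
  show "is_monolith (SIAut_carrier X) (SAut X)"
    unfolding is_monolith_def
  proof (intro conjI allI impI)
    show "SIAut_carrier X \<lhd> SAut X" by (rule norm)
    show "SIAut_carrier X \<noteq> {\<one>\<^bsub>SAut X\<^esub>}" by (rule nontrivial_SIAut)
    fix N assume N: "N \<lhd> SAut X \<and> N \<noteq> {\<one>\<^bsub>SAut X\<^esub>}"
    show "SIAut_carrier X \<subseteq> N"
    proof (rule normalised_subgroup_contains_SIAut)
      show "subgroup N (SAut X)" using N normal_imp_subgroup by blast
      show "N \<noteq> {\<one>\<^bsub>SAut X\<^esub>}" using N by blast
      show "a \<otimes>\<^bsub>SAut X\<^esub> f \<otimes>\<^bsub>SAut X\<^esub> m_inv (SAut X) a \<in> N" if "a \<in> SIAut_carrier X" "f \<in> N" for a f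
        using N that subgroup.subset[OF sub] normal_inv_iff by blast
    qed
  qed
  show "is_simple (SIAut X)"
    unfolding is_simple_def one car
  proof (intro conjI allI impI)
    show "group (SIAut X)" by (rule grp)
    show "SIAut_carrier X \<noteq> {\<one>\<^bsub>SAut X\<^esub>}" by (rule nontrivial_SIAut)
    fix N assume N: "N \<lhd> SIAut X"
    then have subN: "subgroup N (SIAut X)" by (rule normal_imp_subgroup)
    have subN': "subgroup N (SAut X)"
      by (rule incl_subgroup[OF sub]) (use subN in \<open>simp add: SIAut_def\<close>)
    have NM: "N \<subseteq> SIAut_carrier X" using subgroup.subset[OF subN] car by simp
    show "N = {\<one>\<^bsub>SAut X\<^esub>} \<or> N = SIAut_carrier X"
    proof (rule disjCI)
      assume ne: "N \<noteq> SIAut_carrier X"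
      show "N = {\<one>\<^bsub>SAut X\<^esub>}"
      proof (rule ccontr)
        assume "N \<noteq> {\<one>\<^bsub>SAut X\<^esub>}"
        then have "SIAut_carrier X \<subseteq> N"
        proof (rule normalised_subgroup_contains_SIAut[OF subN'])
          fix a f assume a: "a \<in> SIAut_carrier X" and f: "f \<in> N"
          have "a \<otimes>\<^bsub>SIAut X\<^esub> f \<otimes>\<^bsub>SIAut X\<^esub> m_inv (SIAut X) a \<in> N"
            using N group.normal_inv_iff[OF grp] a f car by blast
          moreover have "m_inv (SIAut X) a = m_inv (SAut X) a"
            unfolding SIAut_def by (rule m_inv_consistent[OF sub a])
          ultimately show "a \<otimes>\<^bsub>SAut X\<^esub> f \<otimes>\<^bsub>SAut X\<^esub> m_inv (SAut X) a \<in> N" by (simp add: SIAut_def)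
        qed
        then show False using NM ne by blast
      qed
    qed
  qed
qed

end

theorem theorem2:
  fixes A :: "'a set" and X :: "(int \<Rightarrow> 'a) set"
  assumes "mixing_SFT A X"
    and "\<exists>x\<in>X. \<exists>y\<in>X. x \<noteq> y"
  shows "is_simple (SIAut X) \<and> is_monolith (SIAut_carrier X) (SAut X)"
proof -
  have sft: "SFT A X" and sub: "subshift A X" using assms(1) by (simp_all add: mixing_SFT_def SFT_def)
  obtain w where w: "1 \<le> w" "\<forall>y. (\<forall>i. \<exists>z\<in>X. \<forall>j. i \<le> j \<and> j \<le> i + w \<longrightarrow> z j = y j) \<longrightarrow> y \<in> X"
    using SFT_windows[OF sft] by blast
  obtain D where D: "0 \<le> D"
    "\<forall>x\<in>X. \<forall>y\<in>X. \<forall>i. \<exists>z\<in>X. (\<forall>j<i. z j = x j) \<and> (\<forall>j\<ge>i + D. z j = y j)"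
    using mixing_SFT_glue[OF assms(1)] by blast
  interpret compact_mixing_shift X w A D
  proof unfold_locales
    show "y \<in> X" if "\<And>i. \<exists>z\<in>X. \<forall>j. i \<le> j \<and> j \<le> i + w \<longrightarrow> z j = y j" for y
      using w(2) that by blast
  qed (use w(1) D assms(2) subshiftD[OF sub] in blast)+
  show ?thesis by (rule simple_and_monolith)
qed

end
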